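(* For partitions $\mu,\nu$ of $p$ (at most $d$ rows) with $\mu\wedge\nu\neq\emptyset$, let $B^{\mu\nu}$ be the matrix indexed by $\mu\wedge\nu$ with entries $b^{\mu\nu}(\alpha,\alpha')=\frac{1}{d(d^2-1)}\big(d\frac{m_\mu m_\nu}{m_\alpha}\delta^{\alpha\alpha'}-m_\mu\delta^{\mu\nu}\big)$, let $U^{\mu\nu}$ be a unitary matrix indexed by $\mu\wedge\nu$ such that $\sum_{\beta,\beta'}U^{\mu\nu}_{\alpha\beta}\,b^{\mu\nu}(\beta,\beta')\,(U^{\mu\nu})^\dagger_{\beta'\alpha'}=b^{\mu\nu}_{diag}(\alpha)\delta^{\alpha\alpha'}$. For $\beta\in\mu\wedge\nu$, $\beta'\in\mu'\wedge\nu'$ with $b^{\mu\nu}_{diag}(\beta)\neq 0$ and $b^{\mu'\nu'}_{diag}(\beta')\neq0$ define $$\mathcal{G}^{\mu\nu,\,\mu'\nu'}_{ij,\,i'j'}(p-1,\beta,\beta')=\frac{\sum_{\alpha\in\mu\wedge\nu,\ \alpha'\in\mu'\wedge\nu'}(U^{\mu\nu})^\dagger_{\alpha\beta}\,U^{\mu'\nu'}_{\beta'\alpha'}\,H^{\mu\nu,\,\mu'\nu'}_{ij,\,i'j'}(p-1,\alpha,\alpha')}{d\sqrt{b^{\mu\nu}_{diag}(\beta)\,b^{\mu'\nu'}_{diag}(\beta')}}.$$ These operators (the irreducible matrix units of $\mathcal{M}^{(p-1)}$) satisfy $$\mathcal{G}^{\mu\nu,\,\mu'\nu'}_{ij,\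,i'j'}(p-1,\beta,\beta')\,\mathcal{G}^{\tilde\mu\tilde\nu,\,\mu''\nu''}_{kl,\,k'l'}(p-1,\tilde\beta,\tilde\beta')=\delta^{\beta'\tilde\beta}\delta^{\mu'\tilde\mu}\delta^{\nu'\tilde\nu}\delta_{i'k}\delta_{j'l}\,\mathcal{G}^{\mu\nu,\,\mu''\nu''}_{ij,\,k'l'}(p-1,\beta,\tilde\beta').$$
   Context: Fix integers $d\ge 2$, $p\ge 2$. For $\sigma\in\mathcal{S}_p$, $V_\sigma$ is the operator on $(\mathbb{C}^d)^{\otimes p}$ with $V_\sigma(v_1\otimes\cdots\otimes v_p)=v_{\sigma^{-1}(1)}\otimes\cdots\otimes v_{\sigma^{-1}(p)}$. Partitions of $p$ and $p-1$ have at most $d$ rows. $d_\mu$: number of standard Young tableaux of shape $\mu$; $m_\mu,m_\alpha$: numbers of semistandard Young tableaux of the shape with entries in $\{1,\ldots,d\}$. $\varphi^\mu$: irrep $\mu$ of $\mathcal{S}_p$ in Young's orthogonal (Young–Yamanouchi) basis; $E^\mu_{ij}=\frac{d_\mu}{p!}\sum_\sigma\varphi^\mu_{ji}(\sigma^{-1})V_\sigma$ irreducible matrix units. Removing the box containing $p$ from a standard tableau of shape $\mu$ gives one of a shape $\alpha\vdash p-1$ obtained by deleting a box from $\mu$ ($\alpha\in\mu$), identifying indices $i$ of $\mu$ with pairs $(\alpha,i_\alpha)$. For each $\alpha$ fix an index $1_\alpha$; $E^\mu_{i\,1_\alpha}$ is $E^\mu_{ij}$ with $j=(\alpha,1_\alpha)$,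 $E^\mu_{1_\alpha\,i}$ is $E^\mu_{ji}$ with $j=(\alpha,1_\alpha)$. $\mu\wedge\nu=\{\alpha\vdash p-1:\alpha\in\mu,\ \alpha\in\nu\}$. On $(\mathbb{C}^d)^{\otimes 2p}$ (systems $1,\ldots,2p$), $A\otimes B$ has $A$ on systems $1,\ldots,p$ (its $k$-th slot is system $p+1-k$) and $B$ on systems $p+1,\ldots,2p$ (its $k$-th slot is system $p+k$). $W_{a,b}=\sum_{i,j=1}^d|i\rangle\langle j|_a\otimes|i\rangle\langle j|_b$; $V^{(p)}=\prod_{k=1}^{p}W_{p+1-k,p+k}$, $V^{(p-1)}=\prod_{k=1}^{p-1}W_{p+1-k,p+k}$. $F^{\mu\,\mu'}_{ij,\,i'j'}(p)=(E^\mu_{ij}\otimes\mathbb{1})V^{(p)}(E^{\mu'}_{j'i'}\otimes\mathbb{1})$; for $\alpha\in\mu\wedge\nu$, $\alpha'\in\mu'\wedge\nu'$, $F^{\mu\nu,\,\mu'\nu'}_{ij,\,i'j'}(p-1,\alpha,\alpha')=(E^\mu_{i\,1_\alpha}\otimes E^\nu_{j\,1_\alpha})V^{(p-1)}(E^{\mu'}_{1_{\alpha'}\,i'}\otimes E^{\nu'}_{1_{\alpha'}\,j'})$ and $H^{\mu\nu,\,\mu'\nu'}_{ij,\,i'j'}(p-1,\alpha,\alpha')=d\,F^{\mu\nu,\,\mu'\nu'}_{ij,\,i'j'}(p-1,\alpha,\alpha')-F^{\mu\,\mu'}_{ij,\,i'j'}(p)\delta^{\mu\nu}\delta^{\mu'\nu'}$.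 Here $i$ indexes $\mu$, $j$ indexes $\nu$, $i'$ indexes $\mu'$, $j'$ indexes $\nu'$ (and likewise for $k,l,k',l'$ with $\tilde\mu,\tilde\nu,\mu'',\nu''$). $\mathcal{M}^{(p-1)}$ is the linear span of all $(V_\sigma\otimes V_{\sigma'})X(V_\pi\otimes V_{\pi'})$, $\sigma,\sigma',\pi,\pi'\in\mathcal{S}_p$, $X\in\{V^{(p)},V^{(p-1)}\}$. *)

theory Defs
  imports Complex_Main "HOL-Combinatorics.Combinatorics" "HOL-Library.FuncSet"
begin

definition is_partition :: "nat \<Rightarrow> nat \<Rightarrow> nat list \<Rightarrow> bool" where
  "is_partition d n lam \<longleftrightarrow> sorted (rev lam) \<and> (\<forall>x\<in>set lam. 0 < x) \<and> sum_list lam = n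
     \<and> length lam \<le> d"

definition cells :: "nat list \<Rightarrow> (nat \<times> nat) set" where
  "cells lam = {(r, c). r < length lam \<and> c < lam ! r}"

type_synonym tableau = "nat \<times> nat \<Rightarrow> nat"

definition syt :: "nat list \<Rightarrow> tableau set" where
  "syt lam = {T. bij_betw T (cells lam) {1..sum_list lam}
      \<and> (\<forall>c. c \<notin> cells lam \<longrightarrow> T c = 0)
      \<and> (\<forall>r c c'. (r, c) \<in> cells lam \<longrightarrow> (r, c') \<in> cells lam \<longrightarrow> c < c' \<longrightarrow> T (r, c) < T (r, c'))
      \<and> (\<forall>r r' c. (r, c) \<in> cells lam \<longrightarrow> (r', c) \<in> cells lam \<longrightarrow> r < r' \<longrightarrow> T (r, c) < T (r', c))}"

definition ssyt :: "nat \<Rightarrow> nat list \<Rightarrow> tableau set" where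
  "ssyt d lam = {T. (\<forall>c\<in>cells lam. T c \<in> {1..d})
      \<and> (\<forall>c. c \<notin> cells lam \<longrightarrow> T c = 0)
      \<and> (\<forall>r c c'. (r, c) \<in> cells lam \<longrightarrow> (r, c') \<in> cells lam \<longrightarrow> c < c' \<longrightarrow> T (r, c) \<le> T (r, c'))
      \<and> (\<forall>r r' c. (r, c) \<in> cells lam \<longrightarrow> (r', c) \<in> cells lam \<longrightarrow> r < r' \<longrightarrow> T (r, c) < T (r', c))}"

definition dim_irrep :: "nat list \<Rightarrow> nat" where
  "dim_irrep lam = card (syt lam)"

definition mult :: "nat \<Rightarrow> nat list \<Rightarrow> nat" where
  "mult d lam = card (ssyt d lam)"

definition cell_of :: "nat list \<Rightarrow> tableau \<Rightarrow> nat \<Rightarrow> nat \<times> nat" where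
  "cell_of lam T k = (THE c. c \<in> cells lam \<and> T c = k)"

definition content :: "nat list \<Rightarrow> tableau \<Rightarrow> nat \<Rightarrow> int" where
  "content lam T k = int (snd (cell_of lam T k)) - int (fst (cell_of lam T k))"

definition swap_entries :: "nat \<Rightarrow> tableau \<Rightarrow> tableau" where
  "swap_entries k T = (\<lambda>c. if T c = k then Suc k else if T c = Suc k then k else T c)"

text \<open>Matrix of the adjacent transposition (k, k+1) in Young's orthogonal basis:
  entry (S,T) is the coefficient of v_S in phi(s_k) v_T, where
  phi(s_k) v_T = (1/r) v_T + sqrt(1 - 1/r^2) v_{s_k T}, r = c_T(k+1) - c_T(k).\<close>
definition young_gen :: "nat list \<Rightarrow> nat \<Rightarrow> tableau \<Rightarrow> tableau \<Rightarrow> real" where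
  "young_gen lam k S T =
     (let r = real_of_int (content lam T (Suc k) - content lam T k) in
      if S = T then 1 / r
      else if S = swap_entries k T then sqrt (1 - 1 / r\<^sup>2) else 0)"

definition mat_mult_on :: "'i set \<Rightarrow> ('i \<Rightarrow> 'i \<Rightarrow> 'a::comm_semiring_1) \<Rightarrow> ('i \<Rightarrow> 'i \<Rightarrow> 'a) \<Rightarrow> 'i \<Rightarrow> 'i \<Rightarrow> 'a" where
  "mat_mult_on I A B = (\<lambda>x y. \<Sum>z\<in>I. A x z * B z y)"

definition mat_id :: "'i \<Rightarrow> 'i \<Rightarrow> 'a::zero_neq_one" where
  "mat_id = (\<lambda>x y. if x = y then 1 else 0)"

definition adj_word :: "nat list \<Rightarrow> nat \<Rightarrow> nat" where
  "adj_word ks = foldr (\<lambda>k f. transpose k (Suc k) \<circ> f) ks id"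

text \<open>phi^mu(sigma) for sigma a permutation of {1..p}: product of the generator matrices
  along some word in the adjacent transpositions s_1..s_{p-1} representing sigma
  (independent of the word since Young's orthogonal form is a representation).\<close>
definition young_rep :: "nat list \<Rightarrow> (nat \<Rightarrow> nat) \<Rightarrow> tableau \<Rightarrow> tableau \<Rightarrow> real" where
  "young_rep lam \<sigma> =
     (let n = sum_list lam;
          ks = (SOME ks. set ks \<subseteq> {1..<n} \<and> adj_word ks = \<sigma>)
      in foldr (\<lambda>k M. mat_mult_on (syt lam) (young_gen lam k) M) ks mat_id)"

text \<open>Basis of (C^d)^{\<otimes> n}: extensional maps from systems {1..n} to {0..<d}.
  Operators are matrices indexed by this basis.\<close>
type_synonym op = "(nat \<Rightarrow> nat) \<Rightarrow> (nat \<Rightarrow> nat) \<Rightarrow> complex"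

definition basis :: "nat \<Rightarrow> nat \<Rightarrow> (nat \<Rightarrow> nat) set" where
  "basis d n = ({1..n} \<rightarrow>\<^sub>E {0..<d})"

definition op_mult :: "nat \<Rightarrow> nat \<Rightarrow> op \<Rightarrow> op \<Rightarrow> op" where
  "op_mult d n A B = mat_mult_on (basis d n) A B"

definition op_id :: op where
  "op_id = mat_id"

text \<open>V_sigma (v_1 \<otimes> ... \<otimes> v_p) = v_{sigma^-1(1)} \<otimes> ... \<otimes> v_{sigma^-1(p)};
  on basis vectors V_sigma e_x = e_{x \<circ> sigma^-1}.\<close>
definition Vperm :: "(nat \<Rightarrow> nat) \<Rightarrow> op" where
  "Vperm \<sigma> = (\<lambda>y x. if y = x \<circ> inv \<sigma> then 1 else 0)"

definition Eunit :: "nat \<Rightarrow> nat list \<Rightarrow> tableau \<Rightarrow> tableau \<Rightarrow> op" where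
  "Eunit p mu i j = (\<lambda>y x. of_real (real (dim_irrep mu) / fact p) *
      (\<Sum>\<sigma> | \<sigma> permutes {1..p}. of_real (young_rep mu (inv \<sigma>) j i) * Vperm \<sigma> y x))"

text \<open>A \<otimes> B on 2p systems: the k-th slot of A is system p+1-k, the k-th slot of B is system p+k.\<close>
definition slotsA :: "nat \<Rightarrow> (nat \<Rightarrow> nat) \<Rightarrow> nat \<Rightarrow> nat" where
  "slotsA p y = restrict (\<lambda>k. y (p + 1 - k)) {1..p}"

definition slotsB :: "nat \<Rightarrow> (nat \<Rightarrow> nat) \<Rightarrow> nat \<Rightarrow> nat" where
  "slotsB p y = restrict (\<lambda>k. y (p + k)) {1..p}"

definition tensor :: "nat \<Rightarrow> op \<Rightarrow> op \<Rightarrow> op" where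
  "tensor p A B = (\<lambda>y x. A (slotsA p y) (slotsA p x) * B (slotsB p y) (slotsB p x))"

text \<open>W_{a,b} = \<Sum>_{i,j} |i><j|_a \<otimes> |i><j|_b (identity on the other systems).\<close>
definition Wop :: "nat \<Rightarrow> nat \<Rightarrow> op" where
  "Wop a b = (\<lambda>y x. if y a = y b \<and> x a = x b \<and> (\<forall>k. k \<noteq> a \<and> k \<noteq> b \<longrightarrow> y k = x k) then 1 else 0)"

definition Vpart :: "nat \<Rightarrow> nat \<Rightarrow> nat \<Rightarrow> op" where
  "Vpart d p m = foldr (\<lambda>k M. op_mult d (2 * p) (Wop (p + 1 - k) (p + k)) M) [1..<Suc m] op_id"

definition in_shape :: "nat \<Rightarrow> nat list \<Rightarrow> nat list \<Rightarrow> bool" where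
  "in_shape d alpha mu \<longleftrightarrow> is_partition d (sum_list mu - 1) alpha \<and> cells alpha \<subseteq> cells mu"

definition wedge :: "nat \<Rightarrow> nat list \<Rightarrow> nat list \<Rightarrow> nat list set" where
  "wedge d mu nu = {alpha. in_shape d alpha mu \<and> in_shape d alpha nu}"

text \<open>The index (alpha, t) of mu: the standard tableau of shape mu obtained from the
  standard tableau t of shape alpha by putting p into the box mu \ alpha.\<close>
definition ext_tab :: "nat list \<Rightarrow> nat list \<Rightarrow> tableau \<Rightarrow> tableau" where
  "ext_tab mu alpha t = (\<lambda>c. if c \<in> cells mu - cells alpha then sum_list mu else t c)"

definition Fp :: "nat \<Rightarrow> nat \<Rightarrow> nat list \<Rightarrow> nat list \<Rightarrow> tableau \<Rightarrow> tableau \<Rightarrow> tableau \<Rightarrow> tableau \<Rightarrow> op" where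
  "Fp d p mu mu' i j i' j' =
     op_mult d (2 * p) (op_mult d (2 * p) (tensor p (Eunit p mu i j) op_id) (Vpart d p p))
        (tensor p (Eunit p mu' j' i') op_id)"

text \<open>one alpha is the fixed index 1_alpha (a standard tableau of shape alpha).\<close>
definition Fpm1 :: "nat \<Rightarrow> nat \<Rightarrow> (nat list \<Rightarrow> tableau) \<Rightarrow> nat list \<Rightarrow> nat list \<Rightarrow> nat list \<Rightarrow> nat list
    \<Rightarrow> tableau \<Rightarrow> tableau \<Rightarrow> tableau \<Rightarrow> tableau \<Rightarrow> nat list \<Rightarrow> nat list \<Rightarrow> op" where
  "Fpm1 d p one mu nu mu' nu' i j i' j' alpha alpha' =
     op_mult d (2 * p)
       (op_mult d (2 * p)
          (tensor p (Eunit p mu i (ext_tab mu alpha (one alpha))) (Eunit p nu j (ext_tab nu alpha (one alpha))))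
          (Vpart d p (p - 1)))
       (tensor p (Eunit p mu' (ext_tab mu' alpha' (one alpha')) i') (Eunit p nu' (ext_tab nu' alpha' (one alpha')) j'))"

definition Hop :: "nat \<Rightarrow> nat \<Rightarrow> (nat list \<Rightarrow> tableau) \<Rightarrow> nat list \<Rightarrow> nat list \<Rightarrow> nat list \<Rightarrow> nat list
    \<Rightarrow> tableau \<Rightarrow> tableau \<Rightarrow> tableau \<Rightarrow> tableau \<Rightarrow> nat list \<Rightarrow> nat list \<Rightarrow> op" where
  "Hop d p one mu nu mu' nu' i j i' j' alpha alpha' =
     (\<lambda>y x. of_nat d * Fpm1 d p one mu nu mu' nu' i j i' j' alpha alpha' y x
        - (if mu = nu \<and> mu' = nu' then Fp d p mu mu' i j i' j' y x else 0))"

definition bmat :: "nat \<Rightarrow> nat list \<Rightarrow> nat list \<Rightarrow> nat list \<Rightarrow> nat list \<Rightarrow> complex" where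
  "bmat d mu nu alpha alpha' =
     1 / (of_nat d * (of_nat d ^ 2 - 1)) *
       (of_nat d * of_nat (mult d mu) * of_nat (mult d nu) / of_nat (mult d alpha) * (if alpha = alpha' then 1 else 0)
        - of_nat (mult d mu) * (if mu = nu then 1 else 0))"

definition unitary_on :: "'i set \<Rightarrow> ('i \<Rightarrow> 'i \<Rightarrow> complex) \<Rightarrow> bool" where
  "unitary_on I U \<longleftrightarrow> (\<forall>a\<in>I. \<forall>a'\<in>I. (\<Sum>b\<in>I. U a b * cnj (U a' b)) = (if a = a' then 1 else 0))
                    \<and> (\<forall>a\<in>I. \<forall>a'\<in>I. (\<Sum>b\<in>I. cnj (U b a) * U b a') = (if a = a' then 1 else 0))"

definition conj_b :: "nat \<Rightarrow> (nat list \<Rightarrow> nat list \<Rightarrow> nat list \<Rightarrow> nat list \<Rightarrow> complex)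
    \<Rightarrow> nat list \<Rightarrow> nat list \<Rightarrow> nat list \<Rightarrow> nat list \<Rightarrow> complex" where
  "conj_b d U mu nu alpha alpha' =
     (\<Sum>beta\<in>wedge d mu nu. \<Sum>beta'\<in>wedge d mu nu.
        U mu nu alpha beta * bmat d mu nu beta beta' * cnj (U mu nu alpha' beta'))"

definition bdiag :: "nat \<Rightarrow> (nat list \<Rightarrow> nat list \<Rightarrow> nat list \<Rightarrow> nat list \<Rightarrow> complex)
    \<Rightarrow> nat list \<Rightarrow> nat list \<Rightarrow> nat list \<Rightarrow> complex" where
  "bdiag d U mu nu alpha = conj_b d U mu nu alpha alpha"

text \<open>(U^\<dagger>)_{alpha beta} = cnj (U_{beta alpha}).\<close>
definition Gop :: "nat \<Rightarrow> nat \<Rightarrow> (nat list \<Rightarrow> tableau) \<Rightarrow> (nat list \<Rightarrow> nat list \<Rightarrow> nat list \<Rightarrow> nat list \<Rightarrow> complex)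
    \<Rightarrow> nat list \<Rightarrow> nat list \<Rightarrow> nat list \<Rightarrow> nat list
    \<Rightarrow> tableau \<Rightarrow> tableau \<Rightarrow> tableau \<Rightarrow> tableau \<Rightarrow> nat list \<Rightarrow> nat list \<Rightarrow> op" where
  "Gop d p one U mu nu mu' nu' i j i' j' beta beta' =
     (\<lambda>y x. (\<Sum>alpha\<in>wedge d mu nu. \<Sum>alpha'\<in>wedge d mu' nu'.
          cnj (U mu nu beta alpha) * U mu' nu' beta' alpha' * Hop d p one mu nu mu' nu' i j i' j' alpha alpha' y x)
        / (of_nat d * csqrt (bdiag d U mu nu beta * bdiag d U mu' nu' beta')))"

end

theory Submission
  imports "Jordan_Normal_Form.Determinant" Defs
begin

unbundle no m_inv_syntax

text \<open>
  Young's matrices satisfy the Coxeter relations and hence define a representation, in which the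
  Jucys--Murphy elements act diagonally by contents. Since contents separate standard tableaux, Schur's
  lemma and the orthogonality relations follow, hence \<open>E\<^sub>i\<^sub>j E\<^sub>k\<^sub>l = \<delta>\<^sub>j\<^sub>k E\<^sub>i\<^sub>l\<close>. The last Jucys--Murphy element
  also gives the partial trace of a matrix unit over the last system, which is a matrix unit of
  \<open>\<alpha>\<close> scaled by \<open>m\<^sub>\<mu> / m\<^sub>\<alpha>\<close>; here the number of semistandard tableaux enters through the hook content
  formula, proved by writing that number as a determinant of binomial coefficients.

  Put \<open>V\<^sup>p\<^sup>-\<^sup>1 = J J\<^sup>T\<close> and \<open>V\<^sup>p = J W J\<^sup>T\<close>, where \<open>W\<close> is \<open>d\<close> times the maximally entangled projector on the two
  remaining systems. Then \<open>H = L J (d - W) J\<^sup>T R\<close> with \<open>L\<close>, \<open>R\<close> tensor products of matrix units. For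
  matrix units \<open>A\<close>, \<open>B\<close> the operator \<open>J\<^sup>T (A \<otimes> B) J\<close> commutes with all \<open>g \<otimes> h\<close>, \<open>g h\<^sup>T = 1\<close>, so it is
  \<open>u + v W\<close>, and two traces identify \<open>u\<close> with the entry \<open>b(\<alpha>, \<alpha>')\<close>. As
  \<open>(d - W) (u + v W) (d - W) = d u (d - W)\<close>, a product \<open>H H\<close> is \<open>d b(\<alpha>, \<alpha>')\<close> times \<open>H\<close>, and
  diagonalising \<open>b\<close> yields the claim.
\<close>

section \<open>Words in the Coxeter generators\<close>

text \<open>\<open>young_rep\<close> multiplies along a word picked by \<open>SOME\<close>, so the
  presentation of the symmetric group comes first: in any family with the Coxeter relations, words
  for one permutation have one product. The obstacle on Young's side is that swapping two entries
  may leave the standard tableaux; the coefficient of such a swap vanishes, and formal computations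
  with arbitrary fillings stay valid. The constant in \<open>b\<close> solves a 2 by 2 system. For
  the compression u + v W, let T be its trace and S its expectation in the unnormalised maximally
  entangled vector. Then d^2 u + d v = T and d u + d^2 v = S, so d (d^2 - 1) u = d T - S, with T =
  m_mu m_nu / m_alpha for equal shapes alpha and S = m_mu for mu = nu, and 0 otherwise. The
  coefficient v would spoil the product rule; W (d - W) = 0 removes it, which is the reason for the
  combination d F(p-1) - F(p) in \<open>H\<close>. The normalisation of \<open>G\<close> needs care
  because complex square roots are not multiplicative; the entries b_diag are nonnegative reals,
  being values of a Gram form.\<close>

definition wprod :: "(nat \<Rightarrow> 'a \<Rightarrow> 'a) \<Rightarrow> nat list \<Rightarrow> 'a \<Rightarrow> 'a" where
  "wprod g ks = foldr (\<lambda>k F. g k \<circ> F) ks id"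

lemma wprod_Nil [simp]: "wprod g [] = id"
  and wprod_Cons [simp]: "wprod g (k # ks) = g k \<circ> wprod g ks"
  by (simp_all add: wprod_def)

lemma wprod_append: "wprod g (ks @ ls) = wprod g ks \<circ> wprod g ls"
  by (induction ks) (auto simp: o_assoc)

lemma adj_word_eq_wprod: "adj_word ks = wprod (\<lambda>k. transpose k (Suc k)) ks"
  by (simp add: adj_word_def wprod_def)

text \<open>Functions under composition on an arbitrary type, so that transpositions of
  \<open>nat\<close> and Young's operators on tableau functions are instances of one notion. Indices
  run over 1..n-1, matching the symmetric group on \<open>{1..n}\<close>.\<close>

definition coxeter :: "nat \<Rightarrow> (nat \<Rightarrow> 'a \<Rightarrow> 'a) \<Rightarrow> bool" where
  "coxeter n g \<longleftrightarrow>
     (\<forall>k. 1 \<le> k \<longrightarrow> k < n \<longrightarrow> g k \<circ> g k = id) \<and>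
     (\<forall>k l. 1 \<le> k \<longrightarrow> Suc k < l \<longrightarrow> l < n \<longrightarrow> g k \<circ> g l = g l \<circ> g k) \<and>
     (\<forall>k. 1 \<le> k \<longrightarrow> Suc k < n \<longrightarrow> g k \<circ> g (Suc k) \<circ> g k = g (Suc k) \<circ> g k \<circ> g (Suc k))"

lemma coxeter_involution: "coxeter n g \<Longrightarrow> 1 \<le> k \<Longrightarrow> k < n \<Longrightarrow> g k \<circ> g k = id"
  unfolding coxeter_def by blast

lemma coxeter_braid:
  "coxeter n g \<Longrightarrow> 1 \<le> k \<Longrightarrow> Suc k < n \<Longrightarrow>
    g k \<circ> g (Suc k) \<circ> g k = g (Suc k) \<circ> g k \<circ> g (Suc k)"
  unfolding coxeter_def by blast

lemma coxeter_mono: "coxeter n g \<Longrightarrow> m \<le> n \<Longrightarrow> coxeter m g"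
  unfolding coxeter_def by (meson less_le_trans)

lemma coxeter_transpose: "coxeter n (\<lambda>k. transpose k (Suc k))"
  unfolding coxeter_def
  by (intro conjI allI impI ext) (auto simp: transpose_def)

lemma wprod_commute:
  assumes "\<And>k. k \<in> set ks \<Longrightarrow> x \<circ> g k = g k \<circ> x"
  shows "x \<circ> wprod g ks = wprod g ks \<circ> x"
  using assms
proof (induction ks)
  case (Cons k ks)
  have "x \<circ> wprod g (k # ks) = (x \<circ> g k) \<circ> wprod g ks" by (simp add: o_assoc)
  also have "\<dots> = g k \<circ> (x \<circ> wprod g ks)"
    by (subst Cons.prems[of k]) (simp_all add: o_assoc)
  also have "x \<circ> wprod g ks = wprod g ks \<circ> x" by (rule Cons.IH) (use Cons.prems in auto)
  finally have "x \<circ> wprod g (k # ks) = g k \<circ> (wprod g ks \<circ> x)" .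
  also have "\<dots> = wprod g (k # ks) \<circ> x" by (simp add: o_assoc)
  finally show ?case .
qed simp

lemma surj_comp_cancel: "f \<circ> h = g \<circ> h \<Longrightarrow> surj h \<Longrightarrow> f = g"
  by (metis comp_assoc comp_id surj_iff)

lemma coxeter_commute:
  assumes "coxeter n g" "1 \<le> k" "k < n" "1 \<le> l" "l < n" "Suc k < l \<or> Suc l < k"
  shows "g k \<circ> g l = g l \<circ> g k"
  using assms unfolding coxeter_def by metis

text \<open>Every word in the first \<open>n\<close> generators can be brought into the form
  \<open>w \<circ> (g\<^sub>n \<circ> \<dots> \<circ> g\<^sub>m)\<close> with \<open>w\<close> a word in the first \<open>n - 1\<close> generators; the next lemma
  multiplies such a form by one more generator.\<close>

lemma wprod_desc_mult:
  fixes g :: "nat \<Rightarrow> 'a \<Rightarrow> 'a"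
  assumes cox: "coxeter (Suc n) g" and m: "1 \<le> m" "m \<le> Suc n" and j: "1 \<le> j" "j \<le> n"
  shows "wprod g (rev [m..<Suc n]) \<circ> g j =
    wprod g (if Suc j < m then [j] else if j \<le> m then [] else [j - 1]) \<circ>
    wprod g (rev [(if Suc j = m then j else if j = m then Suc m else m)..<Suc n])"
    (is "?D m \<circ> _ = wprod g ?l \<circ> ?D ?m")
proof -
  consider "Suc j < m" | "Suc j = m" | "j = m" | "m < j" by linarith
  then show ?thesis
  proof cases
    case 1
    have "g j \<circ> wprod g (rev [m..<Suc n]) = wprod g (rev [m..<Suc n]) \<circ> g j"
      using 1 m j by (intro wprod_commute coxeter_commute[OF cox]) auto
    moreover have "?l = [j]" "?m = m" using 1 by auto
    ultimately show ?thesis by (simp only: wprod_Cons wprod_Nil comp_id)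
  next
    case 2
    have "[j..<Suc n] = j # [m..<Suc n]" using 2 j by (simp add: upt_conv_Cons)
    then have "wprod g (rev [j..<Suc n]) = wprod g (rev [m..<Suc n]) \<circ> g j"
      by (simp only: rev.simps wprod_append wprod_Cons wprod_Nil comp_id)
    moreover have "?l = []" "?m = j" using 2 by auto
    ultimately show ?thesis by (simp only: wprod_Nil id_comp)
  next
    case 3
    have "[m..<Suc n] = m # [Suc m..<Suc n]" using 3 j by (simp add: upt_conv_Cons)
    moreover have "g j \<circ> g j = id" using coxeter_involution[OF cox] j by simp
    ultimately have "wprod g (rev [m..<Suc n]) \<circ> g j = wprod g (rev [Suc m..<Suc n])"
      by (simp only: rev.simps wprod_append wprod_Cons wprod_Nil comp_id comp_assoc 3)
    moreover have "?l = []" "?m = Suc m" using 3 by auto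
    ultimately show ?thesis by (simp only: wprod_Nil id_comp)
  next
    case 4
    \<comment> \<open>Here \<open>j\<close> lies inside the chain: \<open>g j\<close> passes the
      lower part \<open>?B\<close>, the braid relation turns \<open>g (Suc i) g i g (Suc i)\<close>
      into \<open>g i g (Suc i) g i\<close>, and the new \<open>g i\<close> passes the upper part
      \<open>?A\<close> to the far left.\<close>
    define i where "i = j - 1"
    have ji: "j = Suc i" "m \<le> i" using 4 by (auto simp: i_def)
    have "[m..<Suc n] = [m..<i] @ [i..<Suc n]"
      using ji j upt_add_eq_append[of m i "Suc n - i"] by simp
    also have "[i..<Suc n] = i # Suc i # [Suc (Suc i)..<Suc n]"
      using ji j by (simp add: upt_conv_Cons)
    finally have split: "rev [m..<Suc n] = rev [Suc (Suc i)..<Suc n] @ [Suc i, i] @ rev [m..<i]"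
      by simp
    let ?A = "wprod g (rev [Suc (Suc i)..<Suc n])" and ?B = "wprod g (rev [m..<i])"
    have B: "?B \<circ> g (Suc i) = g (Suc i) \<circ> ?B"
      by (rule wprod_commute[symmetric], rule coxeter_commute[OF cox]) (use ji m j in auto)
    have A: "?A \<circ> g i = g i \<circ> ?A"
      by (rule wprod_commute[symmetric], rule coxeter_commute[OF cox]) (use ji m j in auto)
    have braid: "g i \<circ> g (Suc i) \<circ> g i = g (Suc i) \<circ> g i \<circ> g (Suc i)"
      by (rule coxeter_braid[OF cox]) (use ji m j in auto)
    have "wprod g (rev [m..<Suc n]) \<circ> g j = ?A \<circ> (g (Suc i) \<circ> g i) \<circ> (?B \<circ> g (Suc i))"
      by (simp only: split wprod_append wprod_Cons wprod_Nil ji o_assoc comp_id)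
    also have "\<dots> = ?A \<circ> (g (Suc i) \<circ> g i \<circ> g (Suc i)) \<circ> ?B"
      by (simp only: B o_assoc)
    also have "\<dots> = (?A \<circ> g i) \<circ> g (Suc i) \<circ> g i \<circ> ?B"
      by (simp only: braid[symmetric] o_assoc)
    also have "\<dots> = g i \<circ> wprod g (rev [m..<Suc n])"
      by (simp only: A split wprod_append wprod_Cons wprod_Nil o_assoc comp_id)
    finally have "wprod g (rev [m..<Suc n]) \<circ> g j = g i \<circ> wprod g (rev [m..<Suc n])" .
    moreover have "?l = [i]" "?m = m" using ji by auto
    ultimately show ?thesis by (simp only: wprod_Cons wprod_Nil comp_id)
  qed
qed

text \<open>The rewriting looks only at indices, so the same \<open>ls\<close> and \<open>m\<close>
  serve two unrelated families. Taking transpositions as one of them lets a permutation control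
  words in the other.\<close>

lemma wprod_normal_form:
  fixes g :: "nat \<Rightarrow> 'a \<Rightarrow> 'a" and h :: "nat \<Rightarrow> 'b \<Rightarrow> 'b"
  assumes g: "coxeter (Suc n) g" and h: "coxeter (Suc n) h" and ks: "set ks \<subseteq> {1..<Suc n}"
  shows "\<exists>ls m. set ls \<subseteq> {1..<n} \<and> 1 \<le> m \<and> m \<le> Suc n \<and>
    wprod g ks = wprod g ls \<circ> wprod g (rev [m..<Suc n]) \<and>
    wprod h ks = wprod h ls \<circ> wprod h (rev [m..<Suc n])"
  using ks
proof (induction ks rule: rev_induct)
  case Nil
  show ?case by (rule exI[of _ "[]"], rule exI[of _ "Suc n"]) simp
next
  case (snoc j ks)
  have "set ks \<subseteq> {1..<Suc n}" using snoc.prems by auto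
  from snoc.IH[OF this] obtain ls m where IH: "set ls \<subseteq> {1..<n}" "1 \<le> m" "m \<le> Suc n"
    "wprod g ks = wprod g ls \<circ> wprod g (rev [m..<Suc n])"
    "wprod h ks = wprod h ls \<circ> wprod h (rev [m..<Suc n])" by blast
  have j: "1 \<le> j" "j \<le> n" using snoc.prems by auto
  let ?l = "if Suc j < m then [j] else if j \<le> m then [] else [j - 1]"
  let ?m = "if Suc j = m then j else if j = m then Suc m else m"
  have *: "wprod f (ks @ [j]) = wprod f (ls @ ?l) \<circ> wprod f (rev [?m..<Suc n])"
    if "coxeter (Suc n) f" "wprod f ks = wprod f ls \<circ> wprod f (rev [m..<Suc n])"
    for f :: "nat \<Rightarrow> 'c \<Rightarrow> 'c"
  proof -
    have "wprod f (ks @ [j]) = wprod f ls \<circ> (wprod f (rev [m..<Suc n]) \<circ> f j)"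
      by (simp only: wprod_append that(2) wprod_Cons wprod_Nil o_assoc comp_id)
    also have "\<dots> = wprod f (ls @ ?l) \<circ> wprod f (rev [?m..<Suc n])"
      by (simp only: wprod_desc_mult[OF that(1) IH(2,3) j] wprod_append o_assoc)
    finally show ?thesis .
  qed
  have "set (ls @ ?l) \<subseteq> {1..<n}" "1 \<le> ?m" "?m \<le> Suc n" using IH j by auto
  with *[OF g IH(4)] *[OF h IH(5)] show ?case by blast
qed

text \<open>The descending chain is a cycle that lifts \<open>m\<close> to the top. Words in the
  lower generators fix the top, so \<open>m\<close> can be recovered from the whole permutation as
  the preimage of \<open>Suc n\<close>.\<close>

lemma wprod_transpose_desc:
  "m \<le> Suc n \<Longrightarrow> wprod (\<lambda>k. transpose k (Suc k)) (rev [m..<Suc n]) m = Suc n"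
proof (induction n)
  case (Suc n)
  show ?case
  proof (cases "m = Suc (Suc n)")
    case False
    then have "[m..<Suc (Suc n)] = [m..<Suc n] @ [Suc n]" using Suc.prems by simp
    then show ?thesis using Suc False by (simp del: upt_Suc)
  qed simp
qed (cases "m = 0"; simp)

lemma adj_word_permutes: "set ks \<subseteq> {1..<n} \<Longrightarrow> adj_word ks permutes {1..n}"
proof (induction ks)
  case Nil
  show ?case unfolding adj_word_eq_wprod wprod_Nil by (rule permutes_id)
next
  case (Cons k ks)
  then have "transpose k (Suc k) permutes {1..n}" by (intro permutes_swap_id) auto
  moreover have "adj_word ks permutes {1..n}" using Cons by auto
  ultimately show ?case
    unfolding adj_word_eq_wprod wprod_Cons by (rule permutes_compose[rotated])
qed

lemma adj_word_desc_permutes: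
  "1 \<le> m \<Longrightarrow> wprod (\<lambda>k. transpose k (Suc k)) (rev [m..<Suc n]) permutes {1..Suc n}"
  by (rule adj_word_permutes[unfolded adj_word_eq_wprod]) auto

text \<open>Normalise both words for \<open>g\<close> and for the transpositions simultaneously. The
  permutation determines the chain through the preimage of \<open>Suc n\<close>; cancelling it
  leaves words in fewer generators for one permutation, to which induction applies.\<close>

theorem coxeter_word_unique:
  assumes "coxeter n g" "set ks \<subseteq> {1..<n}" "set ls \<subseteq> {1..<n}" "adj_word ks = adj_word ls"
  shows "wprod g ks = wprod g ls"
  using assms
proof (induction n arbitrary: ks ls)
  case (Suc n)
  let ?t = "\<lambda>k. transpose k (Suc k)"
  obtain ks1 m where k: "set ks1 \<subseteq> {1..<n}" "1 \<le> m" "m \<le> Suc n"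
    "wprod g ks = wprod g ks1 \<circ> wprod g (rev [m..<Suc n])"
    "wprod ?t ks = wprod ?t ks1 \<circ> wprod ?t (rev [m..<Suc n])"
    using wprod_normal_form[OF Suc.prems(1) coxeter_transpose Suc.prems(2)] by blast
  obtain ls1 l where l: "set ls1 \<subseteq> {1..<n}" "1 \<le> l" "l \<le> Suc n"
    "wprod g ls = wprod g ls1 \<circ> wprod g (rev [l..<Suc n])"
    "wprod ?t ls = wprod ?t ls1 \<circ> wprod ?t (rev [l..<Suc n])"
    using wprod_normal_form[OF Suc.prems(1) coxeter_transpose Suc.prems(3)] by blast
  have fixn: "wprod ?t us (Suc n) = Suc n" if "set us \<subseteq> {1..<n}" for us
    using adj_word_permutes[OF that] by (auto simp: adj_word_eq_wprod permutes_def)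
  have eq: "wprod ?t ks = wprod ?t ls" using Suc.prems(4) by (simp add: adj_word_eq_wprod)
  have "wprod ?t ks m = Suc n" using k fixn by (simp add: wprod_transpose_desc del: upt_Suc)
  moreover have "wprod ?t ls l = Suc n" using l fixn by (simp add: wprod_transpose_desc del: upt_Suc)
  moreover have "inj (wprod ?t ls)"
    using adj_word_permutes[OF Suc.prems(3)] by (auto simp: adj_word_eq_wprod permutes_inj)
  ultimately have ml: "m = l" using eq by (metis injD)
  have "surj (wprod ?t (rev [m..<Suc n]))"
    using adj_word_desc_permutes[OF k(2)] by (rule permutes_surj)
  have "wprod ?t ks1 \<circ> wprod ?t (rev [m..<Suc n]) = wprod ?t ls1 \<circ> wprod ?t (rev [m..<Suc n])"
    using eq k(5) l(5) ml by (simp only:)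
  then have "wprod ?t ks1 = wprod ?t ls1"
    by (rule surj_comp_cancel) fact
  then have "wprod g ks1 = wprod g ls1"
    using Suc.IH[OF coxeter_mono[OF Suc.prems(1)] k(1) l(1)] by (simp add: adj_word_eq_wprod)
  then show ?case using k(4) l(4) ml by (simp only:)
qed simp

lemma ex_adj_word:
  "\<sigma> permutes {1..n} \<Longrightarrow> \<exists>ks. set ks \<subseteq> {1..<n} \<and> adj_word ks = \<sigma>"
proof (induction n arbitrary: \<sigma>)
  case 0
  then have "\<sigma> = id" by simp
  then show ?case by (intro exI[of _ "[]"]) (simp add: adj_word_eq_wprod)
next
  case (Suc n)
  define m where "m = inv \<sigma> (Suc n)"
  have "m \<in> {1..Suc n}"
    using permutes_in_image[OF permutes_inv[OF Suc.prems], of "Suc n"] by (simp add: m_def)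
  then have m: "1 \<le> m" "m \<le> Suc n" by auto
  define D where "D = adj_word (rev [m..<Suc n])"
  have D: "D permutes {1..Suc n}"
    using adj_word_desc_permutes[OF m(1)] by (simp add: D_def adj_word_eq_wprod del: upt_Suc)
  have Dm: "D m = Suc n" using wprod_transpose_desc[OF m(2)] by (simp add: D_def adj_word_eq_wprod)
  have sm: "\<sigma> m = Suc n" using Suc.prems by (simp add: m_def permutes_inverses)
  have per: "\<sigma> \<circ> inv D permutes {1..Suc n}" using Suc.prems D by (simp add: permutes_compose permutes_inv)
  have "(\<sigma> \<circ> inv D) (Suc n) = Suc n" using Dm sm D by (metis comp_apply permutes_inverses(2))
  then have "\<sigma> \<circ> inv D permutes {1..n}"
    by (intro permutes_superset[OF per]) (auto simp: le_Suc_eq)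
  from Suc.IH[OF this] obtain ks where ks: "set ks \<subseteq> {1..<n}" "adj_word ks = \<sigma> \<circ> inv D" by blast
  have "adj_word (ks @ rev [m..<Suc n]) = \<sigma> \<circ> inv D \<circ> D"
    using ks(2) by (simp add: adj_word_eq_wprod wprod_append D_def del: upt_Suc)
  also have "\<dots> = \<sigma>" using D by (simp add: comp_assoc permutes_inv_o)
  finally show ?case using ks(1) m by (intro exI[of _ "ks @ rev [m..<Suc n]"]) auto
qed

section \<open>Young's orthogonal form\<close>

text \<open>Bijectivity is separated from the order conditions because it survives a swap of
  consecutive entries whether or not standardness does.\<close>

definition fillings :: "nat list \<Rightarrow> tableau set" where
  "fillings lam = {T. bij_betw T (cells lam) {1..sum_list lam} \<and> (\<forall>c. c \<notin> cells lam \<longrightarrow> T c = 0)}"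

lemma finite_cells [simp]: "finite (cells lam)"
proof -
  have "cells lam = (SIGMA r:{..<length lam}. {..<lam ! r})" by (auto simp: cells_def)
  then show ?thesis by simp
qed

lemma syt_fillings: "T \<in> syt lam \<Longrightarrow> T \<in> fillings lam"
  by (simp add: syt_def fillings_def)

lemma finite_fillings: "finite (fillings lam)"
proof (rule finite_subset)
  show "fillings lam \<subseteq> {T. \<forall>c. (c \<in> cells lam \<longrightarrow> T c \<in> {1..sum_list lam}) \<and>
      (c \<notin> cells lam \<longrightarrow> T c = 0)}"
    by (auto simp: fillings_def bij_betw_def)
  show "finite \<dots>" by (rule finite_set_of_finite_funs) auto
qed

lemma finite_syt [simp]: "finite (syt lam)"
  by (rule finite_subset[OF _ finite_fillings[of lam]]) (auto intro: syt_fillings)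

lemma filling_bounds: "T \<in> fillings lam \<Longrightarrow> c \<in> cells lam \<Longrightarrow> 1 \<le> T c \<and> T c \<le> sum_list lam"
  by (auto simp: fillings_def bij_betw_def)

lemma filling_inj:
  "T \<in> fillings lam \<Longrightarrow> c \<in> cells lam \<Longrightarrow> c' \<in> cells lam \<Longrightarrow> T c = T c' \<Longrightarrow> c = c'"
  by (auto simp: fillings_def bij_betw_def inj_on_def)

lemma cell_of_eq:
  "T \<in> fillings lam \<Longrightarrow> c \<in> cells lam \<Longrightarrow> cell_of lam T (T c) = c"
  unfolding cell_of_def by (rule the_equality) (auto intro: filling_inj)

lemma cell_of_props:
  assumes "T \<in> fillings lam" "1 \<le> k" "k \<le> sum_list lam"
  shows "cell_of lam T k \<in> cells lam" "T (cell_of lam T k) = k"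
proof -
  have "k \<in> T ` cells lam" using assms by (auto simp: fillings_def bij_betw_def)
  then obtain c where c: "c \<in> cells lam" "T c = k" by auto
  then have "cell_of lam T k = c" using cell_of_eq[OF assms(1) c(1)] by simp
  with c show "cell_of lam T k \<in> cells lam" "T (cell_of lam T k) = k" by simp_all
qed

lemma swap_entries_eq: "swap_entries k T = transpose k (Suc k) \<circ> T"
  by (auto simp: swap_entries_def transpose_def fun_eq_iff)

lemma swap_entries_twice [simp]: "swap_entries k (swap_entries k T) = T"
  by (auto simp: swap_entries_def fun_eq_iff)

lemma swap_entries_eq_iff: "S = swap_entries k T \<longleftrightarrow> T = swap_entries k S"
  by (metis swap_entries_twice)

lemma swap_entries_fillings:
  assumes T: "T \<in> fillings lam" and k: "1 \<le> k" "Suc k \<le> sum_list lam"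
  shows "swap_entries k T \<in> fillings lam"
proof -
  have "bij_betw (transpose k (Suc k)) {1..sum_list lam} {1..sum_list lam}"
    by (rule permutes_imp_bij, rule permutes_swap_id) (use k in auto)
  then have "bij_betw (swap_entries k T) (cells lam) {1..sum_list lam}"
    unfolding swap_entries_eq using T by (auto simp: fillings_def intro: bij_betw_trans)
  then show ?thesis using T k by (auto simp: fillings_def swap_entries_def)
qed

lemma transpose_eq_iff': "transpose a b x = y \<longleftrightarrow> x = transpose a b y"
  by (auto simp: transpose_def)

lemma cell_of_swap: "cell_of lam (swap_entries k T) l = cell_of lam T (transpose k (Suc k) l)"
  by (simp add: cell_of_def swap_entries_eq transpose_eq_iff')

lemma content_swap: "content lam (swap_entries k T) l = content lam T (transpose k (Suc k) l)"
  by (simp add: content_def cell_of_swap)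

lemma is_partition_antimono:
  assumes "is_partition d n lam" "r \<le> r'" "r' < length lam"
  shows "lam ! r' \<le> lam ! r"
proof -
  have "sorted_wrt (\<ge>) lam"
    using assms(1) by (simp add: is_partition_def sorted_wrt_rev)
  with assms(2,3) show ?thesis
    by (cases "r = r'") (auto simp: sorted_wrt_iff_nth_less)
qed

lemma cells_down_closed:
  assumes "is_partition d n lam" "(r, c) \<in> cells lam" "r' \<le> r" "c' \<le> c"
  shows "(r', c') \<in> cells lam"
  using assms is_partition_antimono[OF assms(1,3)] by (auto simp: cells_def)

lemma is_partition_sum: "is_partition d n lam \<Longrightarrow> sum_list lam = n"
  by (simp add: is_partition_def)

lemma syt_mono:
  assumes P: "is_partition d n lam" and T: "T \<in> syt lam"
    and c: "(r', c') \<in> cells lam" and le: "r \<le> r'" "c \<le> c'" and ne: "(r, c) \<noteq> (r', c')"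
  shows "T (r, c) < T (r', c')"
proof -
  have cells: "(r, c') \<in> cells lam" "(r, c) \<in> cells lam"
    using cells_down_closed[OF P c] le by auto
  have "T (r, c) \<le> T (r, c')" using T cells le(2) by (cases "c = c'") (auto simp: syt_def le_less)
  moreover have "T (r, c') \<le> T (r', c')" using T cells c le(1) by (cases "r = r'") (auto simp: syt_def le_less)
  moreover have "T (r, c) < T (r, c') \<or> T (r, c') < T (r', c')"
    using T cells c le ne by (cases "c = c'") (auto simp: syt_def le_less)
  ultimately show ?thesis by linarith
qed

text \<open>The two remaining corners of the rectangle lie strictly between and carry different
  entries, whence a gap of at least three.\<close>

lemma syt_diag_gap:
  assumes P: "is_partition d n lam" and T: "T \<in> syt lam"
    and c: "(r', c') \<in> cells lam" and le: "r < r'" "c < c'"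
  shows "T (r, c) + 3 \<le> T (r', c')"
proof -
  have cells: "(r, c') \<in> cells lam" "(r', c) \<in> cells lam" "(r, c) \<in> cells lam"
    using cells_down_closed[OF P c] le by auto
  have "T (r, c') \<noteq> T (r', c)"
    using filling_inj[OF syt_fillings[OF T] cells(1,2)] le by auto
  moreover have "T (r, c) < T (r, c')" "T (r, c') < T (r', c')" "T (r, c) < T (r', c)"
     "T (r', c) < T (r', c')"
    using syt_mono[OF P T] cells c le by auto
  ultimately show ?thesis by linarith
qed

lemma content_eq: "content lam T k = int c - int r" if "cell_of lam T k = (r, c)"
  using that by (simp add: content_def)

text \<open>Equal contents put both cells on one diagonal, where entries differ by at least three.
  The range \<open>l \<le> k + 2\<close> is what the braid relation needs: all axial distances among
  three consecutive entries must be invertible.\<close>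

lemma content_neq:
  assumes P: "is_partition d n lam" and T: "T \<in> syt lam"
    and k: "1 \<le> k" "k < l" "l \<le> n" "l \<le> k + 2"
  shows "content lam T k \<noteq> content lam T l"
proof
  assume eq: "content lam T k = content lam T l"
  obtain r c r' c' where c: "cell_of lam T k = (r, c)" "cell_of lam T l = (r', c')"
    by fastforce
  have n: "sum_list lam = n" by (rule is_partition_sum[OF P])
  have *: "(r, c) \<in> cells lam" "T (r, c) = k" "(r', c') \<in> cells lam" "T (r', c') = l"
    using cell_of_props[OF syt_fillings[OF T], of k] cell_of_props[OF syt_fillings[OF T], of l]
      k n c by simp_all
  have e: "int c - int r = int c' - int r'" using eq c by (simp add: content_eq)
  consider "r < r'" "c < c'" | "r' < r" "c' < c" | "r = r'" "c = c'" using e by linarith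
  then show False
    using syt_diag_gap[OF P T *(3)] syt_diag_gap[OF P T *(1)] * k by cases fastforce+
qed

text \<open>Nothing fits between consecutive entries, so comparable cells of \<open>k\<close> and
  \<open>k + 1\<close> are neighbours in a row or column, with contents differing by one; for
  incomparable cells the contents differ by at least two.\<close>

lemma swap_syt_iff:
  assumes P: "is_partition d n lam" and T: "T \<in> syt lam" and k: "1 \<le> k" "Suc k \<le> n"
  shows "swap_entries k T \<in> syt lam \<longleftrightarrow> \<bar>content lam T (Suc k) - content lam T k\<bar> \<noteq> 1"
proof -
  obtain r c r' c' where c: "cell_of lam T k = (r, c)" "cell_of lam T (Suc k) = (r', c')"
    by fastforce
  have n: "sum_list lam = n" by (rule is_partition_sum[OF P])
  have *: "(r, c) \<in> cells lam" "T (r, c) = k" "(r', c') \<in> cells lam" "T (r', c') = Suc k"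
    using cell_of_props[OF syt_fillings[OF T], of k] cell_of_props[OF syt_fillings[OF T], of "Suc k"]
      k n c by simp_all
  let ?S = "swap_entries k T"
  have S: "?S \<in> fillings lam" using swap_entries_fillings[OF syt_fillings[OF T]] k n by simp
  have uniq: "(a, b) = (r, c)" if "(a, b) \<in> cells lam" "T (a, b) = k" for a b
    using filling_inj[OF syt_fillings[OF T] that(1) *(1)] that *(2) by simp
  have uniq': "(a, b) = (r', c')" if "(a, b) \<in> cells lam" "T (a, b) = Suc k" for a b
    using filling_inj[OF syt_fillings[OF T] that(1) *(3)] that *(4) by simp
  have swapT: "T a < T b \<Longrightarrow> \<not> ?S a < ?S b \<Longrightarrow> T a = k \<and> T b = Suc k" for a b
    by (auto simp: swap_entries_def split: if_splits)
  show ?thesis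
  proof
    assume SS: "?S \<in> syt lam"
    have "?S (r, c) = Suc k" "?S (r', c') = k" using * by (auto simp: swap_entries_def)
    then have sw: "\<not> (r \<le> r' \<and> c \<le> c')"
      using syt_mono[OF P SS *(3), of r c] *(2,4) by (cases "(r, c) = (r', c')") auto
    have "\<not> (r' \<le> r \<and> c' \<le> c)"
      using syt_mono[OF P T *(1), of r' c'] *(2,4) by (cases "(r, c) = (r', c')") auto
    with sw show "\<bar>content lam T (Suc k) - content lam T k\<bar> \<noteq> 1"
      using c by (simp add: content_eq) linarith
  next
    assume ne: "\<bar>content lam T (Suc k) - content lam T k\<bar> \<noteq> 1"
    have row: "?S (a, b) < ?S (a, b')"
      if "(a, b) \<in> cells lam" "(a, b') \<in> cells lam" "b < b'" for a b b'
    proof (rule ccontr)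
      assume "\<not> ?S (a, b) < ?S (a, b')"
      moreover have "T (a, b) < T (a, b')" using syt_mono[OF P T that(2)] that(3) by simp
      ultimately have "T (a, b) = k \<and> T (a, b') = Suc k" by (rule swapT[rotated])
      with uniq uniq' that have e: "a = r" "b = c" "a = r'" "b' = c'" by auto
      have "c' = Suc c"
      proof (rule ccontr)
        assume "c' \<noteq> Suc c"
        then have "Suc c < c'" using that e by simp
        then have "(r, Suc c) \<in> cells lam" using cells_down_closed[OF P *(3)] e by auto
        then have "T (r, c) < T (r, Suc c)" "T (r, Suc c) < T (r', c')"
          using syt_mono[OF P T, of r "Suc c" r c] syt_mono[OF P T *(3), of r "Suc c"]
            e \<open>Suc c < c'\<close> by auto
        then show False using * e by simp
      qed
      then show False using ne c e by (simp add: content_eq)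
    qed
    have col: "?S (a, b) < ?S (a', b)"
      if "(a, b) \<in> cells lam" "(a', b) \<in> cells lam" "a < a'" for a a' b
    proof (rule ccontr)
      assume "\<not> ?S (a, b) < ?S (a', b)"
      moreover have "T (a, b) < T (a', b)" using syt_mono[OF P T that(2)] that(3) by simp
      ultimately have "T (a, b) = k \<and> T (a', b) = Suc k" by (rule swapT[rotated])
      with uniq uniq' that have e: "a = r" "b = c" "a' = r'" "b = c'" by auto
      have "r' = Suc r"
      proof (rule ccontr)
        assume "r' \<noteq> Suc r"
        then have "Suc r < r'" using that e by simp
        then have "(Suc r, c) \<in> cells lam" using cells_down_closed[OF P *(3)] e by auto
        then have "T (r, c) < T (Suc r, c)" "T (Suc r, c) < T (r', c')"
          using syt_mono[OF P T, of "Suc r" c r c] syt_mono[OF P T *(3), of "Suc r" c]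
            e \<open>Suc r < r'\<close> by auto
        then show False using * e by simp
      qed
      then show False using ne c e by (simp add: content_eq)
    qed
    show "?S \<in> syt lam" using S row col by (auto simp: syt_def fillings_def)
  qed
qed

section \<open>Young's generators as operators, and their Coxeter relations\<close>

definition ct :: "nat list \<Rightarrow> tableau \<Rightarrow> nat \<Rightarrow> real" where
  "ct lam T k = real_of_int (content lam T k)"

definition axial :: "nat list \<Rightarrow> nat \<Rightarrow> tableau \<Rightarrow> real" where
  "axial lam k T = ct lam T (Suc k) - ct lam T k"

definition offd :: "real \<Rightarrow> real" where
  "offd x = sqrt (1 - 1 / x\<^sup>2)"

text \<open>Acting on functions rather than as a finite matrix turns products into composition.
  Outside \<open>syt lam\<close> it is the identity, so that the Coxeter relations hold at every
  argument and not only at standard tableaux.\<close>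

definition young_op :: "nat list \<Rightarrow> nat \<Rightarrow> (tableau \<Rightarrow> real) \<Rightarrow> tableau \<Rightarrow> real" where
  "young_op lam k f S =
    (if S \<in> syt lam
     then f S / axial lam k S + offd (axial lam k S) * f (swap_entries k S) else f S)"

lemma ct_swap: "ct lam (swap_entries k T) l = ct lam T (transpose k (Suc k) l)"
  by (simp add: ct_def content_swap)

lemma axial_swap [simp]: "axial lam k (swap_entries k T) = - axial lam k T"
  by (simp add: axial_def ct_swap)

lemma offd_minus [simp]: "offd (- x) = offd x"
  by (simp add: offd_def)

lemma axial_int: "axial lam k T = real_of_int (content lam T (Suc k) - content lam T k)"
  by (simp add: axial_def ct_def)

lemma offd_sq: "x = real_of_int i \<Longrightarrow> i \<noteq> 0 \<Longrightarrow> offd x * offd x = 1 - 1 / x\<^sup>2"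
proof -
  assume "x = real_of_int i" "i \<noteq> 0"
  moreover have "1 \<le> i\<^sup>2" using \<open>i \<noteq> 0\<close> by (simp add: int_one_le_iff_zero_less)
  then have "1 \<le> (real_of_int i)\<^sup>2" by (metis of_int_le_iff of_int_1 of_int_power)
  ultimately show ?thesis by (simp add: offd_def)
qed

lemma offd_zero:
  assumes "is_partition d n lam" "T \<in> syt lam" "1 \<le> k" "Suc k \<le> n" "swap_entries k T \<notin> syt lam"
  shows "offd (axial lam k T) = 0"
proof -
  have "\<bar>content lam T (Suc k) - content lam T k\<bar> = 1" using swap_syt_iff assms by blast
  then have "content lam T (Suc k) - content lam T k = 1 \<or>
      content lam T (Suc k) - content lam T k = -1" by linarith
  then have "(axial lam k T)\<^sup>2 = 1" unfolding axial_int by (metis of_int_1 of_int_minus power2_minus one_power2)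
  then show ?thesis by (simp add: offd_def)
qed

text \<open>Schur's lemma uses this converse of \<open>offd_zero\<close>: an admissible swap has a
  nonzero matrix entry, which transports diagonal values from one tableau to the other.\<close>

lemma offd_nonzero:
  assumes "is_partition d n lam" "T \<in> syt lam" "1 \<le> k" "Suc k \<le> n" "swap_entries k T \<in> syt lam"
  shows "offd (axial lam k T) \<noteq> 0"
proof
  let ?i = "content lam T (Suc k) - content lam T k"
  assume "offd (axial lam k T) = 0"
  then have "1 / (real_of_int ?i)\<^sup>2 = 1" by (simp add: offd_def axial_int)
  then have "(real_of_int ?i)\<^sup>2 = 1" by (cases "(real_of_int ?i)\<^sup>2 = 0") (simp_all add: field_simps)
  then have "?i\<^sup>2 = 1" by (metis of_int_eq_1_iff of_int_power)
  then have "\<bar>?i\<bar> = 1" by (simp add: power2_eq_1_iff abs_if) linarith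
  then show False using swap_syt_iff assms by blast
qed

lemma young_op_cong:
  assumes "is_partition d n lam" "1 \<le> k" "Suc k \<le> n" "S \<in> syt lam"
    and "\<And>T. T \<in> syt lam \<Longrightarrow> f T = g T"
  shows "young_op lam k f S = young_op lam k g S"
  using assms offd_zero[OF assms(1,4,2,3)]
  by (cases "swap_entries k S \<in> syt lam") (auto simp: young_op_def)

text \<open>Iterating \<open>young_op\<close> on a standard tableau may leave the standard tableaux, but only with
  coefficient \<open>0\<close>; so the composites can be computed as if all fillings were standard.\<close>

definition formal_op :: "nat list \<Rightarrow> nat \<Rightarrow> (tableau \<Rightarrow> real) \<Rightarrow> tableau \<Rightarrow> real" where
  "formal_op lam k f S = f S / axial lam k S + offd (axial lam k S) * f (swap_entries k S)"

lemma young_op_formal: "S \<in> syt lam \<Longrightarrow> young_op lam k f S = formal_op lam k f S"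
  by (simp add: young_op_def formal_op_def)

lemma formal_op_cong:
  assumes "is_partition d n lam" "1 \<le> k" "Suc k \<le> n" "S \<in> syt lam"
    and "\<And>T. T \<in> syt lam \<Longrightarrow> f T = g T"
  shows "formal_op lam k f S = formal_op lam k g S"
  using young_op_cong[OF assms] assms(4) by (simp add: young_op_formal)

lemma young_op_involution:
  assumes P: "is_partition d n lam" and k: "1 \<le> k" "k < n"
  shows "young_op lam k \<circ> young_op lam k = id"
proof (intro ext)
  fix f S
  show "(young_op lam k \<circ> young_op lam k) f S = id f S"
  proof (cases "S \<in> syt lam")
    case S: True
    have k': "1 \<le> k" "Suc k \<le> n" using k by auto
    define x where "x = axial lam k S"
    have x0: "content lam S (Suc k) - content lam S k \<noteq> 0"
      using content_neq[OF P S, of k "Suc k"] k by auto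
    have q: "offd x * offd x = 1 - 1 / x\<^sup>2" by (rule offd_sq[OF _ x0]) (simp add: x_def axial_int)
    have x: "x \<noteq> 0" using x0 unfolding x_def axial_int by (metis of_int_eq_0_iff)
    have "(young_op lam k \<circ> young_op lam k) f S = formal_op lam k (formal_op lam k f) S"
      using S formal_op_cong[OF P k' S, of "young_op lam k f" "formal_op lam k f"]
      by (simp add: young_op_formal)
    also have "\<dots> = (1 / x\<^sup>2 + offd x * offd x) * f S"
      by (simp add: formal_op_def x_def[symmetric] algebra_simps power2_eq_square add_divide_distrib)
    also have "\<dots> = f S" by (simp add: q)
    finally show ?thesis by simp
  qed (simp add: young_op_def)
qed

lemma young_op_commute:
  assumes P: "is_partition d n lam" and k: "1 \<le> k" "Suc k < l" "l < n"
  shows "young_op lam k \<circ> young_op lam l = young_op lam l \<circ> young_op lam k"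
proof (intro ext)
  fix f S
  show "(young_op lam k \<circ> young_op lam l) f S = (young_op lam l \<circ> young_op lam k) f S"
  proof (cases "S \<in> syt lam")
    case S: True
    have k': "1 \<le> k" "Suc k \<le> n" "1 \<le> l" "Suc l \<le> n" using k by auto
    have ax: "axial lam k (swap_entries l S) = axial lam k S"
      "axial lam l (swap_entries k S) = axial lam l S"
      using k by (auto simp: axial_def ct_swap transpose_def)
    have sw: "swap_entries k (swap_entries l S) = swap_entries l (swap_entries k S)"
      using k by (auto simp: swap_entries_def fun_eq_iff)
    have "(young_op lam k \<circ> young_op lam l) f S = formal_op lam k (formal_op lam l f) S"
      using S formal_op_cong[OF P k'(1,2) S, of "young_op lam l f" "formal_op lam l f"]
      by (simp add: young_op_formal)
    also have "\<dots> = formal_op lam l (formal_op lam k f) S"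
      by (simp add: formal_op_def ax sw algebra_simps add_divide_distrib)
    also have "\<dots> = (young_op lam l \<circ> young_op lam k) f S"
      using S formal_op_cong[OF P k'(3,4) S, of "young_op lam k f" "formal_op lam k f"]
      by (simp add: young_op_formal)
    finally show ?thesis .
  qed (simp add: young_op_def)
qed

lemma young_op_braid:
  assumes P: "is_partition d n lam" and k: "1 \<le> k" "Suc k < n"
  shows "young_op lam k \<circ> young_op lam (Suc k) \<circ> young_op lam k =
    young_op lam (Suc k) \<circ> young_op lam k \<circ> young_op lam (Suc k)"
proof (intro ext)
  fix f S
  let ?P = "formal_op lam k" and ?Q = "formal_op lam (Suc k)"
  show "(young_op lam k \<circ> young_op lam (Suc k) \<circ> young_op lam k) f S =
    (young_op lam (Suc k) \<circ> young_op lam k \<circ> young_op lam (Suc k)) f S"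
  proof (cases "S \<in> syt lam")
    case S: True
    have k': "1 \<le> k" "Suc k \<le> n" "1 \<le> Suc k" "Suc (Suc k) \<le> n" using k by auto
    have red: "(young_op lam a \<circ> young_op lam b \<circ> young_op lam a) f S =
        formal_op lam a (formal_op lam b (formal_op lam a f)) S"
      if a: "1 \<le> a" "Suc a \<le> n" and b: "1 \<le> b" "Suc b \<le> n" for a b
    proof -
      have 1: "young_op lam b (young_op lam a f) T = formal_op lam b (formal_op lam a f) T"
        if T: "T \<in> syt lam" for T
        using T formal_op_cong[OF P b T, of "young_op lam a f" "formal_op lam a f"]
        by (simp add: young_op_formal)
      show ?thesis
        using S formal_op_cong[OF P a S 1] by (simp add: young_op_formal)
    qed
    define i j where "i = content lam S (Suc k) - content lam S k"
      and "j = content lam S (Suc (Suc k)) - content lam S (Suc k)"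
    define x y where "x = real_of_int i" and "y = real_of_int j"
    have xy_ct: "x = ct lam S (Suc k) - ct lam S k" "y = ct lam S (Suc (Suc k)) - ct lam S (Suc k)"
      by (simp_all add: x_def y_def i_def j_def ct_def)
    have i0: "i \<noteq> 0" "j \<noteq> 0" "i + j \<noteq> 0"
      using content_neq[OF P S, of k "Suc k"] content_neq[OF P S, of "Suc k" "Suc (Suc k)"]
        content_neq[OF P S, of k "Suc (Suc k)"] k unfolding i_def j_def by auto
    \<comment> \<open>The axial distance between \<open>k\<close> and \<open>k + 2\<close>, nonzero
      by \<open>content_neq\<close> at its largest allowed gap.\<close>
    define z where "z = x + y"
    have xy: "x \<noteq> 0" "y \<noteq> 0" "z \<noteq> 0"
      using i0 unfolding x_def y_def z_def by (auto simp flip: of_int_add)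
    have q: "offd x * offd x = 1 - 1 / x\<^sup>2" "offd y * offd y = 1 - 1 / y\<^sup>2"
      using offd_sq[OF x_def i0(1)] offd_sq[OF y_def i0(2)] by auto
    let ?s = "swap_entries k" and ?t = "swap_entries (Suc k)"
    have ax: "axial lam k S = x" "axial lam (Suc k) S = y"
      "axial lam (Suc k) (?s S) = z" "axial lam k (?t S) = z"
      "axial lam k (?t (?s S)) = y" "axial lam (Suc k) (?s (?t S)) = x"
      by (simp_all add: axial_def ct_swap transpose_def xy_ct z_def)
    have ax': "axial lam k (?s (?t S)) = - z" "axial lam (Suc k) (?t (?s S)) = - z"
      "axial lam k (?s S) = - x" "axial lam (Suc k) (?t S) = - y"
      by (simp_all add: ax)
    have sw: "?t (?s (?t S)) = ?s (?t (?s S))"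
      by (auto simp: swap_entries_def fun_eq_iff)
    define a b c where "a = offd x" and "b = offd y" and "c = offd z"
    have c': "offd (- x) = a" "offd (- y) = b" "offd (- z) = c"
      by (simp_all only: offd_minus a_def b_def c_def)
    have q': "a * a = 1 - 1 / x\<^sup>2" "b * b = 1 - 1 / y\<^sup>2" using q by (simp_all add: a_def b_def)
    have L: "?P (?Q (?P f)) S =
       (1 / (x * y * x) + a * a / z) * f S
       + (a / (x * y) - a / (x * z)) * f (?s S)
       + (b / (x * z)) * f (?t S)
       + (b * c / x) * f (?s (?t S)) + (a * c / y) * f (?t (?s S)) + a * b * c * f (?s (?t (?s S)))"
      unfolding formal_op_def ax ax' c' a_def[symmetric] b_def[symmetric] c_def[symmetric]
        swap_entries_twice
      by (simp add: algebra_simps add_divide_distrib diff_divide_distrib)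
    have R: "?Q (?P (?Q f)) S =
       (1 / (y * x * y) + b * b / z) * f S
       + (b / (x * y) - b / (y * z)) * f (?t S)
       + (a / (y * z)) * f (?s S)
       + (a * c / y) * f (?t (?s S)) + (b * c / x) * f (?s (?t S)) + a * b * c * f (?s (?t (?s S)))"
      unfolding formal_op_def ax ax' c' a_def[symmetric] b_def[symmetric] c_def[symmetric]
        swap_entries_twice sw
      by (simp add: algebra_simps add_divide_distrib diff_divide_distrib)
    \<comment> \<open>All three coefficient identities rest on
      \<open>1 / (x * y) = 1 / (x * z) + 1 / (y * z)\<close> for \<open>z = x + y\<close>; in
      \<open>e1\<close> it enters once \<open>a * a = 1 - 1 / x\<^sup>2\<close> and its analogue for
      \<open>b\<close> are inserted.\<close>
    have e1: "1 / (x * y * x) + a * a / z = 1 / (y * x * y) + b * b / z"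
      unfolding q' using xy by (simp add: divide_simps power2_eq_square) (simp add: z_def algebra_simps)
    have e2: "a / (x * y) - a / (x * z) = a / (y * z)"
      using xy by (simp add: divide_simps) (simp add: z_def algebra_simps)
    have e3: "b / (x * y) - b / (y * z) = b / (x * z)"
      using xy by (simp add: divide_simps) (simp add: z_def algebra_simps)
    have "?P (?Q (?P f)) S = ?Q (?P (?Q f)) S"
      unfolding L R e1 e2 e3 by simp
    then show ?thesis using red[of k "Suc k"] red[of "Suc k" k] k' by simp
  qed (simp add: young_op_def)
qed

lemma coxeter_young_op: "is_partition d n lam \<Longrightarrow> coxeter n (young_op lam)"
  unfolding coxeter_def
  using young_op_involution young_op_commute young_op_braid by blast

section \<open>Jucys--Murphy elements and Schur orthogonality\<close>

definition delta :: "'i \<Rightarrow> 'i \<Rightarrow> real" where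
  "delta T = (\<lambda>Z. if Z = T then 1 else 0)"

lemma axial_nonzero:
  assumes "is_partition d n lam" "S \<in> syt lam" "1 \<le> k" "Suc k \<le> n"
  shows "axial lam k S \<noteq> 0"
proof -
  have "content lam S (Suc k) - content lam S k \<noteq> 0"
    using content_neq[OF assms(1,2), of k "Suc k"] assms by auto
  then show ?thesis unfolding axial_int by (metis of_int_eq_0_iff)
qed

lemma swap_entries_neq:
  assumes "is_partition d n lam" "S \<in> syt lam" "1 \<le> k" "Suc k \<le> n"
  shows "swap_entries k S \<noteq> S"
  using axial_nonzero[OF assms] axial_swap[of lam k S] by force

text \<open>\<open>young_gen\<close> takes the axial distance from its column,
  \<open>young_op\<close> from its row. They agree since a swap only flips the sign of the distance
  and \<open>offd\<close> is even. A swap outside \<open>syt lam\<close> is missing from the sum,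
  and there \<open>offd\<close> is zero.\<close>

lemma young_gen_sum:
  assumes P: "is_partition d n lam" and S: "S \<in> syt lam" and k: "1 \<le> k" "Suc k \<le> n"
  shows "(\<Sum>Z\<in>syt lam. young_gen lam k S Z * f Z) = young_op lam k f S"
proof -
  have gen: "young_gen lam k S Z = (if S = Z then 1 / axial lam k S
      else if Z = swap_entries k S then offd (axial lam k S) else 0)" for Z
    using axial_swap[of lam k S] swap_entries_eq_iff[of S k Z] offd_minus[of "axial lam k S"]
    by (auto simp: young_gen_def Let_def axial_int offd_def)
  have "(\<Sum>Z\<in>syt lam. young_gen lam k S Z * f Z) =
     (\<Sum>Z\<in>syt lam. (if S = Z then f S / axial lam k S else 0) +
        (if swap_entries k S = Z then offd (axial lam k S) * f (swap_entries k S) else 0))"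
    using swap_entries_neq[OF P S k] by (intro sum.cong) (auto simp: gen)
  also have "\<dots> = young_op lam k f S"
    using offd_zero[OF P S k] S by (auto simp: sum.distrib young_op_def)
  finally show ?thesis .
qed

definition young_mat :: "nat list \<Rightarrow> nat list \<Rightarrow> tableau \<Rightarrow> tableau \<Rightarrow> real" where
  "young_mat lam ks S T = wprod (young_op lam) ks (delta T) S"

lemma young_mat_foldr:
  assumes P: "is_partition d n lam" and ks: "set ks \<subseteq> {1..<n}" and S: "S \<in> syt lam"
  shows "foldr (\<lambda>k M. mat_mult_on (syt lam) (young_gen lam k) M) ks mat_id S T = young_mat lam ks S T"
  using ks S
proof (induction ks arbitrary: S)
  case Nil
  then show ?case by (simp add: young_mat_def mat_id_def delta_def)
next
  case (Cons k ks)
  have k: "1 \<le> k" "Suc k \<le> n" using Cons.prems by auto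
  let ?M = "foldr (\<lambda>k M. mat_mult_on (syt lam) (young_gen lam k) M) ks mat_id"
  have "foldr (\<lambda>k M. mat_mult_on (syt lam) (young_gen lam k) M) (k # ks) mat_id S T =
      (\<Sum>Z\<in>syt lam. young_gen lam k S Z * ?M Z T)" by (simp add: mat_mult_on_def)
  also have "\<dots> = young_op lam k (\<lambda>Z. ?M Z T) S"
    by (rule young_gen_sum[OF P Cons.prems(2) k])
  also have "\<dots> = young_op lam k (\<lambda>Z. young_mat lam ks Z T) S"
    using Cons by (intro young_op_cong[OF P k Cons.prems(2)]) auto
  finally show ?case by (simp add: young_mat_def)
qed

text \<open>Here the arbitrary choice in \<open>young_rep\<close> disappears. Any convenient word
  may be used, so composition of permutations becomes concatenation of words.\<close>

lemma young_rep_word: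
  assumes P: "is_partition d n lam" and ks: "set ks \<subseteq> {1..<n}" and S: "S \<in> syt lam"
  shows "young_rep lam (adj_word ks) S T = young_mat lam ks S T"
proof -
  define ls where "ls = (SOME ls. set ls \<subseteq> {1..<n} \<and> adj_word ls = adj_word ks)"
  have ls: "set ls \<subseteq> {1..<n}" "adj_word ls = adj_word ks"
    using someI[of "\<lambda>ls. set ls \<subseteq> {1..<n} \<and> adj_word ls = adj_word ks" ks] ks
    unfolding ls_def by auto
  have "young_rep lam (adj_word ks) S T = young_mat lam ls S T"
    using young_mat_foldr[OF P ls(1) S]
    by (simp add: young_rep_def Let_def is_partition_sum[OF P] ls_def)
  also have "\<dots> = young_mat lam ks S T"
    unfolding young_mat_def
    using coxeter_word_unique[OF coxeter_young_op[OF P] ls(1) ks ls(2)] by simp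
  finally show ?thesis .
qed

lemma young_op_sum:
  "finite A \<Longrightarrow> young_op lam k (\<lambda>Z. \<Sum>x\<in>A. g x Z * h x) S = (\<Sum>x\<in>A. young_op lam k (g x) S * h x)"
  by (simp add: young_op_def sum_distrib_left sum_divide_distrib sum_distrib_right
      flip: sum.distrib) (auto intro!: sum.cong simp: algebra_simps add_divide_distrib)

lemma wprod_young_op:
  assumes P: "is_partition d n lam" and ks: "set ks \<subseteq> {1..<n}" and S: "S \<in> syt lam"
  shows "wprod (young_op lam) ks f S = (\<Sum>T\<in>syt lam. young_mat lam ks S T * f T)"
  using ks S
proof (induction ks arbitrary: S)
  case Nil
  then show ?case by (simp add: young_mat_def delta_def if_distrib[of "\<lambda>x. x * _"] cong: if_cong)
next
  case (Cons k ks)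
  have k: "1 \<le> k" "Suc k \<le> n" using Cons.prems by auto
  have "wprod (young_op lam) (k # ks) f S = young_op lam k (wprod (young_op lam) ks f) S" by simp
  also have "\<dots> = young_op lam k (\<lambda>Z. \<Sum>T\<in>syt lam. young_mat lam ks Z T * f T) S"
    using Cons by (intro young_op_cong[OF P k Cons.prems(2)]) auto
  also have "\<dots> = (\<Sum>T\<in>syt lam. young_op lam k (\<lambda>Z. young_mat lam ks Z T) S * f T)"
    by (rule young_op_sum) simp
  finally show ?case by (simp add: young_mat_def)
qed

lemma young_mat_append:
  assumes "is_partition d n lam" "set ks \<subseteq> {1..<n}" "S \<in> syt lam"
  shows "young_mat lam (ks @ ls) S T = (\<Sum>Z\<in>syt lam. young_mat lam ks S Z * young_mat lam ls Z T)"
  using wprod_young_op[OF assms, of "wprod (young_op lam) ls (delta T)"]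
  by (simp add: young_mat_def wprod_append)

lemma young_mat_single_sym:
  assumes S: "S \<in> syt lam" "T \<in> syt lam"
  shows "young_mat lam [k] S T = young_mat lam [k] T S"
  using S swap_entries_eq_iff[of S k T] axial_swap[of lam k T] offd_minus[of "axial lam k T"]
  by (cases "S = T") (auto simp: young_mat_def young_op_def delta_def)

text \<open>Each generator matrix is symmetric, so reversing a word transposes its matrix. Together
  with \<open>adj_word_rev\<close> this makes Young's form orthogonal.\<close>

lemma young_mat_rev:
  assumes P: "is_partition d n lam" and ks: "set ks \<subseteq> {1..<n}" and S: "S \<in> syt lam" "T \<in> syt lam"
  shows "young_mat lam (rev ks) S T = young_mat lam ks T S"
  using ks S
proof (induction ks arbitrary: S T)
  case Nil
  then show ?case by (simp add: young_mat_def delta_def)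
next
  case (Cons k ks)
  have "young_mat lam (rev (k # ks)) S T =
      (\<Sum>Z\<in>syt lam. young_mat lam (rev ks) S Z * young_mat lam [k] Z T)"
    using young_mat_append[OF P, of "rev ks"] Cons.prems by simp
  also have "\<dots> = (\<Sum>Z\<in>syt lam. young_mat lam [k] T Z * young_mat lam ks Z S)"
    using Cons.IH Cons.prems young_mat_single_sym[of _ lam T k]
    by (intro sum.cong) auto
  also have "\<dots> = young_mat lam (k # ks) T S"
    using young_mat_append[OF P, of "[k]" T ks S] Cons.prems by simp
  finally show ?case .
qed

lemma young_rep_id:
  assumes "is_partition d n lam" "S \<in> syt lam"
  shows "young_rep lam id S T = (if S = T then 1 else 0)"
  using young_rep_word[OF assms(1) _ assms(2), of "[]" T]
  by (simp add: adj_word_eq_wprod young_mat_def delta_def)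

lemma young_rep_comp:
  assumes P: "is_partition d n lam" and perm: "\<sigma> permutes {1..n}" "\<tau> permutes {1..n}" and S: "S \<in> syt lam"
  shows "young_rep lam (\<sigma> \<circ> \<tau>) S T = (\<Sum>Z\<in>syt lam. young_rep lam \<sigma> S Z * young_rep lam \<tau> Z T)"
proof -
  obtain ks ls where w: "set ks \<subseteq> {1..<n}" "adj_word ks = \<sigma>" "set ls \<subseteq> {1..<n}" "adj_word ls = \<tau>"
    using ex_adj_word[OF perm(1)] ex_adj_word[OF perm(2)] by blast
  have "\<sigma> \<circ> \<tau> = adj_word (ks @ ls)"
    using w by (simp add: adj_word_eq_wprod wprod_append)
  moreover have "set (ks @ ls) \<subseteq> {1..<n}" using w by simp
  ultimately have "young_rep lam (\<sigma> \<circ> \<tau>) S T = young_mat lam (ks @ ls) S T"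
    using young_rep_word[OF P _ S] by metis
  also have "\<dots> = (\<Sum>Z\<in>syt lam. young_mat lam ks S Z * young_mat lam ls Z T)"
    by (rule young_mat_append[OF P w(1) S])
  also have "\<dots> = (\<Sum>Z\<in>syt lam. young_rep lam \<sigma> S Z * young_rep lam \<tau> Z T)"
    using young_rep_word[OF P w(1)] young_rep_word[OF P w(3)] S w by (intro sum.cong) auto
  finally show ?thesis .
qed

lemma young_rep_adj:
  assumes "is_partition d n lam" "S \<in> syt lam" "1 \<le> k" "k < n"
  shows "young_rep lam (transpose k (Suc k)) S T = young_op lam k (delta T) S"
  using young_rep_word[OF assms(1) _ assms(2), of "[k]" T] assms(3,4)
  by (simp add: adj_word_eq_wprod young_mat_def)

lemma adj_word_rev:
  assumes "set ks \<subseteq> {1..<n}"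
  shows "adj_word (rev ks) = inv (adj_word ks)"
proof -
  have "adj_word ks \<circ> adj_word (rev ks) = id"
  proof (induction ks)
    case (Cons k ks)
    have "adj_word (k # ks) \<circ> adj_word (rev (k # ks)) =
      transpose k (Suc k) \<circ> (adj_word ks \<circ> adj_word (rev ks)) \<circ> transpose k (Suc k)"
      by (simp add: adj_word_eq_wprod wprod_append o_assoc)
    also have "\<dots> = id" unfolding Cons.IH by simp
    finally show ?case .
  qed (simp add: adj_word_eq_wprod)
  moreover have "adj_word (rev ks) \<circ> adj_word ks = id"
  proof (induction ks rule: rev_induct)
    case (snoc k ks)
    have "adj_word (rev (ks @ [k])) \<circ> adj_word (ks @ [k]) =
      transpose k (Suc k) \<circ> (adj_word (rev ks) \<circ> adj_word ks) \<circ> transpose k (Suc k)"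
      by (simp add: adj_word_eq_wprod wprod_append o_assoc)
    also have "\<dots> = id" unfolding snoc.IH by simp
    finally show ?case .
  qed (simp add: adj_word_eq_wprod)
  ultimately show ?thesis by (metis inv_unique_comp)
qed

lemma young_rep_inv:
  assumes P: "is_partition d n lam" and perm: "\<sigma> permutes {1..n}" and S: "S \<in> syt lam" "T \<in> syt lam"
  shows "young_rep lam (inv \<sigma>) S T = young_rep lam \<sigma> T S"
proof -
  obtain ks where w: "set ks \<subseteq> {1..<n}" "adj_word ks = \<sigma>" using ex_adj_word[OF perm] by blast
  have "young_rep lam (inv \<sigma>) S T = young_mat lam (rev ks) S T"
    using young_rep_word[OF P _ S(1), of "rev ks"] w adj_word_rev[OF w(1)] by simp
  also have "\<dots> = young_mat lam ks T S" by (rule young_mat_rev[OF P w(1) S])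
  also have "\<dots> = young_rep lam \<sigma> T S" using young_rep_word[OF P w(1) S(2)] w by simp
  finally show ?thesis .
qed

lemma ct_one:
  assumes P: "is_partition d n lam" and S: "S \<in> syt lam" and n: "1 \<le> n"
  shows "ct lam S 1 = 0"
proof -
  obtain r c where rc: "cell_of lam S 1 = (r, c)" by fastforce
  have *: "(r, c) \<in> cells lam" "S (r, c) = 1"
    using cell_of_props[OF syt_fillings[OF S], of 1] n is_partition_sum[OF P] rc by simp_all
  have "(0, 0) \<in> cells lam" using cells_down_closed[OF P *(1)] by simp
  then have "1 \<le> S (0, 0)" using filling_bounds[OF syt_fillings[OF S]] by blast
  then have "(r, c) = (0, 0)" using syt_mono[OF P S *(1), of 0 0] * by fastforce
  then show ?thesis using rc by (simp add: ct_def content_eq)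
qed

lemma transpose_conj_adj:
  assumes "a < k"
  shows "transpose a (Suc k) = transpose k (Suc k) \<circ> (transpose a k \<circ> transpose k (Suc k))"
  using assms by (auto simp: fun_eq_iff transpose_def)

text \<open>Induction through \<open>X_(k+1) = s_k X_k s_k + s_k\<close>: for \<open>a < k\<close>
  the transposition of \<open>a\<close> and \<open>k + 1\<close> is the conjugate by
  \<open>s_k\<close> of that of \<open>a\<close> and \<open>k\<close>, and \<open>a = k\<close>
  contributes \<open>s_k\<close> itself.\<close>

theorem jucys_murphy_diag:
  assumes P: "is_partition d n lam" and S: "S \<in> syt lam" and k: "1 \<le> k" "k \<le> n"
  shows "(\<Sum>a\<in>{1..<k}. young_rep lam (transpose a k) S T) = ct lam S k * delta T S"
  using k S
proof (induction k arbitrary: S T rule: nat_induct_at_least)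
  case base
  then show ?case using ct_one[OF P, of S] by simp
next
  case (Suc k)
  note S = Suc.prems(2)
  have k: "1 \<le> k" "k < n" "Suc k \<le> n" "k \<le> n" using Suc by auto
  let ?s = "transpose k (Suc k)"
  have ps: "?s permutes {1..n}" using k by (intro permutes_swap_id) auto
  have conj: "young_rep lam (transpose a (Suc k)) S T =
     (\<Sum>Z\<in>syt lam. young_rep lam ?s S Z * (\<Sum>Y\<in>syt lam. young_rep lam (transpose a k) Z Y * young_rep lam ?s Y T))"
    if a: "a \<in> {1..<k}" for a
  proof -
    have pa: "transpose a k permutes {1..n}" using a k by (intro permutes_swap_id) auto
    have "a < k" using a by simp
    then show ?thesis
      unfolding transpose_conj_adj[OF \<open>a < k\<close>]
      by (simp only: young_rep_comp[OF P ps permutes_compose[OF ps pa] S]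
          young_rep_comp[OF P pa ps] cong: sum.cong)
  qed
  let ?g = "\<lambda>Z. young_op lam k (delta T) Z"
  have "(\<Sum>a\<in>{1..<k}. young_rep lam (transpose a (Suc k)) S T) =
     (\<Sum>a\<in>{1..<k}. \<Sum>Z\<in>syt lam. young_rep lam ?s S Z *
       (\<Sum>Y\<in>syt lam. young_rep lam (transpose a k) Z Y * young_rep lam ?s Y T))"
    by (intro sum.cong conj) auto
  also have "\<dots> = (\<Sum>Z\<in>syt lam. young_rep lam ?s S Z *
       (\<Sum>Y\<in>syt lam. (\<Sum>a\<in>{1..<k}. young_rep lam (transpose a k) Z Y) * young_rep lam ?s Y T))"
    by (subst sum.swap) (simp add: sum_distrib_left sum_distrib_right, intro sum.cong refl, rule sum.swap)
  also have "\<dots> = (\<Sum>Z\<in>syt lam. young_rep lam ?s S Z * (ct lam Z k * ?g Z))"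
  proof (intro sum.cong refl, goal_cases)
    case (1 Z)
    have "(\<Sum>Y\<in>syt lam. (\<Sum>a\<in>{1..<k}. young_rep lam (transpose a k) Z Y) * young_rep lam ?s Y T)
       = (\<Sum>Y\<in>syt lam. if Z = Y then ct lam Z k * ?g Z else 0)"
      using 1 Suc.IH[OF k(4) 1] young_rep_adj[OF P 1 k(1,2)]
      by (intro sum.cong) (auto simp: delta_def)
    then show ?case using 1 by simp
  qed
  also have "\<dots> = (\<Sum>Z\<in>syt lam. young_op lam k (delta Z) S * (ct lam Z k * ?g Z))"
    using young_rep_adj[OF P S k(1,2)] by simp
  also have "\<dots> = young_op lam k (\<lambda>Z. ct lam Z k * ?g Z) S"
    using wprod_young_op[OF P _ S, of "[k]" "\<lambda>Z. ct lam Z k * ?g Z"] k by (simp add: young_mat_def)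
  also have "\<dots> = formal_op lam k (\<lambda>Z. ct lam Z k * formal_op lam k (delta T) Z) S"
    unfolding young_op_formal[OF S]
    by (rule formal_op_cong[OF P k(1,3) S]) (simp add: young_op_formal)
  finally have main: "(\<Sum>a\<in>{1..<k}. young_rep lam (transpose a (Suc k)) S T) =
    formal_op lam k (\<lambda>Z. ct lam Z k * formal_op lam k (delta T) Z) S" .
  define x where "x = axial lam k S"
  have x0: "x \<noteq> 0" unfolding x_def by (rule axial_nonzero[OF P S k(1,3)])
  have i0: "content lam S (Suc k) - content lam S k \<noteq> 0"
    using x0 by (auto simp: x_def axial_int)
  have q: "offd x * offd x = 1 - 1 / x\<^sup>2" by (rule offd_sq[OF _ i0]) (simp add: x_def axial_int)
  have b: "ct lam S (Suc k) = ct lam S k + x" by (simp add: x_def axial_def)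
  have "(\<Sum>a\<in>{1..<Suc k}. young_rep lam (transpose a (Suc k)) S T) =
    (\<Sum>a\<in>{1..<k}. young_rep lam (transpose a (Suc k)) S T) + young_op lam k (delta T) S"
    using k young_rep_adj[OF P S k(1,2)] by simp
  \<comment> \<open>With \<open>c = ct lam S k\<close> and
    \<open>offd x * offd x = 1 - 1 / x\<^sup>2\<close> the diagonal coefficient becomes
    \<open>c + x\<close>, the content of \<open>k + 1\<close>, while the coefficient
    \<open>c / x - (c + x) / x + 1\<close> of the swapped tableau cancels.\<close>
  also have "\<dots> = (ct lam S k / x\<^sup>2 + offd x * offd x * (ct lam S k + x) + 1 / x) * delta T S
      + (ct lam S k / x - (ct lam S k + x) / x + 1) * offd x * delta T (swap_entries k S)"
    unfolding main young_op_formal[OF S] formal_op_def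
    by (simp add: x_def[symmetric] ct_swap b power2_eq_square algebra_simps add_divide_distrib diff_divide_distrib)
  also have "\<dots> = ct lam S (Suc k) * delta T S"
    unfolding q b using x0 by (simp add: field_simps power2_eq_square)
  finally show ?case .
qed

section \<open>Contents separate standard tableaux\<close>

lemma cells_inj:
  assumes "is_partition d n lam" "is_partition d' n' mu" "cells lam = cells mu"
  shows "lam = mu"
proof (rule nth_equalityI)
  have len: "{r. (r, 0) \<in> cells l} = {..<length l}" if "is_partition e m l" for e m l
    using that by (auto simp: cells_def is_partition_def)
  show l: "length lam = length mu"
    using len[OF assms(1)] len[OF assms(2)] assms(3) by (metis card_lessThan)
  fix r assume "r < length lam"
  then have "{c. (r, c) \<in> cells lam} = {..<lam ! r}" "{c. (r, c) \<in> cells mu} = {..<mu ! r}"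
    using l by (auto simp: cells_def)
  then show "lam ! r = mu ! r" using assms(3) by (metis card_lessThan)
qed

lemma syt_outside: "T \<in> syt lam \<Longrightarrow> c \<notin> cells lam \<Longrightarrow> T c = 0"
  unfolding syt_def by blast

text \<open>Equal contents put both cells on one diagonal. If the cell in \<open>S\<close> came
  first, \<open>T\<close> would hold a smaller entry \<open>m\<close> there; the induction
  hypothesis places \<open>m\<close> in the same cell of \<open>S\<close>, where \<open>k\<close>
  already stands.\<close>

lemma content_determines_aux:
  assumes PS: "is_partition d n lam" and PT: "is_partition d' n mu"
    and S: "S \<in> syt lam" and T: "T \<in> syt mu" and k: "1 \<le> k" "k \<le> n"
    and eq: "content lam S k = content mu T k"
    and IH: "\<And>m. 1 \<le> m \<Longrightarrow> m < k \<Longrightarrow> cell_of lam S m = cell_of mu T m"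
  shows "\<not> fst (cell_of lam S k) < fst (cell_of mu T k)"
proof
  assume less: "fst (cell_of lam S k) < fst (cell_of mu T k)"
  obtain r c r' c' where c: "cell_of lam S k = (r, c)" "cell_of mu T k = (r', c')"
    by fastforce
  have *: "(r, c) \<in> cells lam" "S (r, c) = k" "(r', c') \<in> cells mu" "T (r', c') = k"
    using cell_of_props[OF syt_fillings[OF S], of k] cell_of_props[OF syt_fillings[OF T], of k] k
     is_partition_sum[OF PS] is_partition_sum[OF PT] c by auto
  have rc: "r < r'" "c < c'" using less c eq by (auto simp: content_eq)
  then have cm: "(r, c) \<in> cells mu" using cells_down_closed[OF PT *(3)] by simp
  define m where "m = T (r, c)"
  have m: "m < k" using syt_mono[OF PT T *(3), of r c] rc * by (simp add: m_def)
  have m1: "1 \<le> m" using filling_bounds[OF syt_fillings[OF T] cm] by (simp add: m_def)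
  have "cell_of lam S m = (r, c)"
    using IH[OF m1 m] cell_of_eq[OF syt_fillings[OF T] cm] by (simp add: m_def)
  then have "S (r, c) = m"
    using cell_of_props[OF syt_fillings[OF S], of m] m m1 k is_partition_sum[OF PS] by simp
  then show False using * m by simp
qed

text \<open>The joint spectrum of the Jucys-Murphy elements is simple, across shapes as well as
  within one: the cells of 1, 2, ... are recovered one after the other from the contents.\<close>

lemma content_determines:
  assumes PS: "is_partition d n lam" and PT: "is_partition d' n mu"
    and S: "S \<in> syt lam" and T: "T \<in> syt mu"
    and eq: "\<And>k. 1 \<le> k \<Longrightarrow> k \<le> n \<Longrightarrow> content lam S k = content mu T k"
  shows "lam = mu \<and> S = T"
proof -
  have cell: "cell_of lam S k = cell_of mu T k" if "1 \<le> k" "k \<le> n" for k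
    using that
  proof (induction k rule: less_induct)
    case (less k)
    have IH: "cell_of lam S m = cell_of mu T m" if "1 \<le> m" "m < k" for m
      using less.IH[OF that(2,1)] less.prems that by simp
    have "\<not> fst (cell_of lam S k) < fst (cell_of mu T k)"
      using content_determines_aux[OF PS PT S T less.prems eq[OF less.prems] IH] by simp
    moreover have "\<not> fst (cell_of mu T k) < fst (cell_of lam S k)"
      using content_determines_aux[OF PT PS T S less.prems eq[OF less.prems, symmetric] IH[symmetric]]
      by simp
    ultimately have "fst (cell_of lam S k) = fst (cell_of mu T k)" by simp
    with eq[OF less.prems] show ?case by (simp add: content_def prod_eq_iff)
  qed
  have sub: "c \<in> cells b \<and> B c = A c"
    if "is_partition e n a" "is_partition e' n b" "A \<in> syt a" "B \<in> syt b" "c \<in> cells a"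
      and ce: "\<And>k. 1 \<le> k \<Longrightarrow> k \<le> n \<Longrightarrow> cell_of a A k = cell_of b B k" for a b A B c e e'
  proof -
    have k: "1 \<le> A c" "A c \<le> n"
      using filling_bounds[OF syt_fillings[OF that(3)] that(5)] is_partition_sum[OF that(1)] by auto
    have "cell_of b B (A c) = c"
      using ce[OF k] cell_of_eq[OF syt_fillings[OF that(3)] that(5)] by simp
    then show ?thesis
      using cell_of_props[OF syt_fillings[OF that(4)], of "A c"] k is_partition_sum[OF that(2)] by simp
  qed
  have "cells lam = cells mu"
    using sub[OF PS PT S T] sub[OF PT PS T S] cell by (metis subsetI subset_antisym)
  then have lm: "lam = mu" by (rule cells_inj[OF PS PT])
  have "S c = T c" for c
  proof (cases "c \<in> cells lam")
    case True
    then show ?thesis using sub[OF PS PT S T True] cell by simp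
  next
    case False
    then show ?thesis using syt_outside[OF S] syt_outside[OF T] lm by simp
  qed
  then show ?thesis using lm by auto
qed

text \<open>Reading \<open>S\<close> along the order of \<open>T\<close> gives a strictly increasing
  map of \<open>{1..n}\<close> into itself, which can only be the identity.\<close>

lemma syt_eqI:
  assumes P: "is_partition d n lam" and S: "S \<in> syt lam" and T: "T \<in> syt lam"
    and mono: "\<And>k. 1 \<le> k \<Longrightarrow> Suc k \<le> n \<Longrightarrow> S (cell_of lam T k) < S (cell_of lam T (Suc k))"
  shows "S = T"
proof -
  let ?h = "\<lambda>k. S (cell_of lam T k)"
  have n: "sum_list lam = n" by (rule is_partition_sum[OF P])
  have bd: "1 \<le> ?h k" "?h k \<le> n" if "1 \<le> k" "k \<le> n" for k
    using cell_of_props[OF syt_fillings[OF T], of k] filling_bounds[OF syt_fillings[OF S]] that n by auto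
  have ge: "k \<le> ?h k" if "1 \<le> k" "k \<le> n" for k
    using that
  proof (induction k rule: nat_induct_at_least)
    case base then show ?case using bd by simp
  next
    case (Suc k) then show ?case using mono[of k] by simp
  qed
  have le: "?h k + (n - k) \<le> n" if "1 \<le> k" "k \<le> n" for k
    using that(2,1)
  proof (induction k rule: inc_induct)
    case base then show ?case using bd by simp
  next
    case (step k) then show ?case using mono[of k] by simp
  qed
  have h: "?h k = k" if "1 \<le> k" "k \<le> n" for k
    using ge[OF that] le[OF that] that by simp
  have "S c = T c" for c
  proof (cases "c \<in> cells lam")
    case True
    have "cell_of lam T (T c) = c" by (rule cell_of_eq[OF syt_fillings[OF T] True])
    then show ?thesis using h[of "T c"] filling_bounds[OF syt_fillings[OF T] True] n by simp
  next
    case False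
    then show ?thesis using syt_outside[OF S] syt_outside[OF T] by simp
  qed
  then show ?thesis by auto
qed

text \<open>If \<open>S\<close> decreases from the cell of \<open>k\<close> to the cell of \<open>k + 1\<close> in \<open>T\<close>, then exchanging these two
  entries of \<open>T\<close> increases \<open>\<Sum>c. S c * T c\<close>.\<close>

lemma syt_connected:
  assumes P: "is_partition d n lam" and S: "S \<in> syt lam" and T: "T \<in> syt lam"
    and g: "\<And>k T. 1 \<le> k \<Longrightarrow> Suc k \<le> n \<Longrightarrow> T \<in> syt lam \<Longrightarrow> swap_entries k T \<in> syt lam \<Longrightarrow>
       g (swap_entries k T) = g T"
  shows "g T = g S"
  using T
proof (induction "(\<Sum>c\<in>cells lam. S c * n) - (\<Sum>c\<in>cells lam. S c * T c)" arbitrary: T rule: less_induct)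
  case less
  note T = less.prems
  have n: "sum_list lam = n" by (rule is_partition_sum[OF P])
  show ?case
  proof (cases "S = T")
    case False
    then obtain k where k: "1 \<le> k" "Suc k \<le> n"
      "\<not> S (cell_of lam T k) < S (cell_of lam T (Suc k))"
      using syt_eqI[OF P S T] by blast
    define a b where "a = cell_of lam T k" and "b = cell_of lam T (Suc k)"
    have ab: "a \<in> cells lam" "b \<in> cells lam" "T a = k" "T b = Suc k"
      using cell_of_props[OF syt_fillings[OF T], of k] cell_of_props[OF syt_fillings[OF T], of "Suc k"]
        k n by (auto simp: a_def b_def)
    have "S a \<noteq> S b" using filling_inj[OF syt_fillings[OF S] ab(1,2)] ab by auto
    then have gt: "S b < S a" using k by (simp add: a_def b_def)
    obtain r c r' c' where c: "a = (r, c)" "b = (r', c')" by fastforce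
    \<comment> \<open>\<open>S\<close> and \<open>T\<close> order these two cells oppositely, so the
      cells are incomparable and the swap is admissible.\<close>
    have "\<not> (r \<le> r' \<and> c \<le> c')"
      using syt_mono[OF P S, of r' c' r c] ab c gt by (cases "(r, c) = (r', c')") auto
    moreover have "\<not> (r' \<le> r \<and> c' \<le> c)"
      using syt_mono[OF P T, of r c r' c'] ab c by (cases "(r, c) = (r', c')") auto
    moreover have "content lam T k = int c - int r" "content lam T (Suc k) = int c' - int r'"
      using c by (simp_all add: content_eq a_def b_def)
    ultimately have "\<bar>content lam T (Suc k) - content lam T k\<bar> \<noteq> 1" by linarith
    then have T': "swap_entries k T \<in> syt lam" using swap_syt_iff[OF P T k(1,2)] by simp
    let ?T' = "swap_entries k T"
    have pt: "?T' x + (if x = b then 1 else 0) = T x + (if x = a then 1 else 0)"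
      if "x \<in> cells lam" for x
    proof -
      have "T x = k \<longleftrightarrow> x = a" "T x = Suc k \<longleftrightarrow> x = b"
        using filling_inj[OF syt_fillings[OF T] that ab(1)]
          filling_inj[OF syt_fillings[OF T] that ab(2)] ab(3,4) by metis+
      then show ?thesis using ab(3,4) by (auto simp: swap_entries_def)
    qed
    have "(\<Sum>x\<in>cells lam. S x * ?T' x) + S b =
        (\<Sum>x\<in>cells lam. S x * (?T' x + (if x = b then 1 else 0)))"
      using ab by (simp add: algebra_simps sum.distrib if_distrib[of "\<lambda>z. _ * z"] cong: if_cong)
    also have "\<dots> = (\<Sum>x\<in>cells lam. S x * (T x + (if x = a then 1 else 0)))"
      by (intro sum.cong refl) (simp only: pt)
    also have "\<dots> = (\<Sum>x\<in>cells lam. S x * T x) + S a"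
      using ab by (simp add: algebra_simps sum.distrib if_distrib[of "\<lambda>z. _ * z"] cong: if_cong)
    finally have lt: "(\<Sum>x\<in>cells lam. S x * T x) < (\<Sum>x\<in>cells lam. S x * ?T' x)" using gt by linarith
    have "(\<Sum>x\<in>cells lam. S x * ?T' x) \<le> (\<Sum>x\<in>cells lam. S x * n)"
      using filling_bounds[OF syt_fillings[OF T']] n by (intro sum_mono) auto
    with lt have "g ?T' = g S" by (intro less.hyps[OF _ T']) linarith
    then show ?thesis using g[OF k(1,2) T T'] by simp
  qed simp
qed

text \<open>Intertwining with the Jucys-Murphy elements kills every entry whose content sequences
  differ, which leaves a diagonal. The intertwining relation for a swap, at an entry where the
  generator is nonzero, equates the two diagonal values, and \<open>syt_connected\<close> joins all
  tableaux by such swaps.\<close>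

theorem young_schur:
  assumes PS: "is_partition d n lam" and PT: "is_partition d' n mu"
    and M: "\<And>\<sigma> S T. \<sigma> permutes {1..n} \<Longrightarrow> S \<in> syt lam \<Longrightarrow> T \<in> syt mu \<Longrightarrow>
      (\<Sum>Z\<in>syt lam. young_rep lam \<sigma> S Z * M Z T) = (\<Sum>Z\<in>syt mu. M S Z * young_rep mu \<sigma> Z T)"
  obtains c where "\<And>S T. S \<in> syt lam \<Longrightarrow> T \<in> syt mu \<Longrightarrow> M S T = (if lam = mu \<and> S = T then c else 0)"
proof -
  have comm: "ct lam S k * M S T = M S T * ct mu T k"
    if S: "S \<in> syt lam" and T: "T \<in> syt mu" and k: "1 \<le> k" "k \<le> n" for S T k
  proof -
    have "ct lam S k * M S T = (\<Sum>Z\<in>syt lam. (ct lam S k * delta Z S) * M Z T)"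
      using S by (simp add: delta_def if_distrib if_distribR cong: if_cong)
    also have "\<dots> = (\<Sum>Z\<in>syt lam. (\<Sum>a\<in>{1..<k}. young_rep lam (transpose a k) S Z) * M Z T)"
      by (simp only: jucys_murphy_diag[OF PS S k])
    also have "\<dots> = (\<Sum>a\<in>{1..<k}. \<Sum>Z\<in>syt lam. young_rep lam (transpose a k) S Z * M Z T)"
      by (simp add: sum_distrib_right sum.swap[of _ "syt lam"])
    also have "\<dots> = (\<Sum>a\<in>{1..<k}. \<Sum>Z\<in>syt mu. M S Z * young_rep mu (transpose a k) Z T)"
    proof (rule sum.cong[OF refl], rule M[OF _ S T])
      fix a assume "a \<in> {1..<k}"
      then show "transpose a k permutes {1..n}" using k by (intro permutes_swap_id) auto
    qed
    also have "\<dots> = (\<Sum>Z\<in>syt mu. M S Z * (\<Sum>a\<in>{1..<k}. young_rep mu (transpose a k) Z T))"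
      by (simp add: sum_distrib_left sum.swap[of _ "syt mu"])
    also have "\<dots> = (\<Sum>Z\<in>syt mu. M S Z * (ct mu Z k * delta T Z))"
      by (intro sum.cong refl) (simp only: jucys_murphy_diag[OF PT _ k])
    also have "\<dots> = M S T * ct mu T k"
      using T by (simp add: delta_def if_distrib if_distribR cong: if_cong)
    finally show ?thesis .
  qed
  have off: "lam = mu \<and> S = T" if "S \<in> syt lam" "T \<in> syt mu" "M S T \<noteq> 0" for S T
  proof (rule content_determines[OF PS PT that(1,2)])
    fix k assume "1 \<le> k" "k \<le> n"
    then have "ct lam S k = ct mu T k" using comm[OF that(1,2)] that(3) by simp
    then show "content lam S k = content mu T k" by (simp add: ct_def)
  qed
  show thesis
  proof (cases "lam = mu \<and> syt lam \<noteq> {}")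
    case False
    then show thesis using off by (intro that[of 0]) auto
  next
    case True
    then obtain S0 where S0: "S0 \<in> syt lam" by auto
    have step: "M (swap_entries k S) (swap_entries k S) = M S S"
      if k: "1 \<le> k" "Suc k \<le> n" and S: "S \<in> syt lam" "swap_entries k S \<in> syt lam" for k S
    proof -
      let ?T = "swap_entries k S" and ?s = "transpose k (Suc k)"
      have p: "?s permutes {1..n}" using k by (intro permutes_swap_id) auto
      have T: "?T \<in> syt mu" using S True by simp
      have diag: "M Z Y = 0" if "Z \<in> syt lam" "Y \<in> syt lam" "Z \<noteq> Y" for Z Y
        using off[of Z Y] that True by auto
      have "(\<Sum>Z\<in>syt lam. young_rep lam ?s S Z * M Z ?T) =
         (\<Sum>Z\<in>syt lam. if Z = ?T then young_rep lam ?s S ?T * M ?T ?T else 0)"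
        using diag S by (intro sum.cong) auto
      then have l: "(\<Sum>Z\<in>syt lam. young_rep lam ?s S Z * M Z ?T) = young_rep lam ?s S ?T * M ?T ?T"
        using S by simp
      have "(\<Sum>Z\<in>syt mu. M S Z * young_rep mu ?s Z ?T) =
         (\<Sum>Z\<in>syt mu. if Z = S then M S S * young_rep lam ?s S ?T else 0)"
        using diag S True by (intro sum.cong) auto
      then have r: "(\<Sum>Z\<in>syt mu. M S Z * young_rep mu ?s Z ?T) = M S S * young_rep lam ?s S ?T"
        using S True by simp
      have "young_rep lam ?s S ?T = offd (axial lam k S)"
        using young_rep_adj[OF PS S(1), of k ?T] k S swap_entries_neq[OF PS S(1) k]
        by (auto simp: young_op_def delta_def)
      then have "young_rep lam ?s S ?T \<noteq> 0" using offd_nonzero[OF PS S(1) k S(2)] by simp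
      then show ?thesis using M[OF p S(1) T] l r by simp
    qed
    have const: "M S S = M S0 S0" if "S \<in> syt lam" for S
      using syt_connected[OF PS S0 that, of "\<lambda>S. M S S"] step by blast
    show thesis
      by (rule that[of "M S0 S0"]) (use off const True in auto)
  qed
qed

text \<open>For fixed \<open>k\<close> and \<open>j\<close> the group sum, as a matrix in
  \<open>m\<close> and \<open>i\<close>, is an intertwiner, so Schur's lemma leaves one constant.
  Its trace yields \<open>fact n / dim_irrep lam\<close>, since the matrices of \<sigma> and of its
  inverse multiply to the identity.\<close>

theorem young_orthogonality:
  assumes PS: "is_partition d n lam" and PT: "is_partition d' n mu"
    and m: "m \<in> syt lam" "k \<in> syt lam" and j: "j \<in> syt mu" "i \<in> syt mu"
  shows "(\<Sum>\<sigma> | \<sigma> permutes {1..n}. young_rep lam \<sigma> m k * young_rep mu (inv \<sigma>) j i) =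
    (if lam = mu \<and> k = j \<and> m = i then fact n / real (dim_irrep lam) else 0)"
proof -
  define M where "M = (\<lambda>m i. \<Sum>\<sigma> | \<sigma> permutes {1..n}. young_rep lam \<sigma> m k * young_rep mu (inv \<sigma>) j i)"
  have inter: "(\<Sum>Z\<in>syt lam. young_rep lam \<tau> S Z * M Z T) = (\<Sum>Z\<in>syt mu. M S Z * young_rep mu \<tau> Z T)"
    if \<tau>: "\<tau> permutes {1..n}" and S: "S \<in> syt lam" and T: "T \<in> syt mu" for \<tau> S T
  proof -
    have "(\<Sum>Z\<in>syt lam. young_rep lam \<tau> S Z * M Z T) =
       (\<Sum>\<sigma> | \<sigma> permutes {1..n}. (\<Sum>Z\<in>syt lam. young_rep lam \<tau> S Z * young_rep lam \<sigma> Z k)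
          * young_rep mu (inv \<sigma>) j T)"
      by (simp add: M_def sum_distrib_left sum_distrib_right sum.swap[of _ "syt lam"] mult.assoc)
    also have "\<dots> = (\<Sum>\<sigma> | \<sigma> permutes {1..n}. young_rep lam (\<tau> \<circ> \<sigma>) S k * young_rep mu (inv \<sigma>) j T)"
      by (intro sum.cong refl) (simp add: young_rep_comp[OF PS \<tau> _ S])
    also have "\<dots> = (\<Sum>\<sigma> | \<sigma> permutes {1..n}. young_rep lam \<sigma> S k * young_rep mu (inv \<sigma> \<circ> \<tau>) j T)"
    proof (rule sum.reindex_bij_witness[of _ "\<lambda>\<sigma>. inv \<tau> \<circ> \<sigma>" "\<lambda>\<sigma>. \<tau> \<circ> \<sigma>"], goal_cases)
      case (1 \<sigma>) then show ?case using \<tau> by (simp add: o_assoc permutes_inv_o)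
    next
      case (2 \<sigma>) then show ?case using \<tau> by (simp add: permutes_compose)
    next
      case (3 \<sigma>) then show ?case using \<tau> by (simp add: o_assoc permutes_inv_o)
    next
      case (4 \<sigma>) then show ?case using \<tau> by (simp add: permutes_compose permutes_inv)
    next
      case (5 \<sigma>)
      then have "inv (\<tau> \<circ> \<sigma>) \<circ> \<tau> = inv \<sigma>"
        using \<tau> by (simp add: o_inv_distrib permutes_bij comp_assoc permutes_inv_o)
      then show ?case by simp
    qed
    also have "\<dots> = (\<Sum>\<sigma> | \<sigma> permutes {1..n}. young_rep lam \<sigma> S k *
        (\<Sum>Z\<in>syt mu. young_rep mu (inv \<sigma>) j Z * young_rep mu \<tau> Z T))"
      by (intro sum.cong refl) (simp add: young_rep_comp[OF PT permutes_inv \<tau> j(1)])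
    also have "\<dots> = (\<Sum>Z\<in>syt mu. M S Z * young_rep mu \<tau> Z T)"
      by (simp add: M_def sum_distrib_left sum_distrib_right sum.swap[of _ "syt mu"] mult.assoc)
    finally show ?thesis .
  qed
  obtain c where c: "\<And>S T. S \<in> syt lam \<Longrightarrow> T \<in> syt mu \<Longrightarrow> M S T = (if lam = mu \<and> S = T then c else 0)"
    using young_schur[OF PS PT inter] by blast
  show ?thesis
  proof (cases "lam = mu")
    case False
    then show ?thesis using c[OF m(1) j(2)] by (simp add: M_def)
  next
    case True
    have "real (dim_irrep lam) * c = (\<Sum>S\<in>syt lam. M S S)"
      using c True by (simp add: dim_irrep_def)
    also have "\<dots> = (\<Sum>\<sigma> | \<sigma> permutes {1..n}. \<Sum>S\<in>syt lam. young_rep mu (inv \<sigma>) j S * young_rep lam \<sigma> S k)"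
      unfolding M_def by (subst sum.swap) (simp add: mult.commute)
    also have "\<dots> = (\<Sum>\<sigma> | \<sigma> permutes {1..n}. if j = k then 1 else 0)"
    proof (intro sum.cong refl, goal_cases)
      case (1 \<sigma>)
      then have s: "\<sigma> permutes {1..n}" by simp
      show ?case
        using young_rep_comp[OF PT permutes_inv[OF s] s j(1), of k] young_rep_id[OF PT j(1), of k]
          permutes_inv_o(2)[OF s] True by simp
    qed
    also have "\<dots> = (if j = k then fact n else 0)"
      by (simp add: card_permutations[of "{Suc 0..n}" n])
    finally have *: "real (dim_irrep lam) * c = (if j = k then fact n else 0)" .
    have "dim_irrep lam \<noteq> 0" using m by (auto simp: dim_irrep_def)
    then have "c = (if j = k then fact n / real (dim_irrep lam) else 0)"
      using * by (auto simp: field_simps)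
    then show ?thesis using c[OF m(1) j(2)] True by (auto simp: M_def)
  qed
qed

section \<open>Removing a box\<close>

text \<open>Row lengths as a total function padded by zeros: removing a box is then a function
  update, with no case distinction on whether a row vanishes from the list.\<close>

definition rowlen :: "nat list \<Rightarrow> nat \<Rightarrow> nat" where
  "rowlen lam r = (if r < length lam then lam ! r else 0)"

definition row_cells :: "(nat \<Rightarrow> nat) \<Rightarrow> (nat \<times> nat) set" where
  "row_cells f = {(r, c). c < f r}"

lemma mem_row_cells [simp]: "(r, c) \<in> row_cells f \<longleftrightarrow> c < f r"
  by (simp add: row_cells_def)

lemma cells_eq_row_cells: "cells lam = row_cells (rowlen lam)"
  by (auto simp: cells_def row_cells_def rowlen_def split: if_splits)

lemma row_cells_inj: "row_cells f = row_cells g \<Longrightarrow> f = g"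
proof
  fix r assume "row_cells f = row_cells g"
  then have "{c. (r, c) \<in> row_cells f} = {c. (r, c) \<in> row_cells g}" by simp
  then have "{..<f r} = {..<g r}" by (simp add: lessThan_def)
  then show "f r = g r" by simp
qed

definition of_rows :: "(nat \<Rightarrow> nat) \<Rightarrow> nat list" where
  "of_rows f = map f [0..<LEAST r. f r = 0]"

lemma rowlen_antimono:
  assumes "is_partition d n lam" shows "antimono (rowlen lam)"
proof
  fix r r' :: nat assume "r \<le> r'"
  then show "rowlen lam r' \<le> rowlen lam r"
    using is_partition_antimono[OF assms, of r r'] by (simp add: rowlen_def)
qed

lemma rowlen_zero: "is_partition d n lam \<Longrightarrow> d \<le> r \<Longrightarrow> rowlen lam r = 0"
  by (auto simp: is_partition_def rowlen_def)

lemma rowlen_sum: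
  assumes "is_partition d n lam" shows "(\<Sum>r<d. rowlen lam r) = n"
proof -
  have "(\<Sum>r<d. rowlen lam r) = (\<Sum>r<length lam. lam ! r)"
    using assms by (intro sum.mono_neutral_cong_right) (auto simp: is_partition_def rowlen_def)
  then show ?thesis using assms by (simp add: is_partition_def sum_list_sum_nth atLeast0LessThan)
qed

lemma rowlen_inj:
  assumes "is_partition d n lam" "is_partition d' n' mu" "rowlen lam = rowlen mu"
  shows "lam = mu"
  using cells_inj[OF assms(1,2)] assms(3) by (simp add: cells_eq_row_cells)

lemma
  assumes anti: "antimono f" and z: "\<And>r. d \<le> r \<Longrightarrow> f r = 0"
  shows rowlen_of_rows: "rowlen (of_rows f) = f"
    and is_partition_of_rows: "is_partition d (\<Sum>r<d. f r) (of_rows f)"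
proof -
  define m where "m = (LEAST r. f r = 0)"
  have m: "f m = 0" "m \<le> d" unfolding m_def using z[of d] by (auto intro: LeastI Least_le)
  have pos: "0 < f r" if "r < m" for r using not_less_Least[of r "\<lambda>r. f r = 0"] that by (simp add: m_def)
  have zero: "f r = 0" if "m \<le> r" for r using antimonoD[OF anti that] m by simp
  have of: "of_rows f = map f [0..<m]" by (simp add: of_rows_def m_def)
  show rl: "rowlen (of_rows f) = f" using zero by (auto simp: rowlen_def of fun_eq_iff)
  have "sorted (rev (of_rows f))"
    unfolding of sorted_wrt_rev using antimonoD[OF anti] by (auto simp: sorted_wrt_iff_nth_less)
  moreover have "sum_list (of_rows f) = (\<Sum>r<d. f r)"
  proof -
    have "sum_list (of_rows f) = (\<Sum>r<m. f r)"
      by (simp add: of interv_sum_list_conv_sum_set_nat atLeast0LessThan)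
    also have "\<dots> = (\<Sum>r<d. f r)" using m zero by (intro sum.mono_neutral_left) auto
    finally show ?thesis .
  qed
  ultimately show "is_partition d (\<Sum>r<d. f r) (of_rows f)"
    using pos m by (auto simp: is_partition_def of)
qed

definition removable :: "nat list \<Rightarrow> nat \<Rightarrow> bool" where
  "removable lam r \<longleftrightarrow> rowlen lam (Suc r) < rowlen lam r"

definition remove_box :: "nat list \<Rightarrow> nat \<Rightarrow> nat list" where
  "remove_box lam r = of_rows ((rowlen lam)(r := rowlen lam r - 1))"

lemma removable_less: "is_partition d n lam \<Longrightarrow> removable lam r \<Longrightarrow> r < d"
  using rowlen_zero[of d n lam r] by (cases "r < d") (auto simp: removable_def)

lemma
  assumes P: "is_partition d n lam" and r: "removable lam r"
  shows rowlen_remove_box: "rowlen (remove_box lam r) = (rowlen lam)(r := rowlen lam r - 1)"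
    and remove_box_in_shape: "in_shape d (remove_box lam r) lam"
proof -
  let ?g = "(rowlen lam)(r := rowlen lam r - 1)"
  have anti: "antimono ?g"
  proof (rule antimonoI)
    fix a b :: nat assume ab: "a \<le> b"
    have le: "rowlen lam b \<le> rowlen lam a" by (rule antimonoD[OF rowlen_antimono[OF P] ab])
    have "rowlen lam b \<le> rowlen lam r - 1" if "r < b"
      using antimonoD[OF rowlen_antimono[OF P], of "Suc r" b] that r by (simp add: removable_def)
    then show "?g b \<le> ?g a" using le ab by (auto simp: le_less)
  qed
  have rd: "r < d" by (rule removable_less[OF P r])
  have z: "?g a = 0" if "d \<le> a" for a using rowlen_zero[OF P that] rd that by auto
  show rl: "rowlen (remove_box lam r) = ?g"
    unfolding remove_box_def by (rule rowlen_of_rows[OF anti z])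
  have pos: "0 < rowlen lam r" using r by (simp add: removable_def)
  have "n = (\<Sum>a<d. rowlen lam a)" by (simp add: rowlen_sum[OF P])
  also have "\<dots> = rowlen lam r + (\<Sum>a\<in>{..<d} - {r}. rowlen lam a)"
    using rd by (simp add: sum.remove)
  finally have 1: "n = rowlen lam r + (\<Sum>a\<in>{..<d} - {r}. rowlen lam a)" .
  have 2: "(\<Sum>a<d. ?g a) = (rowlen lam r - 1) + (\<Sum>a\<in>{..<d} - {r}. rowlen lam a)"
    using rd by (subst sum.remove[of _ r]) auto
  have "(\<Sum>a<d. ?g a) = n - 1" using 1 2 pos by simp
  moreover have "is_partition d (\<Sum>a<d. ?g a) (remove_box lam r)"
    unfolding remove_box_def by (rule is_partition_of_rows[OF anti z])
  ultimately show "in_shape d (remove_box lam r) lam"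
    by (auto simp: in_shape_def is_partition_sum[OF P] cells_eq_row_cells rl row_cells_def
        split: if_splits)
qed

text \<open>The row lengths of \<open>alpha\<close> are below those of \<open>lam\<close> with total
  deficit one, so exactly one row is short by one. That row is removable because the rows of
  \<open>alpha\<close> decrease.\<close>

lemma in_shape_remove_box:
  assumes P: "is_partition d n lam" and n: "1 \<le> n" and a: "in_shape d alpha lam"
  obtains r where "removable lam r" "alpha = remove_box lam r"
proof -
  have Pa: "is_partition d (n - 1) alpha" using a by (simp add: in_shape_def is_partition_sum[OF P])
  have le: "rowlen alpha r \<le> rowlen lam r" for r
  proof (rule ccontr)
    assume "\<not> rowlen alpha r \<le> rowlen lam r"
    then have "(r, rowlen lam r) \<in> cells alpha" "(r, rowlen lam r) \<notin> cells lam"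
      by (auto simp: cells_eq_row_cells)
    then show False using a by (auto simp: in_shape_def)
  qed
  have "(\<Sum>r<d. rowlen lam r - rowlen alpha r) = (\<Sum>r<d. rowlen lam r) - (\<Sum>r<d. rowlen alpha r)"
    using le by (intro sum_subtractf_nat) auto
  also have "\<dots> = 1" using rowlen_sum[OF P] rowlen_sum[OF Pa] n by simp
  finally have "\<exists>r\<in>{..<d}. rowlen lam r - rowlen alpha r = 1 \<and>
      (\<forall>r'\<in>{..<d}. r \<noteq> r' \<longrightarrow> rowlen lam r' - rowlen alpha r' = 0)"
    by (subst (asm) sum_eq_1_iff) auto
  then obtain r where r: "r < d" "rowlen lam r - rowlen alpha r = 1"
    "\<And>r'. r' < d \<Longrightarrow> r' \<noteq> r \<Longrightarrow> rowlen lam r' - rowlen alpha r' = 0"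
    by (metis lessThan_iff)
  have eq: "rowlen alpha = (rowlen lam)(r := rowlen lam r - 1)"
  proof
    fix r' show "rowlen alpha r' = ((rowlen lam)(r := rowlen lam r - 1)) r'"
      using r le[of r'] rowlen_zero[OF P, of r'] by (cases "r' < d") (auto simp: le_antisym)
  qed
  have "rowlen lam (Suc r) = rowlen alpha (Suc r)" by (simp add: eq)
  also have "\<dots> \<le> rowlen alpha r" by (rule antimonoD[OF rowlen_antimono[OF Pa]]) simp
  finally have rem: "removable lam r" using r by (simp add: removable_def)
  moreover have "alpha = remove_box lam r"
    using remove_box_in_shape[OF P rem] rowlen_remove_box[OF P rem] eq
    by (intro rowlen_inj[OF Pa, of d "n - 1"]) (auto simp: in_shape_def is_partition_sum[OF P])
  ultimately show thesis by (rule that)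
qed

lemma inj_on_remove_box:
  assumes P: "is_partition d n lam"
  shows "inj_on (remove_box lam) {r. removable lam r}"
proof (rule inj_onI, clarsimp)
  fix r s assume r: "removable lam r" and s: "removable lam s" and "remove_box lam r = remove_box lam s"
  then have "((rowlen lam)(r := rowlen lam r - 1)) r = ((rowlen lam)(s := rowlen lam s - 1)) r"
    using rowlen_remove_box[OF P] by metis
  then show "r = s" using r by (auto simp: removable_def split: if_splits)
qed

lemma shapes_eq:
  assumes P: "is_partition d n lam" and n: "1 \<le> n"
  shows "{alpha. in_shape d alpha lam} = remove_box lam ` {r. removable lam r}"
proof (intro equalityI subsetI)
  fix alpha assume "alpha \<in> {alpha. in_shape d alpha lam}"
  then show "alpha \<in> remove_box lam ` {r. removable lam r}"
    using in_shape_remove_box[OF P n, of alpha] by auto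
qed (auto simp: remove_box_in_shape[OF P])

lemma finite_removable: "is_partition d n lam \<Longrightarrow> finite {r. removable lam r}"
  by (rule finite_subset[of _ "{..<d}"]) (auto dest: removable_less)

lemma finite_shapes: "is_partition d n lam \<Longrightarrow> 1 \<le> n \<Longrightarrow> finite {alpha. in_shape d alpha lam}"
  by (simp add: shapes_eq finite_removable)

definition box :: "nat list \<Rightarrow> nat list \<Rightarrow> nat \<times> nat" where
  "box lam alpha = (THE c. c \<in> cells lam - cells alpha)"

lemma cells_remove_box:
  assumes P: "is_partition d n lam" and r: "removable lam r"
  shows "cells lam = insert (r, rowlen lam r - 1) (cells (remove_box lam r))"
    "(r, rowlen lam r - 1) \<notin> cells (remove_box lam r)"
  using r unfolding cells_eq_row_cells rowlen_remove_box[OF P r]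
  by (auto simp: removable_def row_cells_def split: if_splits)

lemma box_remove_box:
  assumes P: "is_partition d n lam" and r: "removable lam r"
  shows "box lam (remove_box lam r) = (r, rowlen lam r - 1)"
  unfolding box_def by (rule the_equality) (use cells_remove_box[OF assms] in auto)

lemma cells_box:
  assumes P: "is_partition d n lam" and n: "1 \<le> n" and a: "in_shape d alpha lam"
  shows "cells lam = insert (box lam alpha) (cells alpha)" "box lam alpha \<notin> cells alpha"
proof -
  obtain r where r: "removable lam r" "alpha = remove_box lam r"
    using in_shape_remove_box[OF P n a] .
  then show "cells lam = insert (box lam alpha) (cells alpha)" "box lam alpha \<notin> cells alpha"
    using cells_remove_box[OF P r(1)] box_remove_box[OF P r(1)] by auto
qed

lemma in_shape_partition: "is_partition d n lam \<Longrightarrow> in_shape d alpha lam \<Longrightarrow> is_partition d (n - 1) alpha"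
  by (simp add: in_shape_def is_partition_sum)

lemma ext_tab_eq:
  assumes P: "is_partition d n lam" and n: "1 \<le> n" and a: "in_shape d alpha lam"
  shows "ext_tab lam alpha t = t(box lam alpha := n)"
  using cells_box[OF assms] by (auto simp: ext_tab_def is_partition_sum[OF P] fun_eq_iff)

lemma ext_tab_syt:
  assumes P: "is_partition d n lam" and n: "1 \<le> n" and a: "in_shape d alpha lam" and t: "t \<in> syt alpha"
  shows "ext_tab lam alpha t \<in> syt lam"
proof -
  obtain R where R: "removable lam R" "alpha = remove_box lam R"
    using in_shape_remove_box[OF P n a] .
  note Pa = in_shape_partition[OF P a]
  note cb = cells_box[OF P n a]
  have bx: "box lam alpha = (R, rowlen lam R - 1)" using box_remove_box[OF P R(1)] R by simp
  have bd: "1 \<le> t c \<and> t c \<le> n - 1" if "c \<in> cells alpha" for c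
    using filling_bounds[OF syt_fillings[OF t] that] is_partition_sum[OF Pa] by simp
  let ?T = "t(box lam alpha := n)"
  have "bij_betw t (cells alpha) {1..n - 1}" using t is_partition_sum[OF Pa] by (simp add: syt_def)
  moreover have "bij_betw ?T (cells alpha) {1..n - 1} = bij_betw t (cells alpha) {1..n - 1}"
    using cb by (intro bij_betw_cong) auto
  ultimately have "bij_betw ?T (cells alpha \<union> {box lam alpha}) ({1..n - 1} \<union> {?T (box lam alpha)})"
    using cb n by (subst notIn_Un_bij_betw3[symmetric]) auto
  moreover have "cells alpha \<union> {box lam alpha} = cells lam" "{1..n - 1} \<union> {?T (box lam alpha)} = {1..n}"
    using cb n by auto
  ultimately have bij: "bij_betw ?T (cells lam) {1..n}" by simp
  have out: "?T c = 0" if "c \<notin> cells lam" for c using that cb t by (auto simp: syt_outside)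
  have row: "?T (r, c) < ?T (r, c')" if c: "(r, c) \<in> cells lam" "(r, c') \<in> cells lam" "c < c'" for r c c'
  proof -
    have nb: "(r, c) \<noteq> box lam alpha"
      using c bx by (auto simp: cells_eq_row_cells)
    then have ca: "(r, c) \<in> cells alpha" using c cb by auto
    show ?thesis
    proof (cases "(r, c') = box lam alpha")
      case True then show ?thesis using nb bd[OF ca] n by auto
    next
      case False
      then have "(r, c') \<in> cells alpha" using c cb by auto
      then show ?thesis using syt_mono[OF Pa t, of r c' r c] nb False c by auto
    qed
  qed
  have col: "?T (r, c) < ?T (r', c)" if c: "(r, c) \<in> cells lam" "(r', c) \<in> cells lam" "r < r'" for r r' c
  proof -
    have nb: "(r, c) \<noteq> box lam alpha"
    proof
      assume "(r, c) = box lam alpha"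
      then have "r = R" "c = rowlen lam R - 1" using bx by auto
      moreover have "rowlen lam r' \<le> rowlen lam (Suc R)"
        using c \<open>r = R\<close> by (intro antimonoD[OF rowlen_antimono[OF P]]) auto
      ultimately show False using c R by (auto simp: cells_eq_row_cells removable_def)
    qed
    then have ca: "(r, c) \<in> cells alpha" using c cb by auto
    show ?thesis
    proof (cases "(r', c) = box lam alpha")
      case True then show ?thesis using nb bd[OF ca] n by auto
    next
      case False
      then have "(r', c) \<in> cells alpha" using c cb by auto
      then show ?thesis using syt_mono[OF Pa t, of r' c r c] nb False c by auto
    qed
  qed
  show ?thesis unfolding ext_tab_eq[OF P n a] syt_def is_partition_sum[OF P]
    using bij out row col by blast
qed

text \<open>The largest entry has neither a right nor a lower neighbour, so its cell is a corner
  that can be removed. This is the identification of the indices of \<open>lam\<close> with pairs of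
  a smaller shape and one of its tableaux.\<close>

lemma syt_ext_tabE:
  assumes P: "is_partition d n lam" and n: "1 \<le> n" and T: "T \<in> syt lam"
  obtains alpha t where "in_shape d alpha lam" "t \<in> syt alpha" "T = ext_tab lam alpha t"
proof -
  have sl: "sum_list lam = n" by (rule is_partition_sum[OF P])
  obtain r c where rc: "cell_of lam T n = (r, c)" by fastforce
  have c: "(r, c) \<in> cells lam" "T (r, c) = n"
    using cell_of_props[OF syt_fillings[OF T], of n] n sl rc by auto
  have max: "T x \<le> n" if "x \<in> cells lam" for x using filling_bounds[OF syt_fillings[OF T] that] sl by simp
  have nr: "(r, Suc c) \<notin> cells lam"
  proof
    assume "(r, Suc c) \<in> cells lam"
    then show False using syt_mono[OF P T, of r "Suc c" r c] max[of "(r, Suc c)"] c by auto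
  qed
  have nd: "(Suc r, c) \<notin> cells lam"
  proof
    assume "(Suc r, c) \<in> cells lam"
    then show False using syt_mono[OF P T, of "Suc r" c r c] max[of "(Suc r, c)"] c by auto
  qed
  have cr: "c = rowlen lam r - 1" "0 < rowlen lam r" using c nr by (auto simp: cells_eq_row_cells)
  have R: "removable lam r" using nd c by (auto simp: cells_eq_row_cells removable_def)
  define alpha where "alpha = remove_box lam r"
  have a: "in_shape d alpha lam" using remove_box_in_shape[OF P R] by (simp add: alpha_def)
  note cb = cells_box[OF P n a] and Pa = in_shape_partition[OF P a]
  have bx: "box lam alpha = (r, c)" using box_remove_box[OF P R] cr by (simp add: alpha_def)
  define t where "t = T((r, c) := 0)"
  have bT: "bij_betw T (cells lam) {1..n}" using T sl by (simp add: syt_def)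
  have "bij_betw T (cells alpha \<union> {(r, c)}) ({1..n - 1} \<union> {T (r, c)})"
  proof -
    have "cells alpha \<union> {(r, c)} = cells lam" "{1..n - 1} \<union> {T (r, c)} = {1..n}"
      using cb bx n c by auto
    then show ?thesis using bT by simp
  qed
  then have "bij_betw T (cells alpha) {1..n - 1}"
    using cb bx n c by (subst notIn_Un_bij_betw3[of "(r, c)"]) auto
  moreover have "bij_betw t (cells alpha) {1..n - 1} = bij_betw T (cells alpha) {1..n - 1}"
    using cb bx by (intro bij_betw_cong) (auto simp: t_def)
  ultimately have "bij_betw t (cells alpha) {1..sum_list alpha}" using is_partition_sum[OF Pa] by simp
  moreover have "t x = T x" if "x \<in> cells alpha" for x using that cb bx by (auto simp: t_def)
  moreover have "t x = 0" if "x \<notin> cells alpha" for x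
    using that cb bx syt_outside[OF T, of x] by (auto simp: t_def)
  moreover have "cells alpha \<subseteq> cells lam" using cb by auto
  ultimately have "t \<in> syt alpha" using T unfolding syt_def by (auto simp: subset_iff)
  moreover have "T = ext_tab lam alpha t"
    unfolding ext_tab_eq[OF P n a] bx t_def using c by auto
  ultimately show thesis using a that by blast
qed

lemma ext_tab_inj:
  assumes P: "is_partition d n lam" and n: "1 \<le> n" and a: "in_shape d alpha lam" "in_shape d beta lam"
    and t: "t \<in> syt alpha" "s \<in> syt beta" and eq: "ext_tab lam alpha t = ext_tab lam beta s"
  shows "alpha = beta \<and> t = s"
proof -
  have T: "ext_tab lam alpha t \<in> syt lam" by (rule ext_tab_syt[OF P n a(1) t(1)])
  have b: "box lam alpha \<in> cells lam" "box lam beta \<in> cells lam"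
    using cells_box[OF P n a(1)] cells_box[OF P n a(2)] by auto
  have "ext_tab lam alpha t (box lam alpha) = ext_tab lam alpha t (box lam beta)"
    unfolding eq ext_tab_eq[OF P n a(2)] unfolding eq[symmetric] ext_tab_eq[OF P n a(1)]
    by (metis eq ext_tab_eq[OF P n a(1)] ext_tab_eq[OF P n a(2)] fun_upd_same)
  then have bb: "box lam alpha = box lam beta"
    using filling_inj[OF syt_fillings[OF T] b] by simp
  then have "cells alpha = cells beta"
    using cells_box[OF P n a(1)] cells_box[OF P n a(2)] by (metis insert_ident)
  then have ab: "alpha = beta" by (rule cells_inj[OF in_shape_partition[OF P a(1)] in_shape_partition[OF P a(2)]])
  have "t x = s x" for x
  proof (cases "x = box lam alpha")
    case True
    then show ?thesis
      using cells_box(2)[OF P n a(1)] ab syt_outside[OF t(1)] syt_outside[OF t(2)] by simp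
  next
    case False
    then show ?thesis using fun_cong[OF eq, of x] bb by (simp add: ext_tab_eq[OF P n] a)
  qed
  then show ?thesis using ab by auto
qed

lemma dim_irrep_branching:
  assumes P: "is_partition d n lam" and n: "1 \<le> n"
  shows "dim_irrep lam = (\<Sum>alpha | in_shape d alpha lam. dim_irrep alpha)"
proof -
  have "syt lam = (\<Union>alpha\<in>{alpha. in_shape d alpha lam}. ext_tab lam alpha ` syt alpha)"
  proof (intro equalityI subsetI)
    fix T assume "T \<in> syt lam"
    then show "T \<in> (\<Union>alpha\<in>{alpha. in_shape d alpha lam}. ext_tab lam alpha ` syt alpha)"
      using syt_ext_tabE[OF P n, of T] by blast
  qed (auto intro: ext_tab_syt[OF P n])
  then have "dim_irrep lam = (\<Sum>alpha | in_shape d alpha lam. card (ext_tab lam alpha ` syt alpha))"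
    unfolding dim_irrep_def
  proof (simp only:, intro card_UN_disjoint ballI impI)
    fix alpha beta assume "alpha \<in> {alpha. in_shape d alpha lam}" "beta \<in> {alpha. in_shape d alpha lam}" "alpha \<noteq> beta"
    then show "ext_tab lam alpha ` syt alpha \<inter> ext_tab lam beta ` syt beta = {}"
      using ext_tab_inj[OF P n] by blast
  qed (simp_all add: finite_shapes[OF P n])
  also have "\<dots> = (\<Sum>alpha | in_shape d alpha lam. dim_irrep alpha)"
    unfolding dim_irrep_def using ext_tab_inj[OF P n]
    by (intro sum.cong refl card_image) (auto simp: inj_on_def)
  finally show ?thesis .
qed

section \<open>Counting semistandard tableaux\<close>

text \<open>Up to the constant factor of the Weyl dimension formula this is the Vandermonde determinant
  of \<open>l\<^sub>0, \<dots>, l\<^sub>d\<^sub>-\<^sub>1\<close>.\<close>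

definition bdet :: "nat \<Rightarrow> (nat \<Rightarrow> nat) \<Rightarrow> int" where
  "bdet d l = det (mat d d (\<lambda>(i, j). int (l i choose j)))"

lemma bdet_leibniz:
  "bdet d l = (\<Sum>\<pi> | \<pi> permutes {0..<d}. sign \<pi> * (\<Prod>i = 0..<d. int (l i choose \<pi> i)))"
  unfolding bdet_def
  by (subst det_def'[of _ d]) (auto intro!: sum.cong prod.cong dest: permutes_in_image)

lemma binomial_absorb_int: "int l * int ((l - 1) choose j) = (int l - int j) * int (l choose j)"
proof (cases "j \<le> l")
  case True
  have "int ((l - j) * (l choose j)) = int (l * ((l - 1) choose j))"
    using binomial_absorb_comp[of l j] by simp
  then show ?thesis using True by (simp add: of_nat_diff)
next
  case False
  then show ?thesis by (simp add: binomial_eq_0 not_le)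
qed

text \<open>By \<open>l * ((l - 1) choose j) = (l - j) * (l choose j)\<close>, lowering row
  \<open>i\<close> with weight \<open>l i\<close> multiplies the Leibniz term of \<pi> by
  \<open>l i - \<pi> i\<close>. Summed over \<open>i\<close> this factor is the same for every
  \<pi>.\<close>

lemma bdet_decrement_sum:
  "(\<Sum>i<d. int (l i) * bdet d (l(i := l i - 1))) = ((\<Sum>i<d. int (l i)) - (\<Sum>i<d. int i)) * bdet d l"
proof -
  have "(\<Sum>i<d. int (l i) * bdet d (l(i := l i - 1))) =
     (\<Sum>i<d. \<Sum>\<pi> | \<pi> permutes {0..<d}. sign \<pi> * ((int (l i) - int (\<pi> i)) * (\<Prod>a = 0..<d. int (l a choose \<pi> a))))"
  proof (intro sum.cong refl)
    fix i assume i: "i \<in> {..<d}"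
    have "int (l i) * (\<Prod>a = 0..<d. int ((l(i := l i - 1)) a choose \<pi> a)) =
      (int (l i) - int (\<pi> i)) * (\<Prod>a = 0..<d. int (l a choose \<pi> a))" for \<pi>
    proof -
      have i': "i \<in> {0..<d}" using i by simp
      have "(\<Prod>a = 0..<d. int ((l(i := l i - 1)) a choose \<pi> a)) =
          int ((l i - 1) choose \<pi> i) * (\<Prod>a \<in> {0..<d} - {i}. int (l a choose \<pi> a))"
        by (subst prod.remove[OF _ i']) (auto intro!: prod.cong)
      moreover have "(\<Prod>a = 0..<d. int (l a choose \<pi> a)) =
          int (l i choose \<pi> i) * (\<Prod>a \<in> {0..<d} - {i}. int (l a choose \<pi> a))"
        by (subst prod.remove[OF _ i']) auto
      ultimately show ?thesis
        using binomial_absorb_int[of "l i" "\<pi> i"] by (simp only: mult.assoc[symmetric])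
    qed
    then show "int (l i) * bdet d (l(i := l i - 1)) =
      (\<Sum>\<pi> | \<pi> permutes {0..<d}. sign \<pi> * ((int (l i) - int (\<pi> i)) * (\<Prod>a = 0..<d. int (l a choose \<pi> a))))"
      unfolding bdet_leibniz sum_distrib_left by (intro sum.cong refl) (simp only: mult.left_commute)
  qed
  also have "\<dots> = (\<Sum>\<pi> | \<pi> permutes {0..<d}. sign \<pi> *
      (((\<Sum>i<d. int (l i)) - (\<Sum>i<d. int (\<pi> i))) * (\<Prod>a = 0..<d. int (l a choose \<pi> a))))"
    by (subst sum.swap) (simp only: sum_distrib_left[symmetric] sum_distrib_right[symmetric] sum_subtractf)
  also have "\<dots> = (\<Sum>\<pi> | \<pi> permutes {0..<d}. sign \<pi> *
      (((\<Sum>i<d. int (l i)) - (\<Sum>i<d. int i)) * (\<Prod>a = 0..<d. int (l a choose \<pi> a))))"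
  proof (intro sum.cong refl, goal_cases)
    case (1 \<pi>)
    then have "(\<Sum>i\<in>{0..<d}. int (\<pi> i)) = (\<Sum>i\<in>{0..<d}. int i)"
      using sum.permute[of \<pi> "{0..<d}" int] by simp
    then show ?case by (simp add: atLeast0LessThan)
  qed
  also have "\<dots> = ((\<Sum>i<d. int (l i)) - (\<Sum>i<d. int i)) * bdet d l"
    unfolding bdet_leibniz sum_distrib_left by (intro sum.cong refl) (simp only: mult.left_commute)
  finally show ?thesis .
qed

lemma bdet_equal_rows:
  assumes "i < d" "j < d" "i \<noteq> j" "l i = l j"
  shows "bdet d l = 0"
  unfolding bdet_def
  by (rule det_identical_rows[OF _ assms(3,1,2)]) (use assms in \<open>auto intro!: eq_vecI\<close>)

lemma sum_choose_interval:
  "a \<le> b \<Longrightarrow> (\<Sum>x\<in>{a..<b}. int (x choose j)) = int (b choose Suc j) - int (a choose Suc j)"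
  by (induction b rule: dec_induct) auto

text \<open>Subtracting consecutive rows removes the first column; the differences
  \<open>(b choose (j+1)) - (a choose (j+1))\<close> are then sums of \<open>x choose j\<close> over \<open>a \<le> x < b\<close>.\<close>

lemma bdet_branching:
  assumes mono: "\<And>i. i < d \<Longrightarrow> l i \<le> l (Suc i)"
  shows "bdet (Suc d) l = (\<Sum>k\<in>(\<Pi>\<^sub>E i\<in>{0..<d}. {l i..<l (Suc i)}). bdet d k)"
proof -
  define N1 :: "int mat" where
    "N1 = mat d d (\<lambda>(i, j). int (l (Suc i) choose Suc j) - int (l i choose Suc j))"
  define N :: "int mat" where "N = mat (Suc d) (Suc d)
    (\<lambda>(i, j). if i = 0 then int (l 0 choose j) else int (l i choose j) - int (l (i - 1) choose j))"
  \<comment> \<open>Lower unitriangular summation matrix: it undoes the row differences collected in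
    \<open>N\<close>, whence \<open>det N = det M\<close>. The first column of \<open>N\<close> is a
    unit vector because \<open>x choose 0 = 1\<close>.\<close>
  define L :: "int mat" where "L = mat (Suc d) (Suc d) (\<lambda>(i, j). if j \<le> i then 1 else 0)"
  define M :: "int mat" where "M = mat (Suc d) (Suc d) (\<lambda>(i, j). int (l i choose j))"
  have carr: "N1 \<in> carrier_mat d d" "N \<in> carrier_mat (Suc d) (Suc d)" "L \<in> carrier_mat (Suc d) (Suc d)"
    "M \<in> carrier_mat (Suc d) (Suc d)" by (simp_all add: N1_def N_def L_def M_def)
  have tel: "(\<Sum>a = 0..<Suc i. if a = 0 then int (l 0 choose j) else int (l a choose j) - int (l (a - 1) choose j))
      = int (l i choose j)" for i j
    by (induction i) auto
  have "L * N = M"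
  proof (rule eq_matI)
    fix i j assume ij: "i < dim_row M" "j < dim_col M"
    have "(L * N) $$ (i, j) = (\<Sum>a = 0..<Suc d. (if a \<le> i then 1 else 0) *
       (if a = 0 then int (l 0 choose j) else int (l a choose j) - int (l (a - 1) choose j)))"
      using ij by (simp add: L_def N_def M_def scalar_prod_def del: sum.op_ivl_Suc)
    also have "\<dots> = (\<Sum>a = 0..<Suc i. if a = 0 then int (l 0 choose j) else int (l a choose j) - int (l (a - 1) choose j))"
      using ij by (intro sum.mono_neutral_cong_right) (auto simp: M_def)
    also have "\<dots> = M $$ (i, j)" unfolding tel using ij by (simp add: M_def)
    finally show "(L * N) $$ (i, j) = M $$ (i, j)" .
  qed (simp_all add: L_def N_def M_def)
  moreover have "det L = 1"
  proof -
    have "det L = prod_list (diag_mat L)"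
      by (rule det_lower_triangular[OF _ carr(3)]) (auto simp: L_def)
    also have "diag_mat L = map (\<lambda>i. 1) [0..<Suc d]"
      unfolding diag_mat_def by (rule map_cong) (auto simp: L_def)
    finally show ?thesis by (simp add: map_replicate_const prod_list_replicate del: upt_Suc)
  qed
  moreover have "det N = det N1"
  proof -
    have "det N = (\<Sum>i<Suc d. N $$ (i, 0) * cofactor N i 0)"
      by (rule laplace_expansion_column[OF carr(2)]) simp
    also have "\<dots> = (\<Sum>i<Suc d. if i = 0 then cofactor N 0 0 else 0)"
      by (intro sum.cong refl) (auto simp: N_def)
    also have "\<dots> = cofactor N 0 0" by simp
    also have "\<dots> = det (mat_delete N 0 0)" by (simp add: cofactor_def)
    also have "mat_delete N 0 0 = N1"
      by (rule eq_matI) (auto simp: mat_delete_def N_def N1_def)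
    finally show ?thesis .
  qed
  ultimately have "det M = det N1" using det_mult[OF carr(3,2)] by simp
  then have "bdet (Suc d) l = det N1" by (simp add: bdet_def M_def)
  also have "\<dots> = (\<Sum>\<pi> | \<pi> permutes {0..<d}. sign \<pi> *
      (\<Prod>i = 0..<d. int (l (Suc i) choose Suc (\<pi> i)) - int (l i choose Suc (\<pi> i))))"
    by (subst det_def'[OF carr(1)]) (auto simp: N1_def intro!: sum.cong prod.cong dest: permutes_in_image)
  also have "\<dots> = (\<Sum>\<pi> | \<pi> permutes {0..<d}. sign \<pi> *
      (\<Prod>i = 0..<d. \<Sum>x\<in>{l i..<l (Suc i)}. int (x choose \<pi> i)))"
    using mono by (intro sum.cong refl arg_cong2[of _ _ _ _ "(*)"] prod.cong)
      (simp add: sum_choose_interval)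
  also have "\<dots> = (\<Sum>\<pi> | \<pi> permutes {0..<d}. sign \<pi> *
      (\<Sum>k\<in>(\<Pi>\<^sub>E i\<in>{0..<d}. {l i..<l (Suc i)}). \<Prod>i = 0..<d. int (k i choose \<pi> i)))"
    by (subst prod_sum_PiE) auto
  also have "\<dots> = (\<Sum>k\<in>(\<Pi>\<^sub>E i\<in>{0..<d}. {l i..<l (Suc i)}). bdet d k)"
    unfolding bdet_leibniz sum_distrib_left by (rule sum.swap)
  finally show ?thesis .
qed

definition row_ssyt :: "nat \<Rightarrow> (nat \<Rightarrow> nat) \<Rightarrow> tableau set" where
  "row_ssyt d f = {T. (\<forall>c\<in>row_cells f. T c \<in> {1..d})
      \<and> (\<forall>c. c \<notin> row_cells f \<longrightarrow> T c = 0)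
      \<and> (\<forall>r c c'. (r, c) \<in> row_cells f \<longrightarrow> (r, c') \<in> row_cells f \<longrightarrow> c < c' \<longrightarrow> T (r, c) \<le> T (r, c'))
      \<and> (\<forall>r r' c. (r, c) \<in> row_cells f \<longrightarrow> (r', c) \<in> row_cells f \<longrightarrow> r < r' \<longrightarrow> T (r, c) < T (r', c))}"

lemma ssyt_row_ssyt: "ssyt d lam = row_ssyt d (rowlen lam)"
  by (simp add: ssyt_def row_ssyt_def cells_eq_row_cells)

text \<open>Entries grow by at least one per row, so entries at most \<open>d\<close> stay within
  the first \<open>d\<close> rows. This is what makes the last row disappear when the number of
  letters drops by one.\<close>

lemma row_ssyt_ge:
  assumes T: "T \<in> row_ssyt d f" and anti: "antimono f" and c: "c < f r"
  shows "Suc r \<le> T (r, c)"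
  using c
proof (induction r)
  case 0
  then show ?case using T by (fastforce simp: row_ssyt_def row_cells_def)
next
  case (Suc r)
  have "c < f r" using antimonoD[OF anti, of r "Suc r"] Suc.prems by simp
  moreover have "T (r, c) < T (Suc r, c)"
    using T \<open>c < f r\<close> Suc.prems unfolding row_ssyt_def by auto
  ultimately show ?case using Suc.IH by simp
qed

text \<open>Rows are numbered from the bottom, so that the beta numbers of a partition are increasing;
  \<open>interlaced d k\<close> is the partition with beta numbers \<open>k\<close>.\<close>

definition interlaced :: "nat \<Rightarrow> (nat \<Rightarrow> nat) \<Rightarrow> nat \<Rightarrow> nat" where
  "interlaced d k r = (if r < d then k (d - 1 - r) - (d - 1 - r) else 0)"

definition beta_numbers :: "nat \<Rightarrow> (nat \<Rightarrow> nat) \<Rightarrow> nat \<Rightarrow> nat" where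
  "beta_numbers d f i = f (d - 1 - i) + i"

lemma downset_nat: "finite (A :: nat set) \<Longrightarrow> (\<And>x y. x \<in> A \<Longrightarrow> y < x \<Longrightarrow> y \<in> A) \<Longrightarrow> A = {..<card A}"
proof -
  assume fin: "finite A" and down: "\<And>x y. x \<in> A \<Longrightarrow> y < x \<Longrightarrow> y \<in> A"
  define m where "m = (LEAST x. x \<notin> A)"
  have "\<exists>x. x \<notin> A" using fin by (rule ex_new_if_finite[OF infinite_UNIV_nat])
  then have m: "m \<notin> A" unfolding m_def by (rule LeastI_ex)
  have "x \<in> A" if "x < m" for x using not_less_Least that unfolding m_def by blast
  moreover have "x < m" if "x \<in> A" for x using down[OF that, of m] m that by (metis linorder_neqE_nat)
  ultimately have "A = {..<m}" by auto
  then show ?thesis by simp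
qed

lemma interlaced_bounds:
  assumes k: "k \<in> (\<Pi>\<^sub>E i\<in>{0..<d}. {beta_numbers (Suc d) f i..<beta_numbers (Suc d) f (Suc i)})"
    and r: "r < d"
  shows "f (Suc r) \<le> interlaced d k r" "interlaced d k r \<le> f r"
proof -
  let ?i = "d - 1 - r"
  have "?i \<in> {0..<d}" using r by simp
  then have "k ?i \<in> {beta_numbers (Suc d) f ?i..<beta_numbers (Suc d) f (Suc ?i)}"
    using k by (rule PiE_mem[rotated])
  moreover have "Suc d - 1 - ?i = Suc r" "Suc d - 1 - Suc ?i = r" using r by auto
  ultimately show "f (Suc r) \<le> interlaced d k r" "interlaced d k r \<le> f r"
    using r by (auto simp: beta_numbers_def interlaced_def)
qed

lemma interlaced_antimono:
  assumes k: "k \<in> (\<Pi>\<^sub>E i\<in>{0..<d}. {beta_numbers (Suc d) f i..<beta_numbers (Suc d) f (Suc i)})"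
  shows "antimono (interlaced d k)"
proof (rule antimonoI)
  fix r s :: nat assume "r \<le> s"
  then show "interlaced d k s \<le> interlaced d k r"
  proof (induction s rule: dec_induct)
    case (step s)
    have "interlaced d k (Suc s) \<le> interlaced d k s"
    proof (cases "Suc s < d")
      case True
      then show ?thesis using interlaced_bounds[OF k, of s] interlaced_bounds[OF k, of "Suc s"] by simp
    qed (simp add: interlaced_def)
    then show ?case using step.IH by simp
  qed simp
qed

lemma interlaced_inj:
  assumes k: "k \<in> (\<Pi>\<^sub>E i\<in>{0..<d}. {beta_numbers (Suc d) f i..<beta_numbers (Suc d) f (Suc i)})"
    and k': "k' \<in> (\<Pi>\<^sub>E i\<in>{0..<d}. {beta_numbers (Suc d) f i..<beta_numbers (Suc d) f (Suc i)})"
    and eq: "interlaced d k = interlaced d k'"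
  shows "k = k'"
proof (rule PiE_ext[OF k k'])
  fix i assume i: "i \<in> {0..<d}"
  have "k i \<ge> i" "k' i \<ge> i" using PiE_mem[OF k i] PiE_mem[OF k' i] by (auto simp: beta_numbers_def)
  moreover have "k i - i = k' i - i"
    using fun_cong[OF eq, of "d - 1 - i"] i by (simp add: interlaced_def)
  ultimately show "k i = k' i" by simp
qed

definition ext_ssyt :: "nat \<Rightarrow> (nat \<Rightarrow> nat) \<Rightarrow> (nat \<Rightarrow> nat) \<Rightarrow> tableau \<Rightarrow> tableau" where
  "ext_ssyt d f g T c = (if c \<in> row_cells f - row_cells g then Suc d else T c)"

lemma row_ssytD:
  assumes "T \<in> row_ssyt d f"
  shows "c \<in> row_cells f \<Longrightarrow> 1 \<le> T c \<and> T c \<le> d" "c \<notin> row_cells f \<Longrightarrow> T c = 0"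
    "c2 < f r \<Longrightarrow> c1 \<le> c2 \<Longrightarrow> T (r, c1) \<le> T (r, c2)"
    "c1 < f r \<Longrightarrow> c1 < f r' \<Longrightarrow> r < r' \<Longrightarrow> T (r, c1) < T (r', c1)"
proof -
  show "c2 < f r \<Longrightarrow> c1 \<le> c2 \<Longrightarrow> T (r, c1) \<le> T (r, c2)"
    using assms unfolding row_ssyt_def by (cases "c1 = c2") auto
  show "c \<notin> row_cells f \<Longrightarrow> T c = 0" using assms unfolding row_ssyt_def by blast
qed (use assms in \<open>auto simp: row_ssyt_def\<close>)

lemma row_ssytI:
  assumes "\<And>c. c \<in> row_cells f \<Longrightarrow> 1 \<le> T c \<and> T c \<le> d" "\<And>c. c \<notin> row_cells f \<Longrightarrow> T c = 0"
    "\<And>r c c'. c < f r \<Longrightarrow> c' < f r \<Longrightarrow> c < c' \<Longrightarrow> T (r, c) \<le> T (r, c')"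
    "\<And>r r' c. c < f r \<Longrightarrow> c < f r' \<Longrightarrow> r < r' \<Longrightarrow> T (r, c) < T (r', c)"
  shows "T \<in> row_ssyt d f"
  using assms unfolding row_ssyt_def by auto

text \<open>Deleting the letter \<open>Suc d\<close> removes a horizontal strip, so the remaining
  shape interlaces with \<open>f\<close> (one Gelfand-Tsetlin step). In beta numbers interlacing is
  an independent choice of each \<open>k i\<close> from a half-open interval, exactly the index set
  of \<open>bdet_branching\<close>.\<close>

lemma row_ssyt_Suc:
  assumes anti: "antimono f" and z: "\<And>r. Suc d \<le> r \<Longrightarrow> f r = 0"
  shows "row_ssyt (Suc d) f =
    (\<Union>k\<in>(\<Pi>\<^sub>E i\<in>{0..<d}. {beta_numbers (Suc d) f i..<beta_numbers (Suc d) f (Suc i)}).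
      ext_ssyt d f (interlaced d k) ` row_ssyt d (interlaced d k))" (is "_ = (\<Union>k\<in>?K. ?E k)")
proof (intro equalityI subsetI)
  fix T assume "T \<in> (\<Union>k\<in>?K. ?E k)"
  then obtain k T' where k: "k \<in> ?K" and T': "T' \<in> row_ssyt d (interlaced d k)"
    and T: "T = ext_ssyt d f (interlaced d k) T'" by blast
  let ?g = "interlaced d k"
  have gf: "?g r \<le> f r" for r using interlaced_bounds[OF k, of r] by (cases "r < d") (auto simp: interlaced_def)
  have fg: "f (Suc r) \<le> ?g r" for r
    using interlaced_bounds[OF k, of r] z[of "Suc r"] by (cases "r < d") auto
  note D = row_ssytD[OF T']
  show "T \<in> row_ssyt (Suc d) f"
  proof (rule row_ssytI)
    fix c assume "c \<in> row_cells f"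
    then show "1 \<le> T c \<and> T c \<le> Suc d" using D(1)[of c] by (auto simp: T ext_ssyt_def)
  next
    fix c :: "nat \<times> nat" assume "c \<notin> row_cells f"
    moreover from this have "c \<notin> row_cells ?g" using gf by (cases c) (auto simp: not_less intro: order_trans)
    ultimately show "T c = 0" using D(2)[of c] by (auto simp: T ext_ssyt_def)
  next
    fix r c c' assume c: "c < f r" "c' < f r" "c < c'"
    show "T (r, c) \<le> T (r, c')"
    proof (cases "c' < ?g r")
      case True
      then show ?thesis using D(3)[of c' r c] c by (auto simp: T ext_ssyt_def)
    next
      case False
      then show ?thesis using D(1)[of "(r, c)"] c by (auto simp: T ext_ssyt_def)
    qed
  next
    fix r r' c assume c: "c < f r" "c < f r'" "r < r'"
    have "f r' \<le> f (Suc r)" using c by (intro antimonoD[OF anti]) simp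
    then have cg: "c < ?g r" using fg[of r] c by simp
    show "T (r, c) < T (r', c)"
    proof (cases "c < ?g r'")
      case True
      then show ?thesis using D(4)[of c r r'] c cg by (auto simp: T ext_ssyt_def)
    next
      case False
      then show ?thesis using D(1)[of "(r, c)"] c cg by (auto simp: T ext_ssyt_def)
    qed
  qed
next
  fix T assume T: "T \<in> row_ssyt (Suc d) f"
  note D = row_ssytD[OF T]
  \<comment> \<open>Rows increase weakly, so the cells with letter at most \<open>d\<close> form an
    initial segment of each row; \<open>g\<close> is its length.\<close>
  define g where "g r = card {c. c < f r \<and> T (r, c) \<le> d}" for r
  have g: "{c. c < f r \<and> T (r, c) \<le> d} = {..<g r}" for r
    unfolding g_def
  proof (rule downset_nat)
    fix x y assume "x \<in> {c. c < f r \<and> T (r, c) \<le> d}" "y < x"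
    then show "y \<in> {c. c < f r \<and> T (r, c) \<le> d}" using D(3)[of x r y] by auto
  qed simp
  have g_iff: "c < g r \<longleftrightarrow> c < f r \<and> T (r, c) \<le> d" for r c using g[of r] by auto
  have gf: "g r \<le> f r" for r using g_iff[of "f r" r] by (meson not_less order_refl)
  have fg: "f (Suc r) \<le> g r" for r
  proof (rule ccontr)
    assume "\<not> f (Suc r) \<le> g r"
    then have c: "g r < f (Suc r)" by simp
    have c': "g r < f r" using antimonoD[OF anti, of r "Suc r"] c by simp
    have "T (r, g r) < T (Suc r, g r)" using D(4)[OF c' c] by simp
    moreover have "T (Suc r, g r) \<le> Suc d" using D(1)[of "(Suc r, g r)"] c by simp
    ultimately show False using g_iff[of "g r" r] c' by simp
  qed
  have g0: "g r = 0" if "d \<le> r" for r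
  proof (rule ccontr)
    assume "g r \<noteq> 0"
    then have "0 < f r" "T (r, 0) \<le> d" using g_iff[of 0 r] by auto
    then show False using row_ssyt_ge[OF T anti, of 0 r] that by simp
  qed
  define k where "k = restrict (\<lambda>i. g (d - 1 - i) + i) {0..<d}"
  have kg: "interlaced d k = g"
    by (rule ext) (auto simp: interlaced_def k_def g0)
  have k: "k \<in> ?K"
  proof (rule PiE_I)
    fix i assume i: "i \<in> {0..<d}"
    then have e: "Suc (d - 1 - i) = d - i" by auto
    show "k i \<in> {beta_numbers (Suc d) f i..<beta_numbers (Suc d) f (Suc i)}"
      using fg[of "d - 1 - i"] gf[of "d - 1 - i"] i unfolding e by (auto simp: k_def beta_numbers_def)
  qed (simp add: k_def)
  define T' where "T' c = (if c \<in> row_cells g then T c else 0)" for c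
  have "T' \<in> row_ssyt d g"
  proof (rule row_ssytI)
    fix c :: "nat \<times> nat" assume "c \<in> row_cells g"
    then show "1 \<le> T' c \<and> T' c \<le> d" using D(1)[of c] g_iff by (cases c) (auto simp: T'_def)
  next
    fix r c c' assume "c < g r" "c' < g r" "c < c'"
    then show "T' (r, c) \<le> T' (r, c')" using D(3)[of c' r c] g_iff by (auto simp: T'_def)
  next
    fix r r' c assume "c < g r" "c < g r'" "r < r'"
    then show "T' (r, c) < T' (r', c)" using D(4)[of c r r'] g_iff by (auto simp: T'_def)
  qed (simp add: T'_def)
  moreover have "T = ext_ssyt d f g T'"
  proof
    fix x :: "nat \<times> nat"
    obtain r c where x: "x = (r, c)" by fastforce
    show "T x = ext_ssyt d f g T' x"
      using D(1)[of x] D(2)[of x] g_iff[of c r] gf[of r] unfolding x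
      by (auto simp: ext_ssyt_def T'_def)
  qed
  ultimately show "T \<in> (\<Union>k\<in>?K. ?E k)" using k kg by blast
qed

lemma ext_ssyt_inj:
  assumes gf: "\<And>r. g r \<le> f r" "\<And>r. g' r \<le> f r"
    and T: "T \<in> row_ssyt d g" "T' \<in> row_ssyt d g'" and eq: "ext_ssyt d f g T = ext_ssyt d f g' T'"
  shows "g = g' \<and> T = T'"
proof -
  have rc: "row_cells h = {c \<in> row_cells f. ext_ssyt d f h S c \<le> d}"
    if "\<And>r. h r \<le> f r" "S \<in> row_ssyt d h" for h S
    using that(1) row_ssytD(1)[OF that(2)] by (auto simp: ext_ssyt_def less_le_trans)
  have "row_cells g = row_cells g'" using rc[OF gf(1) T(1)] rc[OF gf(2) T(2)] eq by simp
  then have g: "g = g'" by (rule row_cells_inj)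
  have "T c = T' c" for c
    using fun_cong[OF eq, of c] row_ssytD(2)[OF T(1), of c] row_ssytD(2)[OF T(2), of c] g
    by (cases "c \<in> row_cells g") (auto simp: ext_ssyt_def)
  then show ?thesis using g by auto
qed

text \<open>Tableaux and determinants obey one recursion over the same index set \<open>?K\<close>,
  by \<open>row_ssyt_Suc\<close> and \<open>bdet_branching\<close>.\<close>

theorem card_row_ssyt:
  assumes "antimono f" "\<And>r. d \<le> r \<Longrightarrow> f r = 0"
  shows "finite (row_ssyt d f) \<and> int (card (row_ssyt d f)) = bdet d (beta_numbers d f)"
  using assms
proof (induction d arbitrary: f)
  case 0
  then have "row_cells f = {}" by (auto simp: row_cells_def)
  then have "row_ssyt 0 f = {\<lambda>_. 0}" by (auto simp: row_ssyt_def)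
  then show ?case by (simp add: bdet_def)
next
  case (Suc d)
  let ?K = "\<Pi>\<^sub>E i\<in>{0..<d}. {beta_numbers (Suc d) f i..<beta_numbers (Suc d) f (Suc i)}"
  let ?E = "\<lambda>k. ext_ssyt d f (interlaced d k) ` row_ssyt d (interlaced d k)"
  have finK: "finite ?K" by (intro finite_PiE) auto
  have IH: "finite (row_ssyt d (interlaced d k))"
    "int (card (row_ssyt d (interlaced d k))) = bdet d (beta_numbers d (interlaced d k))" if "k \<in> ?K" for k
  proof -
    have "interlaced d k r = 0" if "d \<le> r" for r using that by (simp add: interlaced_def)
    from Suc.IH[OF interlaced_antimono[OF that] this]
    show "finite (row_ssyt d (interlaced d k))"
      "int (card (row_ssyt d (interlaced d k))) = bdet d (beta_numbers d (interlaced d k))" by auto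
  qed
  have gf: "interlaced d k r \<le> f r" if "k \<in> ?K" for k r
    using interlaced_bounds[OF that, of r] by (cases "r < d") (auto simp: interlaced_def)
  have inj: "k = k' \<and> T = T'"
    if "k \<in> ?K" "k' \<in> ?K" "T \<in> row_ssyt d (interlaced d k)" "T' \<in> row_ssyt d (interlaced d k')"
      "ext_ssyt d f (interlaced d k) T = ext_ssyt d f (interlaced d k') T'" for k k' T T'
    using ext_ssyt_inj[OF gf[OF that(1)] gf[OF that(2)] that(3-5)] interlaced_inj[OF that(1,2)] by blast
  have eq: "row_ssyt (Suc d) f = (\<Union>k\<in>?K. ?E k)" by (rule row_ssyt_Suc[OF Suc.prems])
  have "card (row_ssyt (Suc d) f) = (\<Sum>k\<in>?K. card (?E k))"
    unfolding eq
  proof (rule card_UN_disjoint[OF finK])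
    show "\<forall>k\<in>?K. \<forall>k'\<in>?K. k \<noteq> k' \<longrightarrow> ?E k \<inter> ?E k' = {}" using inj by blast
  qed (use IH in auto)
  also have "\<dots> = (\<Sum>k\<in>?K. card (row_ssyt d (interlaced d k)))"
  proof (intro sum.cong refl card_image inj_onI)
    fix k T T' assume "k \<in> ?K" "T \<in> row_ssyt d (interlaced d k)" "T' \<in> row_ssyt d (interlaced d k)"
      "ext_ssyt d f (interlaced d k) T = ext_ssyt d f (interlaced d k) T'"
    then show "T = T'" using inj by blast
  qed
  finally have "int (card (row_ssyt (Suc d) f)) = (\<Sum>k\<in>?K. bdet d (beta_numbers d (interlaced d k)))"
    using IH by simp
  also have "\<dots> = (\<Sum>k\<in>?K. bdet d k)"
  proof (intro sum.cong refl)
    fix k assume k: "k \<in> ?K"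
    have "beta_numbers d (interlaced d k) i = k i" if "i < d" for i
    proof -
      have "i \<le> k i" using PiE_mem[OF k, of i] that by (auto simp: beta_numbers_def)
      then show ?thesis using that by (simp add: beta_numbers_def interlaced_def)
    qed
    then show "bdet d (beta_numbers d (interlaced d k)) = bdet d k"
      unfolding bdet_leibniz by (intro sum.cong refl arg_cong2[of _ _ _ _ "(*)"] prod.cong) simp
  qed
  also have "\<dots> = bdet (Suc d) (beta_numbers (Suc d) f)"
  proof (rule bdet_branching[symmetric])
    fix i assume i: "i < d"
    have "f (Suc d - 1 - i) \<le> f (Suc d - 1 - Suc i)" by (rule antimonoD[OF Suc.prems(1)]) simp
    then show "beta_numbers (Suc d) f i \<le> beta_numbers (Suc d) f (Suc i)" by (simp add: beta_numbers_def)
  qed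
  finally show ?case using eq finK IH by auto
qed

lemma mult_eq_bdet:
  "is_partition d n lam \<Longrightarrow> int (Defs.mult d lam) = bdet d (beta_numbers d (rowlen lam))"
  using card_row_ssyt[OF rowlen_antimono[of d n lam] rowlen_zero[of d n lam]]
  by (auto simp: Defs.mult_def ssyt_row_ssyt)

section \<open>Branching of the multiplicities and the hook content formula\<close>

definition box_content :: "nat list \<Rightarrow> nat list \<Rightarrow> int" where
  "box_content lam alpha = int (snd (box lam alpha)) - int (fst (box lam alpha))"

text \<open>The beta number of a removable row is \<open>d\<close> plus the content of its last box,
  so \<open>bdet_decrement_sum\<close> is the claimed sum. Other rows contribute nothing: lowering
  one makes two beta numbers equal, or it is the empty bottom row with beta number 0.\<close>

theorem mult_branching:
  assumes P: "is_partition d n lam" and n: "1 \<le> n"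
  shows "int n * int (Defs.mult d lam) =
    (\<Sum>alpha | in_shape d alpha lam. (int d + box_content lam alpha) * int (Defs.mult d alpha))"
proof -
  define f where "f = rowlen lam"
  define l where "l = beta_numbers d f"
  have "(\<Sum>i<d. int (f (d - 1 - i))) = (\<Sum>i<d. int (f i))"
    using sum.nat_diff_reindex[of "\<lambda>i. int (f i)" d] by simp
  also have "\<dots> = int n" using rowlen_sum[OF P] by (simp add: f_def flip: of_nat_sum)
  finally have suml: "(\<Sum>i<d. int (l i)) - (\<Sum>i<d. int i) = int n"
    by (simp add: l_def beta_numbers_def sum.distrib)
  let ?G = "\<lambda>r. if removable lam r
    then (int d + box_content lam (remove_box lam r)) * int (Defs.mult d (remove_box lam r)) else 0"
  have term_eq: "int (l i) * bdet d (l(i := l i - 1)) = ?G (d - Suc i)" if i: "i < d" for i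
  proof -
    define r where "r = d - Suc i"
    have r: "d - Suc i = r" by (simp add: r_def)
    have li: "l i = f r + i" by (simp add: l_def beta_numbers_def r)
    show ?thesis
    proof (cases "removable lam r")
      case True
      have pos: "0 < f r" using True by (simp add: removable_def f_def)
      have Pa: "is_partition d (n - 1) (remove_box lam r)"
        by (rule in_shape_partition[OF P remove_box_in_shape[OF P True]])
      have "beta_numbers d (f(r := f r - 1)) a = (l(i := l i - 1)) a" if a: "a < d" for a
      proof (cases "a = i")
        case True
        then show ?thesis using pos by (simp add: beta_numbers_def li r)
      next
        case False
        then have "d - 1 - a \<noteq> r" using a i by (auto simp: r_def)
        then show ?thesis using False by (simp add: beta_numbers_def l_def)
      qed
      then have "bdet d (l(i := l i - 1)) = bdet d (beta_numbers d (f(r := f r - 1)))"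
        unfolding bdet_leibniz by (intro sum.cong refl arg_cong2[of _ _ _ _ "(*)"] prod.cong) simp
      also have "\<dots> = int (Defs.mult d (remove_box lam r))"
        by (simp add: mult_eq_bdet[OF Pa] rowlen_remove_box[OF P True] f_def)
      finally have *: "bdet d (l(i := l i - 1)) = int (Defs.mult d (remove_box lam r))" .
      have "int (l i) = int d + box_content lam (remove_box lam r)"
        using pos i li unfolding box_content_def box_remove_box[OF P True]
        by (simp add: r_def of_nat_diff f_def)
      then show ?thesis using True * by (simp add: r_def)
    next
      case False
      have "int (l i) * bdet d (l(i := l i - 1)) = 0"
      proof (cases "i = 0")
        case True
        have "rowlen lam (Suc r) = 0" by (rule rowlen_zero[OF P]) (use True i in \<open>simp add: r_def\<close>)
        then have "f r = 0" using False by (simp add: removable_def f_def)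
        then show ?thesis using True li by simp
      next
        case i0: False
        have "rowlen lam (Suc r) \<le> rowlen lam r" by (rule antimonoD[OF rowlen_antimono[OF P]]) simp
        then have fr: "f (Suc r) = f r" using False by (simp add: removable_def f_def)
        have "d - 1 - (i - 1) = Suc r" using i i0 by (simp add: r_def)
        then have "l (i - 1) = f r + (i - 1)" by (simp only: l_def beta_numbers_def fr)
        then have "(l(i := l i - 1)) i = (l(i := l i - 1)) (i - 1)" using i0 li by simp
        then show ?thesis using i i0 by (subst bdet_equal_rows[of i d "i - 1"]) auto
      qed
      then show ?thesis using False by (simp add: r_def)
    qed
  qed
  have "int n * int (Defs.mult d lam) = (\<Sum>i<d. int (l i) * bdet d (l(i := l i - 1)))"
    unfolding bdet_decrement_sum suml by (simp add: mult_eq_bdet[OF P] l_def f_def)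
  also have "\<dots> = (\<Sum>i<d. ?G (d - Suc i))" by (intro sum.cong refl term_eq) simp
  also have "\<dots> = (\<Sum>r<d. ?G r)" by (rule sum.nat_diff_reindex)
  also have "\<dots> = (\<Sum>r | removable lam r. (int d + box_content lam (remove_box lam r)) *
      int (Defs.mult d (remove_box lam r)))"
    using removable_less[OF P] by (intro sum.mono_neutral_cong_right) auto
  also have "\<dots> = (\<Sum>alpha | in_shape d alpha lam. (int d + box_content lam alpha) * int (Defs.mult d alpha))"
    unfolding shapes_eq[OF P n] by (subst sum.reindex[OF inj_on_remove_box[OF P]]) simp
  finally show ?thesis .
qed

text \<open>The numerator of the hook content formula.\<close>

definition content_prod :: "nat \<Rightarrow> nat list \<Rightarrow> int" where
  "content_prod d lam = (\<Prod>(r, c)\<in>cells lam. int d + int c - int r)"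

lemma content_prod_box:
  assumes P: "is_partition d n lam" and n: "1 \<le> n" and a: "in_shape d alpha lam"
  shows "content_prod d lam = (int d + box_content lam alpha) * content_prod d alpha"
  using cells_box[OF assms] unfolding content_prod_def box_content_def
  by (simp add: case_prod_beta algebra_simps)

lemma content_prod_pos:
  assumes P: "is_partition d n lam"
  shows "0 < content_prod d lam"
  unfolding content_prod_def
  using P by (intro prod_pos) (auto simp: cells_def is_partition_def)

lemma is_partition_0: "is_partition d 0 lam \<longleftrightarrow> lam = []"
  by (cases lam) (auto simp: is_partition_def)

text \<open>\<open>fact n / dim_irrep lam\<close> stands for the product of hook lengths. Both sides
  obey the same branching recursion, because passing from \<open>alpha\<close> to \<open>lam\<close>
  multiplies \<open>content_prod\<close> by the factor in \<open>mult_branching\<close>.\<close>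

theorem hook_content:
  "is_partition d n lam \<Longrightarrow> fact n * int (Defs.mult d lam) = int (dim_irrep lam) * content_prod d lam"
proof (induction n arbitrary: lam)
  case 0
  then have "lam = []" by (simp add: is_partition_0)
  moreover have "ssyt d [] = {\<lambda>_. 0}" "syt [] = {\<lambda>_. 0}"
    by (auto simp: ssyt_def syt_def cells_def bij_betw_def)
  ultimately show ?case
    by (simp add: Defs.mult_def dim_irrep_def content_prod_def cells_def bij_betw_def)
next
  case (Suc n)
  have n: "1 \<le> Suc n" by simp
  have "fact (Suc n) * int (Defs.mult d lam) = fact n * (int (Suc n) * int (Defs.mult d lam))"
    by (simp add: algebra_simps)
  also have "\<dots> = (\<Sum>alpha | in_shape d alpha lam.
      (int d + box_content lam alpha) * (fact n * int (Defs.mult d alpha)))"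
    unfolding mult_branching[OF Suc.prems n] by (simp add: sum_distrib_left algebra_simps)
  also have "\<dots> = (\<Sum>alpha | in_shape d alpha lam. int (dim_irrep alpha) * content_prod d lam)"
  proof (intro sum.cong refl, goal_cases)
    case (1 alpha)
    then have a: "in_shape d alpha lam" by simp
    have "is_partition d n alpha" using in_shape_partition[OF Suc.prems a] by simp
    then show ?case using Suc.IH content_prod_box[OF Suc.prems n a] by simp
  qed
  also have "\<dots> = int (dim_irrep lam) * content_prod d lam"
    by (simp add: dim_irrep_branching[OF Suc.prems n] sum_distrib_right)
  finally show ?case .
qed

lemma mult_pos:
  assumes "is_partition d n lam" "syt lam \<noteq> {}"
  shows "0 < Defs.mult d lam"
proof -
  have "0 < int (dim_irrep lam) * content_prod d lam"
    using assms content_prod_pos[OF assms(1)] by (auto simp: dim_irrep_def card_gt_0_iff)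
  then have "0 < fact n * int (Defs.mult d lam)" by (simp only: hook_content[OF assms(1)])
  then show ?thesis by (simp add: zero_less_mult_iff)
qed

text \<open>Dividing the hook content formulas of \<open>lam\<close> and \<open>alpha\<close>
  cancels all boxes but the removed one. Its factor is the eigenvalue that the partial trace
  produces.\<close>

lemma mult_ratio:
  assumes P: "is_partition d n lam" and n: "1 \<le> n" and a: "in_shape d alpha lam"
  shows "int n * int (Defs.mult d lam) * int (dim_irrep alpha) =
    int (dim_irrep lam) * (int d + box_content lam alpha) * int (Defs.mult d alpha)"
proof -
  note Pa = in_shape_partition[OF P a]
  have fn: "(fact n :: int) = int n * fact (n - 1)" using n by (simp add: fact_reduce)
  have "fact (n - 1) * (int n * int (Defs.mult d lam) * int (dim_irrep alpha)) =
      (fact n * int (Defs.mult d lam)) * int (dim_irrep alpha)"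
    by (simp add: fn)
  also have "\<dots> = int (dim_irrep lam) * (int d + box_content lam alpha) *
      (int (dim_irrep alpha) * content_prod d alpha)"
    by (simp add: hook_content[OF P] content_prod_box[OF P n a])
  also have "\<dots> = fact (n - 1) *
      (int (dim_irrep lam) * (int d + box_content lam alpha) * int (Defs.mult d alpha))"
    by (simp flip: hook_content[OF Pa])
  finally show ?thesis by simp
qed

section \<open>Irreducible matrix units\<close>


lemma sum_rotate3:
  "(\<Sum>a\<in>A. \<Sum>b\<in>B. \<Sum>c\<in>C. F a b c) = (\<Sum>b\<in>B. \<Sum>c\<in>C. \<Sum>a\<in>A. F a b c)"
  by (rule trans[OF sum.swap]) (rule sum.cong[OF refl], rule sum.swap)

lemma sum_swap_pairs:
  "(\<Sum>a\<in>A. \<Sum>b\<in>B. \<Sum>c\<in>C. \<Sum>d\<in>D. F a b c d) = (\<Sum>c\<in>C. \<Sum>d\<in>D. \<Sum>a\<in>A. \<Sum>b\<in>B. F a b c d)"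
  by (rule trans[OF sum.cong[OF refl sum_rotate3] sum_rotate3])

lemma finite_basis [simp]: "finite (basis d n)"
  by (auto simp: basis_def intro!: finite_PiE)

lemma basis_upd_Suc: "s \<in> basis d n \<Longrightarrow> c < d \<Longrightarrow> s(Suc n := c) \<in> basis d (Suc n)"
  by (auto simp: basis_def PiE_iff extensional_def)

lemma sum_basis_Suc:
  "(\<Sum>u\<in>basis d (Suc n). f u) = (\<Sum>s\<in>basis d n. \<Sum>c<d. f (s(Suc n := c)))"
proof -
  have ins: "{1..Suc n} = insert (Suc n) {1..n}" by auto
  have "(\<Sum>u\<in>basis d (Suc n). f u) =
      (\<Sum>(c, s)\<in>{0..<d} \<times> ({1..n} \<rightarrow>\<^sub>E {0..<d}). f (s(Suc n := c)))"
    unfolding basis_def ins PiE_insert_eq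
    using inj_combinator[of "Suc n" "{1..n}" "\<lambda>_. {0..<d}"]
    by (subst sum.reindex) (simp_all add: case_prod_unfold o_def)
  also have "\<dots> = (\<Sum>c<d. \<Sum>s\<in>basis d n. f (s(Suc n := c)))"
    by (simp add: sum.cartesian_product basis_def atLeast0LessThan)
  also have "\<dots> = (\<Sum>s\<in>basis d n. \<Sum>c<d. f (s(Suc n := c)))" by (rule sum.swap)
  finally show ?thesis .
qed

lemma basis_comp_perm: "x \<in> basis d n \<Longrightarrow> \<sigma> permutes {1..n} \<Longrightarrow> x \<circ> \<sigma> \<in> basis d n"
  unfolding basis_def PiE_iff extensional_def
  by (auto simp: permutes_not_in permutes_in_image) (metis atLeastAtMost_iff permutes_in_image)+

lemma Vperm_comp_iff:
  assumes "\<sigma> permutes {1..n}"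
  shows "Vperm \<sigma> y x = (if y \<circ> \<sigma> = x then 1 else 0)"
proof -
  have "y = x \<circ> inv \<sigma> \<longleftrightarrow> y \<circ> \<sigma> = x"
    using permutes_inv_o[OF assms] by (metis comp_assoc comp_id)
  then show ?thesis by (simp add: Vperm_def)
qed

lemma Vperm_transpose:
  assumes "\<sigma> permutes {1..n}"
  shows "Vperm (inv \<sigma>) x y = Vperm \<sigma> y x"
  using Vperm_comp_iff[OF assms, of y x] permutes_inv_inv[OF assms] by (auto simp: Vperm_def)

lemma Vperm_mult:
  assumes p: "\<sigma> permutes {1..n}" "\<tau> permutes {1..n}" and y: "y \<in> basis d n"
  shows "(\<Sum>z\<in>basis d n. Vperm \<sigma> y z * Vperm \<tau> z x) = Vperm (\<sigma> \<circ> \<tau>) y x"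
proof -
  have "(\<Sum>z\<in>basis d n. Vperm \<sigma> y z * Vperm \<tau> z x) =
      (\<Sum>z\<in>basis d n. if z = y \<circ> \<sigma> then Vperm \<tau> (y \<circ> \<sigma>) x else 0)"
    by (intro sum.cong) (auto simp: Vperm_comp_iff[OF p(1)])
  also have "\<dots> = Vperm \<tau> (y \<circ> \<sigma>) x" using basis_comp_perm[OF y p(1)] by simp
  also have "\<dots> = Vperm (\<sigma> \<circ> \<tau>) y x"
    by (simp add: Vperm_comp_iff[OF p(2)] Vperm_comp_iff[OF permutes_compose[OF p(2,1)]] comp_assoc)
  finally show ?thesis .
qed

text \<open>Collecting the double sum by the product \<rho> of the two permutations, the coefficient
  of \<open>Vperm \<rho>\<close> contains exactly the sum evaluated by
  \<open>young_orthogonality\<close>. The computation takes place in the group algebra, hence the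
  free local dimension \<open>e\<close>.\<close>

lemma Eunit_mult:
  assumes P: "is_partition d n mu" and Q: "is_partition d' n nu"
    and i: "i \<in> syt mu" "j \<in> syt mu" and k: "k \<in> syt nu" "l \<in> syt nu" and y: "y \<in> basis e n"
  shows "(\<Sum>z\<in>basis e n. Eunit n mu i j y z * Eunit n nu k l z x) =
    (if mu = nu \<and> j = k then Eunit n mu i l y x else 0)"
proof -
  let ?S = "{\<sigma>. \<sigma> permutes {1..n}}"
  let ?a = "complex_of_real (real (dim_irrep mu) / fact n)" and ?b = "complex_of_real (real (dim_irrep nu) / fact n)"
  let ?f = "\<lambda>\<sigma>. complex_of_real (young_rep mu (inv \<sigma>) j i)" and ?g = "\<lambda>\<sigma>. complex_of_real (young_rep nu (inv \<sigma>) l k)"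
  have "(\<Sum>z\<in>basis e n. Eunit n mu i j y z * Eunit n nu k l z x) =
     ?a * ?b * (\<Sum>\<sigma>\<in>?S. \<Sum>\<tau>\<in>?S. ?f \<sigma> * ?g \<tau> * (\<Sum>z\<in>basis e n. Vperm \<sigma> y z * Vperm \<tau> z x))"
  proof -
    have "Eunit n mu i j y z * Eunit n nu k l z x = ?a * ?b *
        (\<Sum>\<sigma>\<in>?S. \<Sum>\<tau>\<in>?S. ?f \<sigma> * ?g \<tau> * (Vperm \<sigma> y z * Vperm \<tau> z x))" for z
    proof -
      have "Eunit n mu i j y z * Eunit n nu k l z x =
        ?a * ?b * ((\<Sum>\<sigma>\<in>?S. ?f \<sigma> * Vperm \<sigma> y z) * (\<Sum>\<tau>\<in>?S. ?g \<tau> * Vperm \<tau> z x))"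
        by (simp only: Eunit_def mult_ac)
      then show ?thesis by (simp only: sum_product mult_ac)
    qed
    then have "(\<Sum>z\<in>basis e n. Eunit n mu i j y z * Eunit n nu k l z x) = ?a * ?b *
       (\<Sum>z\<in>basis e n. \<Sum>\<sigma>\<in>?S. \<Sum>\<tau>\<in>?S. ?f \<sigma> * ?g \<tau> * (Vperm \<sigma> y z * Vperm \<tau> z x))"
      by (simp only: sum_distrib_left)
    also have "(\<Sum>z\<in>basis e n. \<Sum>\<sigma>\<in>?S. \<Sum>\<tau>\<in>?S. ?f \<sigma> * ?g \<tau> * (Vperm \<sigma> y z * Vperm \<tau> z x)) =
       (\<Sum>\<sigma>\<in>?S. \<Sum>\<tau>\<in>?S. \<Sum>z\<in>basis e n. ?f \<sigma> * ?g \<tau> * (Vperm \<sigma> y z * Vperm \<tau> z x))"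
      by (rule sum_rotate3)
    finally show ?thesis by (simp only: sum_distrib_left)
  qed
  also have "\<dots> = ?a * ?b * (\<Sum>\<sigma>\<in>?S. \<Sum>\<tau>\<in>?S. ?f \<sigma> * ?g \<tau> * Vperm (\<sigma> \<circ> \<tau>) y x)"
    using y by (intro arg_cong2[of _ _ _ _ "(*)"] sum.cong refl) (simp add: Vperm_mult)
  also have "\<dots> = ?a * ?b * (\<Sum>\<sigma>\<in>?S. \<Sum>\<rho>\<in>?S. ?f \<sigma> * complex_of_real (young_rep nu (inv \<rho> \<circ> \<sigma>) l k) * Vperm \<rho> y x)"
  proof (rule arg_cong2[of _ _ _ _ "(*)", OF refl], rule sum.cong[OF refl])
    fix \<sigma> assume "\<sigma> \<in> ?S"
    then have s: "\<sigma> permutes {1..n}" by simp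
    show "(\<Sum>\<tau>\<in>?S. ?f \<sigma> * ?g \<tau> * Vperm (\<sigma> \<circ> \<tau>) y x) =
      (\<Sum>\<rho>\<in>?S. ?f \<sigma> * complex_of_real (young_rep nu (inv \<rho> \<circ> \<sigma>) l k) * Vperm \<rho> y x)"
    proof (rule sum.reindex_bij_witness[of _ "\<lambda>\<rho>. inv \<sigma> \<circ> \<rho>" "\<lambda>\<tau>. \<sigma> \<circ> \<tau>"], goal_cases)
      case (1 \<tau>) then show ?case using s by (simp add: o_assoc permutes_inv_o)
    next
      case (2 \<tau>) then show ?case using s by (simp add: permutes_compose)
    next
      case (3 \<rho>) then show ?case using s by (simp add: o_assoc permutes_inv_o)
    next
      case (4 \<rho>) then show ?case using s by (simp add: permutes_compose permutes_inv)
    next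
      case (5 \<tau>)
      then have "inv (\<sigma> \<circ> \<tau>) \<circ> \<sigma> = inv \<tau>"
        using s by (simp add: o_inv_distrib permutes_bij comp_assoc permutes_inv_o)
      then show ?case by simp
    qed
  qed
  also have "\<dots> = ?a * ?b * (\<Sum>\<rho>\<in>?S. (\<Sum>\<sigma>\<in>?S. complex_of_real
      (young_rep mu (inv \<sigma>) j i * young_rep nu (inv \<rho> \<circ> \<sigma>) l k)) * Vperm \<rho> y x)"
    by (subst sum.swap) (simp add: sum_distrib_right)
  also have "\<dots> = ?a * ?b * (\<Sum>\<rho>\<in>?S. complex_of_real (\<Sum>m\<in>syt nu. young_rep nu (inv \<rho>) l m *
      (\<Sum>\<sigma>\<in>?S. young_rep nu \<sigma> m k * young_rep mu (inv \<sigma>) j i)) * Vperm \<rho> y x)"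
  proof (intro arg_cong2[of _ _ _ _ "(*)"] sum.cong refl)
    fix \<rho> assume "\<rho> \<in> ?S"
    then have r: "inv \<rho> permutes {1..n}" by (simp add: permutes_inv)
    have "(\<Sum>\<sigma>\<in>?S. young_rep mu (inv \<sigma>) j i * young_rep nu (inv \<rho> \<circ> \<sigma>) l k) =
       (\<Sum>\<sigma>\<in>?S. young_rep mu (inv \<sigma>) j i * (\<Sum>m\<in>syt nu. young_rep nu (inv \<rho>) l m * young_rep nu \<sigma> m k))"
      by (intro sum.cong refl) (simp add: young_rep_comp[OF Q r _ k(2)])
    also have "\<dots> = (\<Sum>m\<in>syt nu. young_rep nu (inv \<rho>) l m *
      (\<Sum>\<sigma>\<in>?S. young_rep nu \<sigma> m k * young_rep mu (inv \<sigma>) j i))"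
      by (simp add: sum_distrib_left sum.swap[of _ "syt nu"] mult_ac)
    finally show "(\<Sum>\<sigma>\<in>?S. complex_of_real (young_rep mu (inv \<sigma>) j i * young_rep nu (inv \<rho> \<circ> \<sigma>) l k)) =
      complex_of_real (\<Sum>m\<in>syt nu. young_rep nu (inv \<rho>) l m *
      (\<Sum>\<sigma>\<in>?S. young_rep nu \<sigma> m k * young_rep mu (inv \<sigma>) j i))"
      by (simp only: of_real_sum[symmetric])
  qed
  also have "\<dots> = ?a * ?b * (\<Sum>\<rho>\<in>?S. complex_of_real (\<Sum>m\<in>syt nu. young_rep nu (inv \<rho>) l m *
      (if nu = mu \<and> k = j \<and> m = i then fact n / real (dim_irrep nu) else 0)) * Vperm \<rho> y x)"
    using young_orthogonality[OF Q P _ k(1) i(2,1)]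
    by (intro arg_cong2[of _ _ _ _ "(*)"] sum.cong refl arg_cong[of _ _ complex_of_real]) auto
  also have "\<dots> = (if mu = nu \<and> j = k then Eunit n mu i l y x else 0)"
  proof (cases "mu = nu \<and> j = k")
    case True
    have "dim_irrep nu \<noteq> 0" using k by (auto simp: dim_irrep_def)
    have "(\<Sum>m\<in>syt nu. young_rep nu (inv \<rho>) l m *
      (if nu = mu \<and> k = j \<and> m = i then fact n / real (dim_irrep nu) else 0)) =
       young_rep nu (inv \<rho>) l i * (fact n / real (dim_irrep nu))" for \<rho>
    proof -
      have "(\<Sum>m\<in>syt nu. young_rep nu (inv \<rho>) l m *
        (if nu = mu \<and> k = j \<and> m = i then fact n / real (dim_irrep nu) else 0)) =
        (\<Sum>m\<in>syt nu. if m = i then young_rep nu (inv \<rho>) l i * (fact n / real (dim_irrep nu)) else 0)"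
        using True by (intro sum.cong) auto
      then show ?thesis using True i by simp
    qed
    then have "?a * ?b * (\<Sum>\<rho>\<in>?S. complex_of_real (\<Sum>m\<in>syt nu. young_rep nu (inv \<rho>) l m *
      (if nu = mu \<and> k = j \<and> m = i then fact n / real (dim_irrep nu) else 0)) * Vperm \<rho> y x) =
      ?a * (?b * complex_of_real (fact n / real (dim_irrep nu))) *
        (\<Sum>\<rho>\<in>?S. complex_of_real (young_rep nu (inv \<rho>) l i) * Vperm \<rho> y x)"
      by (simp add: sum_distrib_left mult_ac)
    also have "?b * complex_of_real (fact n / real (dim_irrep nu)) = 1"
      using \<open>dim_irrep nu \<noteq> 0\<close> by (simp flip: of_real_mult)
    finally show ?thesis using True by (simp add: Eunit_def)
  next
    case False
    then have "\<not> (nu = mu \<and> k = j \<and> m = i)" for m by auto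
    then show ?thesis using False by (simp only: if_False) simp
  qed
  finally show ?thesis .
qed

text \<open>Transposing \<open>Vperm\<close> inverts the permutation, and Young's form is
  orthogonal. This is what carries a matrix unit across the maximally entangled vector.\<close>

lemma Eunit_transpose:
  assumes P: "is_partition d n mu" and i: "i \<in> syt mu" "j \<in> syt mu"
  shows "Eunit n mu i j y x = Eunit n mu j i x y"
proof -
  have "(\<Sum>\<sigma> | \<sigma> permutes {1..n}. complex_of_real (young_rep mu (inv \<sigma>) j i) * Vperm \<sigma> y x) =
    (\<Sum>\<sigma> | \<sigma> permutes {1..n}. complex_of_real (young_rep mu (inv \<sigma>) i j) * Vperm \<sigma> x y)"
  proof (rule sum.reindex_bij_witness[of _ inv inv], goal_cases)
    case (5 \<sigma>)
    then have s: "\<sigma> permutes {1..n}" by simp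
    show ?case using young_rep_inv[OF P s i(2,1)] Vperm_transpose[OF s, of x y]
      by (simp add: permutes_inv_inv[OF s])
  qed (auto simp: permutes_inv permutes_inv_inv)
  then show ?thesis by (simp add: Eunit_def)
qed

section \<open>Restriction to one system fewer and the partial trace over the last system\<close>

context
  fixes d m lam
  assumes P: "is_partition d (Suc m) lam"
begin

lemma ext_tab_upd: "in_shape d alpha lam \<Longrightarrow> ext_tab lam alpha t = t(box lam alpha := Suc m)"
  by (rule ext_tab_eq[OF P]) simp

lemma shape_partition: "in_shape d alpha lam \<Longrightarrow> is_partition d m alpha"
  using in_shape_partition[OF P] by simp

lemma ext_tab_mem: "in_shape d alpha lam \<Longrightarrow> t \<in> syt alpha \<Longrightarrow> ext_tab lam alpha t \<in> syt lam"
  by (rule ext_tab_syt[OF P]) simp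

lemma cells_box_Suc: "in_shape d alpha lam \<Longrightarrow> cells lam = insert (box lam alpha) (cells alpha)"
  "in_shape d alpha lam \<Longrightarrow> box lam alpha \<notin> cells alpha"
  using cells_box[OF P, of alpha] by auto

lemma cell_of_ext_tab:
  assumes a: "in_shape d alpha lam" and t: "t \<in> syt alpha" and l: "1 \<le> l" "l \<le> m"
  shows "cell_of lam (ext_tab lam alpha t) l = cell_of alpha t l"
proof -
  have c: "cell_of alpha t l \<in> cells alpha" "t (cell_of alpha t l) = l"
    using cell_of_props[OF syt_fillings[OF t], of l] is_partition_sum[OF shape_partition[OF a]] l by auto
  then have "ext_tab lam alpha t (cell_of alpha t l) = l" "cell_of alpha t l \<in> cells lam"
    using cells_box_Suc[OF a] by (auto simp: ext_tab_upd[OF a])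
  then show ?thesis using cell_of_eq[OF syt_fillings[OF ext_tab_mem[OF a t]]] by metis
qed

lemma ct_ext_tab_last:
  assumes a: "in_shape d alpha lam" and t: "t \<in> syt alpha"
  shows "ct lam (ext_tab lam alpha t) (Suc m) = of_int (box_content lam alpha)"
proof -
  have "cell_of lam (ext_tab lam alpha t) (ext_tab lam alpha t (box lam alpha)) = box lam alpha"
    using cells_box_Suc[OF a] by (intro cell_of_eq[OF syt_fillings[OF ext_tab_mem[OF a t]]]) auto
  then show ?thesis by (simp add: ext_tab_upd[OF a] ct_def Defs.content_def box_content_def)
qed

lemma swap_ext_tab:
  assumes "in_shape d alpha lam" "Suc k \<le> m"
  shows "swap_entries k (ext_tab lam alpha t) = ext_tab lam alpha (swap_entries k t)"
  using assms(2) by (auto simp: ext_tab_upd[OF assms(1)] swap_entries_def)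

text \<open>A generator with \<open>Suc k \<le> m\<close> does not move the entry
  \<open>Suc m\<close> and sees the same contents as in \<open>alpha\<close>. The restriction is
  therefore block diagonal over the shapes \<open>alpha\<close> in the given basis.\<close>

lemma young_mat_restrict:
  assumes a: "in_shape d alpha lam" "in_shape d beta lam" and s: "s \<in> syt beta"
    and ks: "set ks \<subseteq> {1..<m}" and t: "t \<in> syt alpha"
  shows "young_mat lam ks (ext_tab lam alpha t) (ext_tab lam beta s) =
    (if alpha = beta then young_mat alpha ks t s else 0)"
  using ks t
proof (induction ks arbitrary: t)
  case Nil
  then show ?case
    using ext_tab_inj[OF P _ a Nil(2) s] by (auto simp: young_mat_def delta_def)
next
  case (Cons k ks)
  note t = Cons.prems(2)
  have k: "1 \<le> k" "Suc k \<le> m" using Cons.prems by auto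
  note Pa = shape_partition[OF a(1)]
  have IH: "young_mat lam ks (ext_tab lam alpha u) (ext_tab lam beta s) =
    (if alpha = beta then young_mat alpha ks u s else 0)" if "u \<in> syt alpha" for u
    using Cons.IH Cons.prems that by auto
  have ax: "axial lam k (ext_tab lam alpha t) = axial alpha k t"
    using cell_of_ext_tab[OF a(1) t, of k] cell_of_ext_tab[OF a(1) t, of "Suc k"] k
    by (simp add: axial_def ct_def Defs.content_def)
  have cons: "young_mat la (k # ks) u T = young_op la k (\<lambda>Z. young_mat la ks Z T) u" for la u T
    by (simp add: young_mat_def)
  have "young_mat lam (k # ks) (ext_tab lam alpha t) (ext_tab lam beta s) =
     young_mat lam ks (ext_tab lam alpha t) (ext_tab lam beta s) / axial alpha k t +
     offd (axial alpha k t) * young_mat lam ks (ext_tab lam alpha (swap_entries k t)) (ext_tab lam beta s)"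
    unfolding cons using ext_tab_mem[OF a(1) t] by (simp add: young_op_def ax swap_ext_tab[OF a(1) k(2)])
  also have "\<dots> = (if alpha = beta then young_mat alpha (k # ks) t s else 0)"
    using offd_zero[OF Pa t k] t unfolding IH[OF t] cons
    by (cases "swap_entries k t \<in> syt alpha") (auto simp: IH young_op_def)
  finally show ?case .
qed

lemma young_rep_restrict:
  assumes a: "in_shape d alpha lam" "in_shape d beta lam" and t: "t \<in> syt alpha" and s: "s \<in> syt beta"
    and \<sigma>: "\<sigma> permutes {1..m}"
  shows "young_rep lam \<sigma> (ext_tab lam alpha t) (ext_tab lam beta s) =
    (if alpha = beta then young_rep alpha \<sigma> t s else 0)"
proof -
  obtain ks where ks: "set ks \<subseteq> {1..<m}" "adj_word ks = \<sigma>" using ex_adj_word[OF \<sigma>] by blast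
  have "set ks \<subseteq> {1..<Suc m}" using ks by auto
  then show ?thesis
    using young_rep_word[OF P _ ext_tab_mem[OF a(1) t]] young_rep_word[OF shape_partition[OF a(1)] ks(1) t]
      young_mat_restrict[OF a s ks(1) t] ks(2) by metis
qed

text \<open>Every permutation of \<open>{1..Suc m}\<close> is uniquely
  \<open>transpose (Suc m) b \<circ> q\<close>. For \<open>b = Suc m\<close> the last system is a
  closed loop and contributes \<open>d\<close>; otherwise the traced value is forced to be
  \<open>s b\<close>, which cuts the system out of its cycle and leaves \<open>q\<close>.\<close>

lemma Vperm_partial_trace:
  assumes q: "q permutes {1..m}" and b: "b \<in> {1..Suc m}" and s: "s \<in> basis d m" and t: "t \<in> basis d m"
  shows "(\<Sum>c<d. Vperm (transpose (Suc m) b \<circ> q) (s(Suc m := c)) (t(Suc m := c))) =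
    (if b = Suc m then of_nat d else 1) * Vperm q s t"
proof -
  have qn: "q (Suc m) = Suc m" "q x \<noteq> Suc m \<longleftrightarrow> x \<noteq> Suc m" for x
    using q by (auto simp: permutes_not_in) (metis atLeastAtMost_iff lessI not_less permutes_not_in permutes_in_image)
  have perm: "transpose (Suc m) b \<circ> q permutes {1..Suc m}"
    using b by (intro permutes_compose permutes_swap_id permutes_subset[OF q]) auto
  note V = Vperm_comp_iff[OF perm] Vperm_comp_iff[OF q]
  have out: "s (Suc m) = undefined" "t (Suc m) = undefined"
    using s t by (auto simp: basis_def PiE_iff extensional_def)
  have sb: "s b < d" if "b \<noteq> Suc m" using s b that by (auto simp: basis_def PiE_iff)
  show ?thesis
  proof (cases "b = Suc m")
    case True
    have "s(Suc m := c) \<circ> q = t(Suc m := c) \<longleftrightarrow> s \<circ> q = t" for c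
    proof -
      have "s(Suc m := c) \<circ> q = (s \<circ> q)(Suc m := c)" using qn by (auto simp: fun_eq_iff)
      moreover have "(s \<circ> q) (Suc m) = t (Suc m)" using qn(1) out by simp
      ultimately show ?thesis by (metis fun_upd_triv fun_upd_upd)
    qed
    then show ?thesis using True by (simp add: V)
  next
    case False
    have "s(Suc m := c) \<circ> (transpose (Suc m) b \<circ> q) = t(Suc m := c) \<longleftrightarrow> c = s b \<and> s \<circ> q = t" for c
    proof
      assume eq: "s(Suc m := c) \<circ> (transpose (Suc m) b \<circ> q) = t(Suc m := c)"
      have c: "c = s b" using fun_cong[OF eq, of "Suc m"] qn False by simp
      have "(s \<circ> q) x = t x" for x
      proof (cases "x = Suc m")
        case True then show ?thesis using qn(1) out by simp
      next
        case x: False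
        then have "q x \<noteq> Suc m" using qn by simp
        then show ?thesis using fun_cong[OF eq, of x] c x by (cases "q x = b") auto
      qed
      then show "c = s b \<and> s \<circ> q = t" using c by auto
    next
      assume *: "c = s b \<and> s \<circ> q = t"
      show "s(Suc m := c) \<circ> (transpose (Suc m) b \<circ> q) = t(Suc m := c)"
      proof
        fix x
        show "(s(Suc m := c) \<circ> (transpose (Suc m) b \<circ> q)) x = (t(Suc m := c)) x"
        proof (cases "x = Suc m")
          case True then show ?thesis using qn(1) False * by simp
        next
          case x: False
          then have "q x \<noteq> Suc m" using qn by simp
          then show ?thesis using * x by (cases "q x = b") auto
        qed
      qed
    qed
    then have "(\<Sum>c<d. Vperm (transpose (Suc m) b \<circ> q) (s(Suc m := c)) (t(Suc m := c))) =
       (\<Sum>c<d. if c = s b then (if s \<circ> q = t then 1 else 0) else 0)"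
      by (intro sum.cong) (auto simp: V)
    then show ?thesis using False sb by (simp add: V)
  qed
qed

lemma frac_eq_aux:
  fixes n M D A B N F :: real
  assumes "n * M * D = A * B * N" "n \<noteq> 0" "N \<noteq> 0" "F \<noteq> 0"
  shows "A / (n * F) * B = M / N * (D / F)"
  using assms by (simp add: field_simps)

theorem Eunit_partial_trace:
  assumes a: "in_shape d alpha lam" "in_shape d beta lam" and t: "u \<in> syt alpha" "v \<in> syt beta"
    and s: "s \<in> basis d m" "t \<in> basis d m"
  shows "(\<Sum>c<d. Eunit (Suc m) lam (ext_tab lam alpha u) (ext_tab lam beta v) (s(Suc m := c)) (t(Suc m := c))) =
    (if alpha = beta then of_nat (Defs.mult d lam) / of_nat (Defs.mult d alpha) * Eunit m alpha u v s t else 0)"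
proof -
  let ?n = "Suc m"
  let ?i = "ext_tab lam alpha u" and ?j = "ext_tab lam beta v"
  have i: "?i \<in> syt lam" "?j \<in> syt lam" using ext_tab_mem a t by auto
  let ?S = "{q. q permutes {1..m}}"
  let ?w = "\<lambda>b. if b = ?n then real d else 1"
  have ins: "{1..?n} = insert ?n {1..m}" by auto
  \<comment> \<open>With weight \<open>d\<close> at \<open>b = ?n\<close> and 1 elsewhere, the
    transpositions add up to \<open>d\<close> plus the last Jucys-Murphy element, which acts on
    \<open>?i\<close> by the content of the added box.\<close>
  have dec: "(\<Sum>b\<in>{1..?n}. ?w b * young_rep lam (inv (transpose ?n b \<circ> q)) ?j ?i) =
     (real d + of_int (box_content lam alpha)) * young_rep lam (inv q) ?j ?i" if q: "q permutes {1..m}" for q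
  proof -
    have q': "inv q permutes {1..?n}" by (rule permutes_subset[OF permutes_inv[OF q]]) auto
    have "(\<Sum>b\<in>{1..?n}. ?w b * young_rep lam (inv (transpose ?n b \<circ> q)) ?j ?i) =
      (\<Sum>b\<in>{1..?n}. ?w b * (\<Sum>Z\<in>syt lam. young_rep lam (inv q) ?j Z * young_rep lam (transpose ?n b) Z ?i))"
    proof (intro sum.cong refl arg_cong2[of _ _ _ _ "(*)"])
      fix b assume b: "b \<in> {1..?n}"
      then have p: "transpose ?n b permutes {1..?n}" by (intro permutes_swap_id) auto
      have "inv (transpose ?n b \<circ> q) = inv q \<circ> transpose ?n b"
        using permutes_bij[OF p] permutes_bij[OF q] by (simp add: o_inv_distrib)
      then show "young_rep lam (inv (transpose ?n b \<circ> q)) ?j ?i =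
         (\<Sum>Z\<in>syt lam. young_rep lam (inv q) ?j Z * young_rep lam (transpose ?n b) Z ?i)"
        using young_rep_comp[OF P q' p i(2)] by simp
    qed
    also have "\<dots> = (\<Sum>Z\<in>syt lam. young_rep lam (inv q) ?j Z *
        (\<Sum>b\<in>{1..?n}. ?w b * young_rep lam (transpose ?n b) Z ?i))"
      by (simp only: sum_distrib_left) (subst sum.swap, intro sum.cong refl, simp only: mult.left_commute)
    also have "\<dots> = (\<Sum>Z\<in>syt lam. young_rep lam (inv q) ?j Z *
        ((real d + ct lam Z ?n) * delta ?i Z))"
    proof (intro sum.cong refl arg_cong2[of _ _ _ _ "(*)"])
      fix Z assume Z: "Z \<in> syt lam"
      have "(\<Sum>b\<in>{1..?n}. ?w b * young_rep lam (transpose ?n b) Z ?i) =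
         real d * young_rep lam id Z ?i + (\<Sum>b\<in>{1..<?n}. young_rep lam (transpose b ?n) Z ?i)"
        unfolding ins atLeastLessThanSuc_atLeastAtMost
        by (subst sum.insert) (auto simp: transpose_commute[of ?n] intro!: sum.cong)
      also have "\<dots> = (real d + ct lam Z ?n) * delta ?i Z"
        using jucys_murphy_diag[OF P Z, of ?n ?i] young_rep_id[OF P Z, of ?i]
        by (simp add: delta_def algebra_simps)
      finally show "(\<Sum>b\<in>{1..?n}. ?w b * young_rep lam (transpose ?n b) Z ?i) =
        (real d + ct lam Z ?n) * delta ?i Z" .
    qed
    also have "\<dots> = (\<Sum>Z\<in>syt lam. if Z = ?i then young_rep lam (inv q) ?j ?i * (real d + ct lam ?i ?n) else 0)"
      by (intro sum.cong) (auto simp: delta_def)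
    also have "\<dots> = (real d + of_int (box_content lam alpha)) * young_rep lam (inv q) ?j ?i"
      using i by (simp add: ct_ext_tab_last[OF a(1) t(1)])
    finally show ?thesis .
  qed
  let ?A = "complex_of_real (real (dim_irrep lam) / fact ?n)"
  have "(\<Sum>c<d. Eunit ?n lam ?i ?j (s(?n := c)) (t(?n := c))) =
    ?A * (\<Sum>\<sigma> | \<sigma> permutes {1..?n}. complex_of_real (young_rep lam (inv \<sigma>) ?j ?i) *
        (\<Sum>c<d. Vperm \<sigma> (s(?n := c)) (t(?n := c))))"
    unfolding Eunit_def by (simp add: sum_distrib_left sum.swap[of _ "{..<d}"])
  also have "\<dots> = ?A * (\<Sum>b\<in>{1..?n}. \<Sum>q\<in>?S. complex_of_real (young_rep lam (inv (transpose ?n b \<circ> q)) ?j ?i) *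
        (\<Sum>c<d. Vperm (transpose ?n b \<circ> q) (s(?n := c)) (t(?n := c))))"
    unfolding ins by (subst sum_over_permutations_insert) auto
  also have "\<dots> = ?A * (\<Sum>b\<in>{1..?n}. \<Sum>q\<in>?S. complex_of_real (young_rep lam (inv (transpose ?n b \<circ> q)) ?j ?i) *
        (complex_of_real (?w b) * Vperm q s t))"
  proof (intro arg_cong2[of _ _ _ _ "(*)"] sum.cong refl)
    fix b q assume "b \<in> {1..?n}" "q \<in> ?S"
    then show "(\<Sum>c<d. Vperm (transpose ?n b \<circ> q) (s(?n := c)) (t(?n := c))) = complex_of_real (?w b) * Vperm q s t"
      using Vperm_partial_trace[of q b s t] s by auto
  qed
  also have "\<dots> = ?A * (\<Sum>q\<in>?S. complex_of_real
      (\<Sum>b\<in>{1..?n}. ?w b * young_rep lam (inv (transpose ?n b \<circ> q)) ?j ?i) * Vperm q s t)"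
    by (subst sum.swap) (simp only: of_real_sum of_real_mult sum_distrib_left sum_distrib_right mult_ac)
  also have "\<dots> = ?A * (\<Sum>q\<in>?S. complex_of_real
      ((real d + of_int (box_content lam alpha)) * (if beta = alpha then young_rep alpha (inv q) v u else 0)) * Vperm q s t)"
    using dec young_rep_restrict[OF a(2,1) t(2,1) permutes_inv]
    by (intro arg_cong2[of _ _ _ _ "(*)"] sum.cong refl arg_cong[of _ _ complex_of_real]) auto
  also have "\<dots> = (if alpha = beta then of_nat (Defs.mult d lam) / of_nat (Defs.mult d alpha) * Eunit m alpha u v s t else 0)"
  proof (cases "alpha = beta")
    case False then show ?thesis by simp
  next
    case True
    have "0 < Defs.mult d alpha" using mult_pos[OF shape_partition[OF a(1)]] t by auto
    \<comment> \<open>\<open>mult_ratio\<close> turns this eigenvalue, together with the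
      normalisations \<open>dim_irrep lam / fact ?n\<close> and
      \<open>dim_irrep alpha / fact m\<close>, into the ratio of multiplicities.\<close>
    moreover have "real_of_int (int ?n * int (Defs.mult d lam) * int (dim_irrep alpha)) =
      real_of_int (int (dim_irrep lam) * (int d + box_content lam alpha) * int (Defs.mult d alpha))"
      using mult_ratio[OF P _ a(1)] by simp
    then have "real ?n * real (Defs.mult d lam) * real (dim_irrep alpha) =
      real (dim_irrep lam) * (real d + of_int (box_content lam alpha)) * real (Defs.mult d alpha)"
      by simp
    ultimately have "real (dim_irrep lam) / fact ?n * (real d + of_int (box_content lam alpha)) =
      real (Defs.mult d lam) / real (Defs.mult d alpha) * (real (dim_irrep alpha) / fact m)"
      unfolding fact_Suc by (intro frac_eq_aux) auto
    then have r: "?A * complex_of_real (real d + of_int (box_content lam alpha)) =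
      of_nat (Defs.mult d lam) / of_nat (Defs.mult d alpha) * complex_of_real (real (dim_irrep alpha) / fact m)"
      by (metis of_real_mult of_real_divide of_real_of_nat_eq)
    have ba: "beta = alpha" using True by simp
    have "?A * (\<Sum>q\<in>?S. complex_of_real
      ((real d + of_int (box_content lam alpha)) * young_rep alpha (inv q) v u) * Vperm q s t) =
      (?A * complex_of_real (real d + of_int (box_content lam alpha))) *
      (\<Sum>q\<in>?S. complex_of_real (young_rep alpha (inv q) v u) * Vperm q s t)"
      by (simp only: of_real_mult sum_distrib_left mult.assoc)
    also have "\<dots> = of_nat (Defs.mult d lam) / of_nat (Defs.mult d alpha) * Eunit m alpha u v s t"
      unfolding r by (simp only: Eunit_def mult.assoc)
    finally show ?thesis unfolding if_P[OF True] if_P[OF ba] .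
  qed
  finally show ?thesis .
qed

end

text \<open>Tracing out one system at a time multiplies ratios of multiplicities, which
  telescope.\<close>

theorem Eunit_trace:
  assumes "is_partition d n lam" "i \<in> syt lam" "j \<in> syt lam"
  shows "(\<Sum>y\<in>basis d n. Eunit n lam i j y y) = (if i = j then of_nat (Defs.mult d lam) else 0)"
  using assms
proof (induction n arbitrary: lam i j)
  case 0
  then have lam: "lam = []" by (simp add: is_partition_0)
  have "syt [] = {\<lambda>_. 0}" "ssyt d [] = {\<lambda>_. 0}"
    by (auto simp: ssyt_def syt_def cells_def bij_betw_def)
  moreover have "basis d 0 = {\<lambda>_. undefined}" by (auto simp: basis_def)
  moreover have "{\<sigma>. \<sigma> permutes {1..0::nat}} = {id}" by auto
  ultimately show ?case
    using 0 young_rep_id[OF 0(1,2), of j]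
    by (simp add: lam Eunit_def Defs.mult_def dim_irrep_def Vperm_def)
next
  case (Suc m)
  note P = Suc.prems(1)
  obtain alpha u where a: "in_shape d alpha lam" "u \<in> syt alpha" "i = ext_tab lam alpha u"
    using syt_ext_tabE[OF P _ Suc.prems(2)] by auto
  obtain beta v where b: "in_shape d beta lam" "v \<in> syt beta" "j = ext_tab lam beta v"
    using syt_ext_tabE[OF P _ Suc.prems(3)] by auto
  have "(\<Sum>y\<in>basis d (Suc m). Eunit (Suc m) lam i j y y) =
    (\<Sum>s\<in>basis d m. if alpha = beta then of_nat (Defs.mult d lam) / of_nat (Defs.mult d alpha) * Eunit m alpha u v s s else 0)"
    unfolding sum_basis_Suc a(3) b(3)
    by (intro sum.cong refl Eunit_partial_trace[OF P a(1) b(1) a(2) b(2)])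
  also have "\<dots> = (if i = j then of_nat (Defs.mult d lam) else 0)"
  proof (cases "alpha = beta")
    case False
    then have "i \<noteq> j" using ext_tab_inj[OF P _ a(1) b(1) a(2) b(2)] a(3) b(3) by auto
    then show ?thesis using False by simp
  next
    case True
    note Pa = shape_partition[OF P a(1)]
    have pos: "0 < Defs.mult d alpha" using mult_pos[OF Pa] a by auto
    have iff: "i = j \<longleftrightarrow> u = v"
      using ext_tab_inj[OF P _ a(1) b(1) a(2) b(2)] a(3) b(3) True by auto
    have tr: "(\<Sum>s\<in>basis d m. Eunit m alpha u v s s) = (if u = v then of_nat (Defs.mult d alpha) else 0)"
      using Suc.IH[OF Pa] a b True by simp
    show ?thesis
      unfolding if_P[OF True] sum_distrib_left[symmetric] tr using iff pos by simp
  qed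
  finally show ?case .
qed

section \<open>Compression to one pair of systems\<close>

definition tpow :: "nat \<Rightarrow> (nat \<Rightarrow> nat \<Rightarrow> complex) \<Rightarrow> (nat \<Rightarrow> nat) \<Rightarrow> (nat \<Rightarrow> nat) \<Rightarrow> complex" where
  "tpow n g u w = (\<Prod>k\<in>{1..n}. g (u k) (w k))"

lemma tpow_Suc: "tpow (Suc n) g (s(Suc n := a)) (t(Suc n := b)) = tpow n g s t * g a b"
proof -
  have "{1..Suc n} = insert (Suc n) {1..n}" by auto
  moreover have "(\<Prod>k\<in>{1..n}. g ((s(Suc n := a)) k) ((t(Suc n := b)) k)) = (\<Prod>k\<in>{1..n}. g (s k) (t k))"
    by (intro prod.cong) auto
  ultimately show ?thesis by (simp add: tpow_def mult.commute)
qed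

text \<open>Both g h^T and g^T h are the identity: \<open>h\<close> is the contragredient of
  \<open>g\<close>, so g \<otimes> h and its transpose fix the maximally entangled vector. Carrying
  the pair spares inverting a matrix.\<close>

definition dual_pair :: "nat \<Rightarrow> (nat \<Rightarrow> nat \<Rightarrow> complex) \<Rightarrow> (nat \<Rightarrow> nat \<Rightarrow> complex) \<Rightarrow> bool" where
  "dual_pair d g h \<longleftrightarrow> (\<forall>a<d. \<forall>b<d. (\<Sum>c<d. g a c * h b c) = (if a = b then 1 else 0)
     \<and> (\<Sum>c<d. g c a * h c b) = (if a = b then 1 else 0))"

lemma basis_eq_iff: "s \<in> basis d n \<Longrightarrow> t \<in> basis d n \<Longrightarrow> (\<forall>k\<in>{1..n}. s k = t k) \<longleftrightarrow> s = t"
  unfolding basis_def by (auto intro: PiE_ext)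

lemma tpow_dual:
  assumes gh: "\<And>a b. a < d \<Longrightarrow> b < d \<Longrightarrow> (\<Sum>c<d. g a c * h b c) = (if a = b then 1 else 0)"
    and s: "s \<in> basis d n" and t: "t \<in> basis d n"
  shows "(\<Sum>w\<in>basis d n. tpow n g s w * tpow n h t w) = (if s = t then 1 else 0)"
proof -
  have "(\<Sum>w\<in>basis d n. tpow n g s w * tpow n h t w) =
     (\<Sum>w\<in>{1..n} \<rightarrow>\<^sub>E {0..<d}. \<Prod>k\<in>{1..n}. g (s k) (w k) * h (t k) (w k))"
    by (simp add: tpow_def basis_def prod.distrib)
  also have "\<dots> = (\<Prod>k\<in>{1..n}. \<Sum>c\<in>{0..<d}. g (s k) c * h (t k) c)"
    by (subst prod_sum_PiE) auto
  also have "\<dots> = (\<Prod>k\<in>{1..n}. if s k = t k then 1 else 0)"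
  proof (intro prod.cong refl)
    fix k assume "k \<in> {1..n}"
    then have "s k < d" "t k < d" using s t by (auto simp: basis_def PiE_iff)
    then show "(\<Sum>c\<in>{0..<d}. g (s k) c * h (t k) c) = (if s k = t k then 1 else 0)"
      using gh by (simp add: atLeast0LessThan)
  qed
  also have "\<dots> = (if \<forall>k\<in>{1..n}. s k = t k then 1 else 0)" by (auto intro: prod.neutral)
  finally show ?thesis using basis_eq_iff[OF s t] by simp
qed

text \<open>Of Schur--Weyl duality only the easy half is needed: permutation operators commute with
  \<open>g \<otimes> \<dots> \<otimes> g\<close>.\<close>

definition commutes_tpow :: "nat \<Rightarrow> nat \<Rightarrow> op \<Rightarrow> bool" where
  "commutes_tpow d n A \<longleftrightarrow> (\<forall>g. \<forall>u\<in>basis d n. \<forall>v\<in>basis d n.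
     (\<Sum>w\<in>basis d n. A u w * tpow n g w v) = (\<Sum>w\<in>basis d n. tpow n g u w * A w v))"

lemma commutes_tpow_Eunit: "commutes_tpow d n (Eunit n mu i j)"
  unfolding commutes_tpow_def
proof (intro allI ballI)
  fix g u v assume u: "u \<in> basis d n" and v: "v \<in> basis d n"
  have V: "(\<Sum>w\<in>basis d n. Vperm \<sigma> u w * tpow n g w v) = (\<Sum>w\<in>basis d n. tpow n g u w * Vperm \<sigma> w v)"
    if s: "\<sigma> permutes {1..n}" for \<sigma>
  proof -
    have "(\<Sum>w\<in>basis d n. Vperm \<sigma> u w * tpow n g w v) =
        (\<Sum>w\<in>basis d n. if w = u \<circ> \<sigma> then tpow n g (u \<circ> \<sigma>) v else 0)"
      by (intro sum.cong) (auto simp: Vperm_comp_iff[OF s])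
    also have "\<dots> = tpow n g (u \<circ> \<sigma>) v" using basis_comp_perm[OF u s] by simp
    also have "\<dots> = (\<Prod>k\<in>{1..n}. g (u (\<sigma> k)) ((v \<circ> inv \<sigma>) (\<sigma> k)))"
      using permutes_inverses(2)[OF s] by (simp add: tpow_def)
    also have "\<dots> = (\<Prod>k\<in>{1..n}. g (u k) ((v \<circ> inv \<sigma>) k))"
      using prod.permute[OF s, of "\<lambda>k. g (u k) ((v \<circ> inv \<sigma>) k)"] by (simp add: o_def)
    also have "\<dots> = tpow n g u (v \<circ> inv \<sigma>)" by (simp add: tpow_def)
    also have "\<dots> = (\<Sum>w\<in>basis d n. if w = v \<circ> inv \<sigma> then tpow n g u (v \<circ> inv \<sigma>) else 0)"
      using basis_comp_perm[OF v permutes_inv[OF s]] by simp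
    also have "\<dots> = (\<Sum>w\<in>basis d n. tpow n g u w * Vperm \<sigma> w v)"
      by (intro sum.cong) (auto simp: Vperm_def)
    finally show ?thesis .
  qed
  let ?a = "complex_of_real (real (dim_irrep mu) / fact n)"
  let ?f = "\<lambda>\<sigma>. complex_of_real (young_rep mu (inv \<sigma>) j i)"
  have "(\<Sum>w\<in>basis d n. Eunit n mu i j u w * tpow n g w v) =
     ?a * (\<Sum>\<sigma> | \<sigma> permutes {1..n}. ?f \<sigma> * (\<Sum>w\<in>basis d n. Vperm \<sigma> u w * tpow n g w v))"
    unfolding Eunit_def sum_distrib_left sum_distrib_right
    by (subst sum.swap) (simp only: mult_ac)
  also have "\<dots> = ?a * (\<Sum>\<sigma> | \<sigma> permutes {1..n}. ?f \<sigma> * (\<Sum>w\<in>basis d n. tpow n g u w * Vperm \<sigma> w v))"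
    using V by simp
  also have "\<dots> = (\<Sum>w\<in>basis d n. tpow n g u w * Eunit n mu i j w v)"
    unfolding Eunit_def sum_distrib_left sum_distrib_right
    by (subst sum.swap) (simp only: mult_ac)
  finally show "(\<Sum>w\<in>basis d n. Eunit n mu i j u w * tpow n g w v) =
    (\<Sum>w\<in>basis d n. tpow n g u w * Eunit n mu i j w v)" .
qed

text \<open>The compression \<open>\<langle>\<Phi>| A \<otimes> B |\<Phi>\<rangle>\<close>, where \<open>\<Phi>\<close> is the unnormalised maximally entangled vector
  between the first \<open>m\<close> slots of the two tensor factors.\<close>

definition compr :: "nat \<Rightarrow> nat \<Rightarrow> op \<Rightarrow> op \<Rightarrow> nat \<times> nat \<Rightarrow> nat \<times> nat \<Rightarrow> complex" where
  "compr d m A B c c' = (\<Sum>s\<in>basis d m. \<Sum>t\<in>basis d m.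
     A (s(Suc m := fst c)) (t(Suc m := fst c')) * B (s(Suc m := snd c)) (t(Suc m := snd c')))"

text \<open>Abstract form of that invariance: dual kernels inserted into the two sides of a
  contraction cancel.\<close>

lemma sum_dual_kernel:
  fixes G H :: "'a \<Rightarrow> 'a \<Rightarrow> complex"
  assumes "finite X" and "\<And>x y. x \<in> X \<Longrightarrow> y \<in> X \<Longrightarrow> (\<Sum>t\<in>X. G x t * H y t) = (if x = y then 1 else 0)"
  shows "(\<Sum>t\<in>X. (\<Sum>x\<in>X. f x * G x t) * (\<Sum>y\<in>X. g y * H y t)) = (\<Sum>x\<in>X. f x * g x)"
proof -
  have "(\<Sum>t\<in>X. (\<Sum>x\<in>X. f x * G x t) * (\<Sum>y\<in>X. g y * H y t)) =
      (\<Sum>t\<in>X. \<Sum>x\<in>X. \<Sum>y\<in>X. f x * g y * (G x t * H y t))"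
    by (simp only: sum_product mult_ac)
  also have "\<dots> = (\<Sum>x\<in>X. \<Sum>y\<in>X. \<Sum>t\<in>X. f x * g y * (G x t * H y t))"
    by (rule sum_rotate3)
  also have "\<dots> = (\<Sum>x\<in>X. \<Sum>y\<in>X. f x * g y * (if x = y then 1 else 0))"
    using assms(2) by (simp only: sum_distrib_left[symmetric] cong: sum.cong)
  also have "\<dots> = (\<Sum>x\<in>X. f x * g x)"
    using assms(1) by (simp add: if_distrib[of "\<lambda>z. _ * z"] cong: if_cong)
  finally show ?thesis .
qed

text \<open>On the first \<open>m\<close> slots the tensor powers of \<open>g\<close> and
  \<open>h\<close> cancel against the maximally entangled vector, on either side. Of the commutation
  with the full tensor powers there remains an intertwining relation on the last pair of
  systems.\<close>

lemma compr_intertwines: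
  assumes A: "commutes_tpow d (Suc m) A" and B: "commutes_tpow d (Suc m) B"
    and gh: "dual_pair d g h" and lt: "a < d" "b < d" "a' < d" "b' < d"
  shows "(\<Sum>c<d. \<Sum>c'<d. compr d m A B (a, b) (c, c') * (g c a' * h c' b')) =
    (\<Sum>c<d. \<Sum>c'<d. (g a c * h b c') * compr d m A B (c, c') (a', b'))"
proof -
  let ?n = "Suc m" and ?X = "basis d m"
  \<comment> \<open>\<open>PA\<close> is the product of \<open>A\<close> with the tensor power of
    \<open>g\<close>, expanded below once with the power on the right and once, by commutation, on
    the left; likewise \<open>PB\<close> with \<open>h\<close>.\<close>
  define PA where "PA u v = (\<Sum>w\<in>basis d ?n. A u w * tpow ?n g w v)" for u v
  define PB where "PB u v = (\<Sum>w\<in>basis d ?n. B u w * tpow ?n h w v)" for u v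
  have PA2: "PA u v = (\<Sum>w\<in>basis d ?n. tpow ?n g u w * A w v)" if "u \<in> basis d ?n" "v \<in> basis d ?n" for u v
    using A that by (simp add: PA_def commutes_tpow_def)
  have PB2: "PB u v = (\<Sum>w\<in>basis d ?n. tpow ?n h u w * B w v)" if "u \<in> basis d ?n" "v \<in> basis d ?n" for u v
    using B that by (simp add: PB_def commutes_tpow_def)
  have orth1: "(\<Sum>t\<in>?X. tpow m g x t * tpow m h y t) = (if x = y then 1 else 0)" if "x \<in> ?X" "y \<in> ?X" for x y
    using gh that by (intro tpow_dual) (auto simp: dual_pair_def)
  have orth2: "(\<Sum>t\<in>?X. tpow m g t x * tpow m h t y) = (if x = y then 1 else 0)" if "x \<in> ?X" "y \<in> ?X" for x y
  proof -
    have fl: "tpow m g t x = tpow m (\<lambda>a b. g b a) x t" for g t x by (simp add: tpow_def)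
    show ?thesis unfolding fl[of g] fl[of h]
      using gh that by (intro tpow_dual) (auto simp: dual_pair_def)
  qed
  have L: "(\<Sum>t\<in>?X. PA (s(?n := a)) (t(?n := a')) * PB (s(?n := b)) (t(?n := b'))) =
     (\<Sum>t\<in>?X. (\<Sum>c<d. A (s(?n := a)) (t(?n := c)) * g c a') * (\<Sum>c<d. B (s(?n := b)) (t(?n := c)) * h c b'))" for s
  proof -
    have 1: "PA u (t(?n := a')) = (\<Sum>x\<in>?X. (\<Sum>c<d. A u (x(?n := c)) * g c a') * tpow m g x t)" for u t
      by (simp add: PA_def sum_basis_Suc tpow_Suc sum_distrib_left sum_distrib_right mult_ac)
    have 2: "PB u (t(?n := b')) = (\<Sum>x\<in>?X. (\<Sum>c<d. B u (x(?n := c)) * h c b') * tpow m h x t)" for u t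
      by (simp add: PB_def sum_basis_Suc tpow_Suc sum_distrib_left sum_distrib_right mult_ac)
    show ?thesis unfolding 1 2 by (rule sum_dual_kernel[OF finite_basis orth1])
  qed
  have R: "(\<Sum>s\<in>?X. PA (s(?n := a)) (t(?n := a')) * PB (s(?n := b)) (t(?n := b'))) =
     (\<Sum>s\<in>?X. (\<Sum>c<d. g a c * A (s(?n := c)) (t(?n := a'))) * (\<Sum>c<d. h b c * B (s(?n := c)) (t(?n := b'))))"
    if t: "t \<in> ?X" for t
  proof -
    have 1: "PA (s(?n := a)) (t(?n := a')) = (\<Sum>x\<in>?X. (\<Sum>c<d. g a c * A (x(?n := c)) (t(?n := a'))) * tpow m g s x)"
      if "s \<in> ?X" for s
      using basis_upd_Suc[OF that lt(1)] basis_upd_Suc[OF t lt(3)]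
      by (simp add: PA2 sum_basis_Suc tpow_Suc sum_distrib_left sum_distrib_right mult_ac)
    have 2: "PB (s(?n := b)) (t(?n := b')) = (\<Sum>x\<in>?X. (\<Sum>c<d. h b c * B (x(?n := c)) (t(?n := b'))) * tpow m h s x)"
      if "s \<in> ?X" for s
      using basis_upd_Suc[OF that lt(2)] basis_upd_Suc[OF t lt(4)]
      by (simp add: PB2 sum_basis_Suc tpow_Suc sum_distrib_left sum_distrib_right mult_ac)
    have "(\<Sum>s\<in>?X. PA (s(?n := a)) (t(?n := a')) * PB (s(?n := b)) (t(?n := b'))) =
      (\<Sum>s\<in>?X. (\<Sum>x\<in>?X. (\<Sum>c<d. g a c * A (x(?n := c)) (t(?n := a'))) * tpow m g s x) *
        (\<Sum>x\<in>?X. (\<Sum>c<d. h b c * B (x(?n := c)) (t(?n := b'))) * tpow m h s x))"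
      by (intro sum.cong refl) (simp only: 1 2)
    also have "\<dots> = (\<Sum>s\<in>?X. (\<Sum>c<d. g a c * A (s(?n := c)) (t(?n := a'))) * (\<Sum>c<d. h b c * B (s(?n := c)) (t(?n := b'))))"
      by (rule sum_dual_kernel[OF finite_basis orth2])
    finally show ?thesis .
  qed
  note swap4 = sum_swap_pairs[where A = ?X and B = ?X and C = "{..<d}" and D = "{..<d}"]
  have "(\<Sum>c<d. \<Sum>c'<d. compr d m A B (a, b) (c, c') * (g c a' * h c' b')) =
     (\<Sum>s\<in>?X. \<Sum>t\<in>?X. \<Sum>c<d. \<Sum>c'<d. (A (s(?n := a)) (t(?n := c)) * g c a') * (B (s(?n := b)) (t(?n := c')) * h c' b'))"
    unfolding swap4 compr_def sum_distrib_right fst_conv snd_conv by (simp only: mult_ac)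
  also have "\<dots> = (\<Sum>s\<in>?X. \<Sum>t\<in>?X. PA (s(?n := a)) (t(?n := a')) * PB (s(?n := b)) (t(?n := b')))"
    unfolding L by (simp only: sum_product)
  also have "\<dots> = (\<Sum>t\<in>?X. \<Sum>s\<in>?X. PA (s(?n := a)) (t(?n := a')) * PB (s(?n := b)) (t(?n := b')))"
    by (rule sum.swap)
  also have "\<dots> = (\<Sum>t\<in>?X. \<Sum>s\<in>?X. (\<Sum>c<d. g a c * A (s(?n := c)) (t(?n := a'))) * (\<Sum>c<d. h b c * B (s(?n := c)) (t(?n := b'))))"
    by (rule sum.cong[OF refl], rule R)
  also have "\<dots> = (\<Sum>s\<in>?X. \<Sum>t\<in>?X. (\<Sum>c<d. g a c * A (s(?n := c)) (t(?n := a'))) * (\<Sum>c<d. h b c * B (s(?n := c)) (t(?n := b'))))"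
    by (rule sum.swap)
  also have "\<dots> = (\<Sum>c<d. \<Sum>c'<d. (g a c * h b c') * compr d m A B (c, c') (a', b'))"
    unfolding sum_product swap4
    by (intro sum.cong refl) (simp only: compr_def fst_conv snd_conv sum_distrib_left mult_ac)
  finally show ?thesis .
qed

lemma sum_sum_delta2:
  fixes F :: "nat \<Rightarrow> nat \<Rightarrow> complex"
  assumes "a < d" "b < d"
  shows "(\<Sum>c<d. \<Sum>c'<d. if c = a \<and> c' = b then F c c' else 0) = F a b"
proof -
  have "(\<Sum>c<d. \<Sum>c'<d. if c = a \<and> c' = b then F c c' else 0) =
      (\<Sum>c<d. if c = a then (\<Sum>c'<d. if c' = b then F a c' else 0) else 0)"
    by (intro sum.cong refl) auto
  then show ?thesis using assms by simp
qed

text \<open>Invariance under the torus kills all but two kinds of entries, invariance under the symmetric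
  group makes them constant, and invariance under unipotents relates the remaining constants.\<close>

lemma compr_structure:
  assumes A: "commutes_tpow d (Suc m) A" and B: "commutes_tpow d (Suc m) B" and d: "2 \<le> d"
  obtains u v where "\<And>a b a' b'. a < d \<Longrightarrow> b < d \<Longrightarrow> a' < d \<Longrightarrow> b' < d \<Longrightarrow>
    compr d m A B (a, b) (a', b') = u * (if a = a' \<and> b = b' then 1 else 0) + v * (if a = b \<and> a' = b' then 1 else 0)"
proof -
  define X where "X a b a' b' = compr d m A B (a, b) (a', b')" for a b a' b'
  note inter = compr_intertwines[OF A B, folded X_def]
  have torus: "X a b a' b' * (t a' / t b') = (t a / t b) * X a b a' b'"
    if t: "\<And>x. t x \<noteq> 0" and lt: "a < d" "b < d" "a' < d" "b' < d" for t a b a' b'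
  proof -
    let ?g = "\<lambda>x y. if x = y then t x else 0" and ?h = "\<lambda>x y. if x = y then inverse (t x) else 0"
    have dual: "dual_pair d ?g ?h"
      unfolding dual_pair_def
    proof (intro allI impI conjI)
      fix x y assume xy: "x < d" "y < d"
      have "(\<Sum>c<d. ?g x c * ?h y c) = (\<Sum>c<d. if c = x then ?g x x * ?h y x else 0)"
        by (intro sum.cong) auto
      then show "(\<Sum>c<d. ?g x c * ?h y c) = (if x = y then 1 else 0)" using xy t by simp
      have "(\<Sum>c<d. ?g c x * ?h c y) = (\<Sum>c<d. if c = x then ?g x x * ?h x y else 0)"
        by (intro sum.cong) auto
      then show "(\<Sum>c<d. ?g c x * ?h c y) = (if x = y then 1 else 0)" using xy t by simp
    qed
    have "(\<Sum>c<d. \<Sum>c'<d. X a b c c' * (?g c a' * ?h c' b')) =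
        (\<Sum>c<d. \<Sum>c'<d. if c = a' \<and> c' = b' then X a b c c' * (t a' / t b') else 0)"
      by (intro sum.cong refl) (auto simp: divide_inverse)
    moreover have "(\<Sum>c<d. \<Sum>c'<d. (?g a c * ?h b c') * X c c' a' b') =
        (\<Sum>c<d. \<Sum>c'<d. if c = a \<and> c' = b then (t a / t b) * X c c' a' b' else 0)"
      by (intro sum.cong refl) (auto simp: divide_inverse)
    ultimately show ?thesis using inter[OF dual lt] lt by (simp add: sum_sum_delta2)
  qed
  have zero: "X a b a' b' = 0"
    if lt: "a < d" "b < d" "a' < d" "b' < d" and ne: "\<not> (a = a' \<and> b = b')" "\<not> (a = b \<and> a' = b')" for a b a' b'
  proof -
    have *: "X a b a' b' = 0" if "t a' / t b' \<noteq> t a / t b" "\<And>x. t x \<noteq> 0" for t :: "nat \<Rightarrow> complex"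
    proof -
      have "X a b a' b' * (t a' / t b' - t a / t b) = 0"
        using torus[of t, OF that(2) lt] by (simp only: right_diff_distrib mult.commute) simp
      then show ?thesis using that(1) by simp
    qed
    \<comment> \<open>Weight 2 at a single index: in each case the index is chosen so that the
      characters \<open>t a / t b\<close> and \<open>t a' / t b'\<close> differ.\<close>
    let ?t = "\<lambda>y x. if x = y then 2 else (1 :: complex)"
    consider "a \<noteq> a'" "a \<noteq> b" | "a = b" "a' \<noteq> b'" "a \<noteq> a'" | "a = b" "a' \<noteq> b'" "a = a'" | "a = a'" "b \<noteq> b'" "a \<noteq> b"
      using ne by blast
    then show ?thesis
    proof cases
      case 1 then show ?thesis by (intro *[of "?t a"]) auto
    next
      case 2 then show ?thesis by (intro *[of "?t a'"]) auto
    next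
      case 3 then show ?thesis by (intro *[of "?t a'"]) auto
    next
      case 4 then show ?thesis by (intro *[of "?t b"]) auto
    qed
  qed
  have perm: "X (\<pi> a) (\<pi> b) (\<pi> a') (\<pi> b') = X a b a' b'"
    if p: "\<pi> = transpose e f" "e < d" "f < d" and lt: "a < d" "b < d" "a' < d" "b' < d" for \<pi> e f a b a' b'
  proof -
    have plt: "\<pi> x < d" if "x < d" for x using that p by (auto simp: transpose_def)
    have pp: "\<pi> (\<pi> x) = x" for x using p by simp
    let ?g = "\<lambda>x y. if x = \<pi> y then 1 else (0 :: complex)"
    have dual: "dual_pair d ?g ?g"
      unfolding dual_pair_def
    proof (intro allI impI conjI)
      fix x y assume xy: "x < d" "y < d"
      have "(\<Sum>c<d. ?g x c * ?g y c) = (\<Sum>c<d. if c = \<pi> x then (if x = y then 1 else 0) else 0)"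
        using pp by (intro sum.cong) auto
      then show "(\<Sum>c<d. ?g x c * ?g y c) = (if x = y then 1 else 0)" using xy plt by simp
      have "(\<Sum>c<d. ?g c x * ?g c y) = (\<Sum>c<d. if c = \<pi> x then (if x = y then 1 else 0) else 0)"
        using pp by (intro sum.cong) (auto, metis)
      then show "(\<Sum>c<d. ?g c x * ?g c y) = (if x = y then 1 else 0)" using xy plt by simp
    qed
    have "(\<Sum>c<d. \<Sum>c'<d. X (\<pi> a) (\<pi> b) c c' * (?g c a' * ?g c' b')) =
        (\<Sum>c<d. \<Sum>c'<d. if c = \<pi> a' \<and> c' = \<pi> b' then X (\<pi> a) (\<pi> b) c c' else 0)"
      by (intro sum.cong refl) auto
    moreover have "(\<Sum>c<d. \<Sum>c'<d. (?g (\<pi> a) c * ?g (\<pi> b) c') * X c c' a' b') =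
        (\<Sum>c<d. \<Sum>c'<d. if c = a \<and> c' = b then X c c' a' b' else 0)"
      using pp by (intro sum.cong refl) (auto, (metis pp)+)
    ultimately show ?thesis using inter[OF dual plt plt lt(3,4)] lt plt by (simp add: sum_sum_delta2)
  qed
  have unip: "X i i i i - X i i j j = X j i j i" if lt: "i < d" "j < d" "i \<noteq> j" for i j
  proof -
    \<comment> \<open>\<open>?g\<close> below is the unipotent \<open>1 + E_ij\<close> and
      \<open>?h\<close> is its inverse transpose \<open>1 - E_ji\<close>. The relation is read off
      in row \<open>(i, i)\<close> and column \<open>(j, i)\<close>, where two of the entries vanish
      by \<open>zero\<close>.\<close>
    let ?D = "\<lambda>x y. if x = y then 1 else (0 :: complex)"
    let ?g = "\<lambda>x y. ?D x y + ?D x i * ?D y j" and ?h = "\<lambda>x y. ?D x y - ?D x j * ?D y i"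
    have S: "(\<Sum>c<d. ?D x c * f c) = f x" "(\<Sum>c<d. ?D c x * f c) = f x" if "x < d" for x and f :: "nat \<Rightarrow> complex"
      using that by (simp_all add: if_distrib[of "\<lambda>z. z * _"] cong: if_cong)
    have E: "(\<Sum>c<d. ?g x c * f c) = f x + ?D x i * f j" "(\<Sum>c<d. ?g c x * f c) = f x + ?D x j * f i"
      if "x < d" for x and f :: "nat \<Rightarrow> complex"
    proof -
      have "(\<Sum>c<d. ?g x c * f c) = (\<Sum>c<d. ?D x c * f c) + ?D x i * (\<Sum>c<d. ?D c j * f c)"
        by (simp only: distrib_right sum.distrib sum_distrib_left mult.assoc)
      then show "(\<Sum>c<d. ?g x c * f c) = f x + ?D x i * f j" using that lt by (simp only: S)
      have "(\<Sum>c<d. ?g c x * f c) = (\<Sum>c<d. ?D c x * f c) + ?D x j * (\<Sum>c<d. ?D c i * f c)"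
        by (simp only: distrib_left distrib_right sum.distrib sum_distrib_left mult_ac)
      then show "(\<Sum>c<d. ?g c x * f c) = f x + ?D x j * f i" using that lt by (simp only: S)
    qed
    have dual: "dual_pair d ?g ?h"
      unfolding dual_pair_def
    proof (intro allI impI conjI)
      fix x y assume xy: "x < d" "y < d"
      show "(\<Sum>c<d. ?g x c * ?h y c) = (if x = y then 1 else 0)"
        unfolding E(1)[OF xy(1), of "?h y"] using lt by auto
      show "(\<Sum>c<d. ?g c x * ?h c y) = (if x = y then 1 else 0)"
        unfolding E(2)[OF xy(1), of "\<lambda>c. ?h c y"] using lt by auto
    qed
    have gj: "?g c j = ?D c j + ?D c i" for c by simp
    have hi: "?h c i = ?D c i - ?D c j" for c by simp
    have gi: "?g i c = ?D i c + ?D j c" for c by auto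
    have hi': "?h i c = ?D i c" for c using lt by simp
    have "(\<Sum>c<d. \<Sum>c'<d. X i i c c' * (?g c j * ?h c' i)) =
      (\<Sum>c<d. (?D c j + ?D c i) * (\<Sum>c'<d. (?D c' i - ?D c' j) * X i i c c'))"
      unfolding gj hi sum_distrib_left by (simp only: mult_ac)
    also have "\<dots> = (\<Sum>c<d. (?D c j + ?D c i) * (X i i c i - X i i c j))"
      using lt by (simp only: left_diff_distrib sum_subtractf S)
    also have "\<dots> = (X i i j i - X i i j j) + (X i i i i - X i i i j)"
      using lt by (simp only: distrib_right sum.distrib S)
    finally have 1: "(\<Sum>c<d. \<Sum>c'<d. X i i c c' * (?g c j * ?h c' i)) =
      (X i i j i - X i i j j) + (X i i i i - X i i i j)" .
    have "(\<Sum>c<d. \<Sum>c'<d. (?g i c * ?h i c') * X c c' j i) =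
      (\<Sum>c<d. (?D i c + ?D j c) * (\<Sum>c'<d. ?D i c' * X c c' j i))"
      unfolding gi hi' sum_distrib_left by (simp only: mult_ac)
    also have "\<dots> = (\<Sum>c<d. (?D i c + ?D j c) * X c i j i)" using lt by (simp only: S)
    also have "\<dots> = X i i j i + X j i j i" using lt by (simp only: distrib_right sum.distrib S)
    finally have 2: "(\<Sum>c<d. \<Sum>c'<d. (?g i c * ?h i c') * X c c' j i) = X i i j i + X j i j i" .
    have "X i i j i = 0" "X i i i j = 0" using zero lt by auto
    then show ?thesis using inter[OF dual lt(1,1,2,1)] 1 2 by simp
  qed
  have pair: "\<exists>e f e' f'. e < d \<and> f < d \<and> e' < d \<and> f' < d \<and> transpose e' f' (transpose e f 0) = a \<and> transpose e' f' (transpose e f 1) = b"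
    if "a < d" "b < d" "a \<noteq> b" for a b
  proof -
    \<comment> \<open>The first transposition sends 0 to \<open>a\<close>; the second moves the
      image \<open>?e\<close> of 1 to \<open>b\<close> and fixes \<open>a\<close>, which is neither
      \<open>?e\<close> nor \<open>b\<close>.\<close>
    let ?e = "transpose 0 a 1"
    have "?e \<noteq> a" by (auto simp: transpose_def)
    then have "transpose ?e b (transpose 0 a 0) = a" using that by (simp add: transpose_def)
    moreover have "transpose ?e b (transpose 0 a 1) = b" by simp
    moreover have "?e < d" using that d by (auto simp: transpose_def)
    ultimately show ?thesis using that d by (intro exI[of _ 0] exI[of _ a] exI[of _ ?e] exI[of _ b]) auto
  qed
  have const: "X a b a b = X 0 1 0 1" "X a a b b = X 0 0 1 1" if lt: "a < d" "b < d" "a \<noteq> b" for a b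
  proof -
    obtain e f e' f' where ef: "e < d" "f < d" "e' < d" "f' < d" "transpose e' f' (transpose e f 0) = a" "transpose e' f' (transpose e f 1) = b"
      using pair[OF lt] by blast
    have z: "0 < d" "1 < d" using d by auto
    have lt': "transpose e f 0 < d" "transpose e f 1 < d" using ef z by (auto simp: transpose_def)
    show "X a b a b = X 0 1 0 1"
      using perm[OF refl ef(3,4) lt' lt'] perm[OF refl ef(1,2) z z] ef(5,6) by simp
    show "X a a b b = X 0 0 1 1"
      using perm[OF refl ef(3,4) lt'(1,1) lt'(2,2)] perm[OF refl ef(1,2) z(1,1) z(2,2)] ef(5,6) by simp
  qed
  have diag: "X a a a a = X 0 1 0 1 + X 0 0 1 1" if "a < d" for a
  proof -
    define b where "b = (if a = 0 then 1 else 0 :: nat)"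
    have b: "b < d" "a \<noteq> b" using d by (auto simp: b_def)
    show ?thesis using unip[OF that b] const(1)[OF b(1) that] const(2)[OF that b] b by (simp add: algebra_simps)
  qed
  show thesis
  proof (rule that[of "X 0 1 0 1" "X 0 0 1 1"])
    fix a b a' b' assume lt: "a < d" "b < d" "a' < d" "b' < d"
    show "compr d m A B (a, b) (a', b') = X 0 1 0 1 * (if a = a' \<and> b = b' then 1 else 0) +
      X 0 0 1 1 * (if a = b \<and> a' = b' then 1 else 0)"
      unfolding X_def[symmetric]
      using zero[OF lt] const[OF lt(1,2)] const[OF lt(1,3)] diag[OF lt(1)]
      by (cases "a = a' \<and> b = b'"; cases "a = b \<and> a' = b'") auto
  qed
qed

section \<open>Operators on the last pair of systems\<close>

definition pairs :: "nat \<Rightarrow> (nat \<times> nat) set" where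
  "pairs d = {..<d} \<times> {..<d}"

text \<open>The matrix of d - W, that is, d times the projection onto the complement of the
  maximally entangled vector.\<close>

definition dproj :: "nat \<Rightarrow> nat \<times> nat \<Rightarrow> nat \<times> nat \<Rightarrow> complex" where
  "dproj d c c' = of_nat d * (if c = c' then 1 else 0) - (if fst c = snd c \<and> fst c' = snd c' then 1 else 0)"

lemma finite_pairs [simp]: "finite (pairs d)" by (simp add: pairs_def)

lemma card_pairs: "card (pairs d) = d * d" by (simp add: pairs_def)

lemma sum_pairs: "(\<Sum>c\<in>pairs d. f c) = (\<Sum>a<d. \<Sum>b<d. f (a, b))"
  by (simp add: pairs_def sum.cartesian_product)

lemma sum_pairs_diag:
  "(\<Sum>c\<in>pairs d. (if fst c = snd c then f c else 0)) = (\<Sum>a<d. (f (a, a) :: complex))"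
  unfolding sum_pairs by (intro sum.cong refl) simp

lemma dproj_sym: "dproj d c c' = dproj d c' c"
  by (auto simp: dproj_def)

lemma sum_dproj_left:
  assumes "c' \<in> pairs d"
  shows "(\<Sum>c\<in>pairs d. f c * dproj d c c') =
    of_nat d * f c' - (if fst c' = snd c' then (\<Sum>a<d. f (a, a)) else 0)"
proof -
  have "(\<Sum>c\<in>pairs d. f c * dproj d c c') = (\<Sum>c\<in>pairs d. (if c = c' then of_nat d * f c' else 0) -
     (if fst c = snd c then (if fst c' = snd c' then f c else 0) else 0))"
    by (intro sum.cong refl) (auto simp: dproj_def algebra_simps)
  also have "\<dots> = of_nat d * f c' - (\<Sum>a<d. if fst c' = snd c' then f (a, a) else 0)"
    unfolding sum_subtractf sum_pairs_diag using assms by simp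
  finally show ?thesis by simp
qed

lemma sum_dproj_diag: "c \<in> pairs d \<Longrightarrow> (\<Sum>a<d. dproj d c (a, a)) = 0"
proof (cases "fst c = snd c")
  case True
  assume "c \<in> pairs d"
  then have "fst c < d" by (auto simp: pairs_def)
  have "(\<Sum>a<d. dproj d c (a, a)) = (\<Sum>a<d. (if a = fst c then of_nat d else 0) - 1)"
    using True by (intro sum.cong refl) (auto simp: dproj_def prod_eq_iff)
  then show ?thesis using \<open>fst c < d\<close> by (simp add: sum_subtractf)
next
  case False
  then show ?thesis by (intro sum.neutral) (auto simp: dproj_def prod_eq_iff)
qed

lemma dproj_sandwich:
  assumes X: "\<And>b b'. b \<in> pairs d \<Longrightarrow> b' \<in> pairs d \<Longrightarrow>
      X b b' = u * (if b = b' then 1 else 0) + v * (if fst b = snd b \<and> fst b' = snd b' then 1 else 0)"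
    and c: "c \<in> pairs d" "c' \<in> pairs d"
  shows "(\<Sum>b\<in>pairs d. dproj d c b * (\<Sum>b'\<in>pairs d. X b b' * dproj d b' c')) = of_nat d * u * dproj d c c'"
proof -
  have right: "(\<Sum>b'\<in>pairs d. X b b' * dproj d b' c') = u * dproj d b c'" if b: "b \<in> pairs d" for b
  proof -
    have "(\<Sum>a<d. X b (a, a)) = (if fst b = snd b then u + of_nat d * v else 0)"
    proof (cases "fst b = snd b")
      case True
      then have "fst b < d" using b by (auto simp: pairs_def)
      have "(\<Sum>a<d. X b (a, a)) = (\<Sum>a<d. (if a = fst b then u else 0) + v)"
        using True b by (intro sum.cong refl) (auto simp: X pairs_def prod_eq_iff)
      then show ?thesis using True \<open>fst b < d\<close> by (simp add: sum.distrib)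
    next
      case False
      then show ?thesis using b by (auto intro!: sum.neutral simp: X pairs_def)
    qed
    then show ?thesis
      unfolding sum_dproj_left[OF c(2)] by (auto simp: X[OF b c(2)] dproj_def algebra_simps)
  qed
  have "(\<Sum>b\<in>pairs d. dproj d c b * (\<Sum>b'\<in>pairs d. X b b' * dproj d b' c')) =
      u * (\<Sum>b\<in>pairs d. dproj d c b * dproj d b c')"
  proof -
    have "(\<Sum>b\<in>pairs d. dproj d c b * (\<Sum>b'\<in>pairs d. X b b' * dproj d b' c')) =
        (\<Sum>b\<in>pairs d. dproj d c b * (u * dproj d b c'))"
      by (intro sum.cong refl) (simp only: right)
    then show ?thesis by (simp only: sum_distrib_left mult.left_commute)
  qed
  also have "\<dots> = of_nat d * u * dproj d c c'"
    unfolding sum_dproj_left[OF c(2)] using sum_dproj_diag[OF c(1)] by simp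
  finally show ?thesis .
qed

text \<open>The trace and the expectation in the unnormalised maximally entangled vector separate
  the two coefficients: on the identity they are \<open>d^2\<close> and \<open>d\<close>, on W they
  are \<open>d\<close> and \<open>d^2\<close>.\<close>

lemma compr_traces:
  fixes X :: "nat \<times> nat \<Rightarrow> nat \<times> nat \<Rightarrow> complex"
  assumes X: "\<And>b b'. b \<in> pairs d \<Longrightarrow> b' \<in> pairs d \<Longrightarrow>
      X b b' = u * (if b = b' then 1 else 0) + v * (if fst b = snd b \<and> fst b' = snd b' then 1 else 0)"
  shows "(\<Sum>b\<in>pairs d. X b b) = of_nat d ^ 2 * u + of_nat d * v"
    "(\<Sum>a<d. \<Sum>b<d. X (a, a) (b, b)) = of_nat d * u + of_nat d ^ 2 * v"
proof -
  have "(\<Sum>b\<in>pairs d. X b b) = (\<Sum>b\<in>pairs d. u) + (\<Sum>b\<in>pairs d. if fst b = snd b then v else 0)"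
    unfolding sum.distrib[symmetric] by (intro sum.cong refl) (simp add: X)
  also have "(\<Sum>b\<in>pairs d. if fst b = snd b then v else 0) = of_nat d * v"
    by (subst sum_pairs_diag) simp
  finally show "(\<Sum>b\<in>pairs d. X b b) = of_nat d ^ 2 * u + of_nat d * v"
    by (simp add: card_pairs power2_eq_square)
  have "(\<Sum>a<d. \<Sum>b<d. X (a, a) (b, b)) = (\<Sum>a<d. \<Sum>b<d. (if a = b then u else 0) + v)"
    by (intro sum.cong refl) (auto simp: X pairs_def)
  then show "(\<Sum>a<d. \<Sum>b<d. X (a, a) (b, b)) = of_nat d * u + of_nat d ^ 2 * v"
    by (simp add: sum.distrib power2_eq_square algebra_simps)
qed

section \<open>The partially transposed permutation operators\<close>

definition join :: "nat \<Rightarrow> (nat \<Rightarrow> nat) \<Rightarrow> (nat \<Rightarrow> nat) \<Rightarrow> nat \<Rightarrow> nat" where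
  "join p u v = restrict (\<lambda>k. if k \<le> p then u (p + 1 - k) else v (k - p)) {1..2 * p}"

lemma slots_join:
  assumes "u \<in> basis d p" "v \<in> basis d p"
  shows "slotsA p (join p u v) = u" "slotsB p (join p u v) = v" "join p u v \<in> basis d (2 * p)"
proof -
  show "slotsA p (join p u v) = u"
    using assms(1) by (auto simp: slotsA_def join_def basis_def PiE_iff extensional_def fun_eq_iff)
  show "slotsB p (join p u v) = v"
    using assms(2) by (auto simp: slotsB_def join_def basis_def PiE_iff extensional_def fun_eq_iff)
  show "join p u v \<in> basis d (2 * p)"
    unfolding basis_def
  proof (rule PiE_I)
    fix k assume k: "k \<in> {1..2 * p}"
    have "u (p + 1 - k) \<in> {0..<d}" if "k \<le> p"
      using assms(1) k that unfolding basis_def by (intro PiE_mem[of u "{1..p}" "\<lambda>_. {0..<d}"]) auto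
    moreover have "v (k - p) \<in> {0..<d}" if "\<not> k \<le> p"
      using assms(2) k that unfolding basis_def by (intro PiE_mem[of v "{1..p}" "\<lambda>_. {0..<d}"]) auto
    ultimately show "join p u v k \<in> {0..<d}" using k by (auto simp: join_def)
  next
    fix k assume "k \<notin> {1..2 * p}"
    then show "join p u v k = undefined" unfolding join_def by (rule restrict_apply[THEN trans, OF if_not_P])
  qed
qed

lemma slots_basis:
  assumes "y \<in> basis d (2 * p)"
  shows "slotsA p y \<in> basis d p" "slotsB p y \<in> basis d p" "join p (slotsA p y) (slotsB p y) = y"
proof -
  have y: "y k \<in> {0..<d}" if "k \<in> {1..2 * p}" for k
    using assms that unfolding basis_def by (rule PiE_mem)
  have out: "y k = undefined" if "k \<notin> {1..2 * p}" for k
    using assms that unfolding basis_def by (rule PiE_arb)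
  show "slotsA p y \<in> basis d p" "slotsB p y \<in> basis d p"
    unfolding basis_def slotsA_def slotsB_def restrict_PiE_iff by (intro ballI, rule y, force)+
  show "join p (slotsA p y) (slotsB p y) = y"
  proof
    fix k
    show "join p (slotsA p y) (slotsB p y) k = y k"
      using out[of k] by (cases "k \<in> {1..2 * p}") (auto simp: join_def slotsA_def slotsB_def)
  qed
qed

lemma sum_basis_slots:
  "(\<Sum>y\<in>basis d (2 * p). F (slotsA p y) (slotsB p y)) = (\<Sum>u\<in>basis d p. \<Sum>v\<in>basis d p. F u v)"
proof -
  have "(\<Sum>y\<in>basis d (2 * p). F (slotsA p y) (slotsB p y)) = (\<Sum>(u, v)\<in>basis d p \<times> basis d p. F u v)"
    by (rule sum.reindex_bij_witness[of _ "\<lambda>(u, v). join p u v" "\<lambda>y. (slotsA p y, slotsB p y)"])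
      (auto simp: slots_join slots_basis)
  then show ?thesis by (simp add: sum.cartesian_product)
qed

text \<open>Distinct \<open>k\<close> touch disjoint pairs of systems, so the product acts on each
  pair separately and an entry receives a contribution from at most one intermediate basis
  vector.\<close>

lemma Vpart_foldr:
  assumes "distinct ks" "set ks \<subseteq> {1..p}" and y: "y \<in> basis d (2 * p)" and x: "x \<in> basis d (2 * p)"
  shows "foldr (\<lambda>k M. op_mult d (2 * p) (Wop (p + 1 - k) (p + k)) M) ks op_id y x =
    (if (\<forall>k\<in>set ks. y (p + 1 - k) = y (p + k) \<and> x (p + 1 - k) = x (p + k)) \<and>
        (\<forall>j. (\<forall>k\<in>set ks. j \<noteq> p + 1 - k \<and> j \<noteq> p + k) \<longrightarrow> y j = x j) then 1 else 0)"
  using assms(1,2) y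
proof (induction ks arbitrary: y)
  case Nil
  then show ?case by (auto simp: op_id_def mat_id_def fun_eq_iff)
next
  case (Cons k ks)
  let ?M = "foldr (\<lambda>k M. op_mult d (2 * p) (Wop (p + 1 - k) (p + k)) M) ks op_id"
  let ?C = "\<lambda>ks y. (\<forall>k\<in>set ks. y (p + 1 - k) = y (p + k) \<and> x (p + 1 - k) = x (p + k)) \<and>
        (\<forall>j. (\<forall>k\<in>set ks. j \<noteq> p + 1 - k \<and> j \<noteq> p + k) \<longrightarrow> y j = x j)"
  let ?a = "p + 1 - k" and ?b = "p + k"
  have k: "1 \<le> k" "k \<le> p" "k \<notin> set ks" using Cons.prems by auto
  have ne: "?a \<noteq> p + 1 - l" "?a \<noteq> p + l" "?b \<noteq> p + 1 - l" "?b \<noteq> p + l" if "l \<in> set ks" for l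
  proof -
    have "1 \<le> l" "l \<le> p" "l \<noteq> k" using that Cons.prems by auto
    then show "?a \<noteq> p + 1 - l" "?a \<noteq> p + l" "?b \<noteq> p + 1 - l" "?b \<noteq> p + l" using k by auto
  qed
  have ab: "?a \<noteq> ?b" using k by auto
  \<comment> \<open>The only intermediate vector that can contribute: the pair of \<open>k\<close>
    already carries the values of \<open>x\<close>, all other systems still those of
    \<open>y\<close>.\<close>
  define w where "w = y(?a := x ?a, ?b := x ?b)"
  have w: "w \<in> basis d (2 * p)"
    using Cons.prems(3) x k unfolding basis_def w_def
    by (intro PiE_I) (auto simp: PiE_iff extensional_def)
  have wv: "w ?a = x ?a" "w ?b = x ?b" "\<And>j. j \<noteq> ?a \<Longrightarrow> j \<noteq> ?b \<Longrightarrow> w j = y j"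
    using ab by (auto simp: w_def)
  have IH: "?M z x = (if ?C ks z then 1 else 0)" if "z \<in> basis d (2 * p)" for z
    using Cons.IH Cons.prems that by auto
  have uniq: "z = w" if "Wop ?a ?b y z \<noteq> 0" "?C ks z" for z
  proof
    fix j
    have W: "\<And>j. j \<noteq> ?a \<Longrightarrow> j \<noteq> ?b \<Longrightarrow> y j = z j" using that(1) by (auto simp: Wop_def split: if_splits)
    have "z ?a = x ?a" "z ?b = x ?b" using that(2) ne by auto
    then show "z j = w j" using W[of j] wv by (cases "j = ?a"; cases "j = ?b") auto
  qed
  have wl: "w (p + 1 - l) = y (p + 1 - l)" "w (p + l) = y (p + l)" if "l \<in> set ks" for l
    using wv(3)[OF ne(1,3)[OF that, symmetric]] wv(3)[OF ne(2,4)[OF that, symmetric]] .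
  define Q1 where "Q1 \<longleftrightarrow> (\<forall>l\<in>set ks. y (p + 1 - l) = y (p + l) \<and> x (p + 1 - l) = x (p + l))"
  define Q2 where "Q2 \<longleftrightarrow> (\<forall>j. (\<forall>l\<in>set (k # ks). j \<noteq> p + 1 - l \<and> j \<noteq> p + l) \<longrightarrow> y j = x j)"
  have "(\<forall>j. (\<forall>l\<in>set ks. j \<noteq> p + 1 - l \<and> j \<noteq> p + l) \<longrightarrow> w j = x j) \<longleftrightarrow> Q2"
    unfolding Q2_def
  proof (intro iffI allI impI)
    fix j assume *: "\<forall>j. (\<forall>l\<in>set ks. j \<noteq> p + 1 - l \<and> j \<noteq> p + l) \<longrightarrow> w j = x j"
      "\<forall>l\<in>set (k # ks). j \<noteq> p + 1 - l \<and> j \<noteq> p + l"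
    then have "w j = x j" "w j = y j" using wv(3)[of j] by auto
    then show "y j = x j" by simp
  next
    fix j assume *: "\<forall>j. (\<forall>l\<in>set (k # ks). j \<noteq> p + 1 - l \<and> j \<noteq> p + l) \<longrightarrow> y j = x j"
      "\<forall>l\<in>set ks. j \<noteq> p + 1 - l \<and> j \<noteq> p + l"
    show "w j = x j"
    proof (cases "j = ?a \<or> j = ?b")
      case True
      then show ?thesis using wv(1,2) by blast
    next
      case False
      then have "\<forall>l\<in>set (k # ks). j \<noteq> p + 1 - l \<and> j \<noteq> p + l" using *(2) by simp
      then have "y j = x j" using *(1) by blast
      then show ?thesis using wv(3)[of j] False by simp
    qed
  qed
  moreover have "(\<forall>l\<in>set ks. w (p + 1 - l) = w (p + l) \<and> x (p + 1 - l) = x (p + l)) \<longleftrightarrow> Q1"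
    unfolding Q1_def by (intro ball_cong refl) (simp only: wl)
  ultimately have Mw: "?M w x = (if Q1 \<and> Q2 then 1 else 0)" using IH[OF w] by (simp only:)
  have "foldr (\<lambda>k M. op_mult d (2 * p) (Wop (p + 1 - k) (p + k)) M) (k # ks) op_id y x =
     (\<Sum>z\<in>basis d (2 * p). Wop ?a ?b y z * ?M z x)"
    by (simp add: op_mult_def mat_mult_on_def)
  also have "\<dots> = (\<Sum>z\<in>basis d (2 * p). if z = w then Wop ?a ?b y w * ?M w x else 0)"
  proof (intro sum.cong refl)
    fix z assume z: "z \<in> basis d (2 * p)"
    show "Wop ?a ?b y z * ?M z x = (if z = w then Wop ?a ?b y w * ?M w x else 0)"
    proof (cases "z = w")
      case False
      then have "Wop ?a ?b y z = 0 \<or> \<not> ?C ks z" using uniq by blast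
      then have "Wop ?a ?b y z = 0 \<or> ?M z x = 0" using IH[OF z] by (metis (no_types, lifting))
      then show ?thesis using False by auto
    qed simp
  qed
  also have "\<dots> = Wop ?a ?b y w * ?M w x" using w by simp
  also have "Wop ?a ?b y w = (if y ?a = y ?b \<and> x ?a = x ?b then 1 else 0)"
    unfolding Wop_def wv(1,2) using wv(3) by auto
  also have "\<dots> * ?M w x = (if ((y ?a = y ?b \<and> x ?a = x ?b) \<and> Q1) \<and> Q2 then 1 else 0)"
    unfolding Mw by auto
  also have "((y ?a = y ?b \<and> x ?a = x ?b) \<and> Q1) \<longleftrightarrow>
      (\<forall>l\<in>set (k # ks). y (p + 1 - l) = y (p + l) \<and> x (p + 1 - l) = x (p + l))"
    unfolding Q1_def by simp
  finally show ?case unfolding Q2_def .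
qed

lemma Vpart_entry:
  assumes r: "r \<le> p" and y: "y \<in> basis d (2 * p)" and x: "x \<in> basis d (2 * p)"
  shows "Vpart d p r y x =
    (if (\<forall>k\<in>{1..r}. slotsA p y k = slotsB p y k \<and> slotsA p x k = slotsB p x k) \<and>
        (\<forall>k\<in>{Suc r..p}. slotsA p y k = slotsA p x k \<and> slotsB p y k = slotsB p x k) then 1 else 0)"
proof -
  have out: "y j = x j" if "j \<notin> {1..2 * p}" for j
    using x y that unfolding basis_def by (simp add: PiE_arb[of _ _ _ j])
  have "(\<forall>j. (\<forall>k\<in>{1..r}. j \<noteq> p + 1 - k \<and> j \<noteq> p + k) \<longrightarrow> y j = x j) \<longleftrightarrow>
      (\<forall>k\<in>{Suc r..p}. y (p + 1 - k) = x (p + 1 - k) \<and> y (p + k) = x (p + k))" (is "?L \<longleftrightarrow> ?R")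
  proof
    assume L: ?L
    show ?R
    proof
      fix k assume k: "k \<in> {Suc r..p}"
      have "\<forall>l\<in>{1..r}. p + 1 - k \<noteq> p + 1 - l \<and> p + 1 - k \<noteq> p + l" using k r by auto
      moreover have "\<forall>l\<in>{1..r}. p + k \<noteq> p + 1 - l \<and> p + k \<noteq> p + l" using k r by auto
      ultimately show "y (p + 1 - k) = x (p + 1 - k) \<and> y (p + k) = x (p + k)" using L by blast
    qed
  next
    assume R: ?R
    show ?L
    proof (intro allI impI)
      fix j assume j: "\<forall>k\<in>{1..r}. j \<noteq> p + 1 - k \<and> j \<noteq> p + k"
      consider "j \<notin> {1..2 * p}" | "1 \<le> j" "j \<le> p" | "p < j" "j \<le> 2 * p" by fastforce
      then show "y j = x j"
      proof cases
        case 1 then show ?thesis by (rule out)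
      next
        case 2
        define k where "k = p + 1 - j"
        have "j = p + 1 - k" "1 \<le> k" "k \<le> p" using 2 by (auto simp: k_def)
        moreover have "\<not> k \<le> r" using j calculation by auto
        ultimately show ?thesis using R by auto
      next
        case 3
        define k where "k = j - p"
        have "j = p + k" "1 \<le> k" "k \<le> p" using 3 by (auto simp: k_def)
        moreover have "\<not> k \<le> r" using j calculation by auto
        ultimately show ?thesis using R by auto
      qed
    qed
  qed
  moreover have "set [1..<Suc r] = {1..r}" by auto
  moreover have "slotsA p z k = z (p + 1 - k)" "slotsB p z k = z (p + k)" if "k \<in> {1..p}" for z k
    using that by (auto simp: slotsA_def slotsB_def)
  ultimately show ?thesis
    using Vpart_foldr[of "[1..<Suc r]" p y d x] r x y by (auto simp: Vpart_def simp del: upt_Suc)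
qed

text \<open>Column \<open>c\<close> of the map J: maximally entangled on the first \<open>m\<close>
  slots of both factors, the basis vector \<open>c\<close> on the last slots.\<close>

definition jvec :: "nat \<Rightarrow> (nat \<Rightarrow> nat) \<Rightarrow> (nat \<Rightarrow> nat) \<Rightarrow> nat \<times> nat \<Rightarrow> complex" where
  "jvec m u v c = (if (\<forall>k\<in>{1..m}. u k = v k) \<and> u (Suc m) = fst c \<and> v (Suc m) = snd c then 1 else 0)"

lemma basis_Suc_less: "u \<in> basis d (Suc m) \<Longrightarrow> u (Suc m) < d"
  by (auto simp: basis_def PiE_iff)

lemma Vpart_pred_factor:
  assumes y: "y \<in> basis d (2 * Suc m)" and x: "x \<in> basis d (2 * Suc m)"
  shows "Vpart d (Suc m) m y x =
    (\<Sum>c\<in>pairs d. jvec m (slotsA (Suc m) y) (slotsB (Suc m) y) c * jvec m (slotsA (Suc m) x) (slotsB (Suc m) x) c)"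
proof -
  let ?a = "(slotsA (Suc m) y (Suc m), slotsB (Suc m) y (Suc m))"
  have a: "?a \<in> pairs d" using slots_basis[OF y] by (auto simp: pairs_def dest: basis_Suc_less)
  have "(\<Sum>c\<in>pairs d. jvec m (slotsA (Suc m) y) (slotsB (Suc m) y) c * jvec m (slotsA (Suc m) x) (slotsB (Suc m) x) c) =
    (\<Sum>c\<in>pairs d. if c = ?a then jvec m (slotsA (Suc m) y) (slotsB (Suc m) y) ?a * jvec m (slotsA (Suc m) x) (slotsB (Suc m) x) ?a else 0)"
    by (intro sum.cong refl) (auto simp: jvec_def prod_eq_iff)
  also have "\<dots> = jvec m (slotsA (Suc m) y) (slotsB (Suc m) y) ?a * jvec m (slotsA (Suc m) x) (slotsB (Suc m) x) ?a"
    using a by simp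
  also have "\<dots> = Vpart d (Suc m) m y x"
    unfolding Vpart_entry[OF le_SucI[OF order_refl] y x] by (auto simp: jvec_def)
  finally show ?thesis ..
qed

text \<open>W has rank one, so the sum over pairs splits into a product of two sums over diagonal
  pairs.\<close>

lemma Vpart_full_factor:
  assumes y: "y \<in> basis d (2 * Suc m)" and x: "x \<in> basis d (2 * Suc m)"
  shows "Vpart d (Suc m) (Suc m) y x =
    (\<Sum>a<d. jvec m (slotsA (Suc m) y) (slotsB (Suc m) y) (a, a)) * (\<Sum>a<d. jvec m (slotsA (Suc m) x) (slotsB (Suc m) x) (a, a))"
proof -
  have s: "(\<Sum>a<d. jvec m u v (a, a)) = (if \<forall>k\<in>{1..Suc m}. u k = v k then 1 else 0)"
    if u: "u \<in> basis d (Suc m)" for u v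
  proof -
    have "(\<Sum>a<d. jvec m u v (a, a)) =
        (\<Sum>a<d. if a = u (Suc m) then (if (\<forall>k\<in>{1..m}. u k = v k) \<and> v (Suc m) = u (Suc m) then 1 else 0) else 0)"
      by (intro sum.cong refl) (auto simp: jvec_def)
    also have "\<dots> = (if (\<forall>k\<in>{1..m}. u k = v k) \<and> v (Suc m) = u (Suc m) then 1 else 0)"
      using basis_Suc_less[OF u] by simp
    also have "((\<forall>k\<in>{1..m}. u k = v k) \<and> v (Suc m) = u (Suc m)) = (\<forall>k\<in>{1..Suc m}. u k = v k)"
    proof -
      have "{1..Suc m} = insert (Suc m) {1..m}" by auto
      then show ?thesis by auto
    qed
    finally show ?thesis .
  qed
  show ?thesis
    unfolding s[OF slots_basis(1)[OF y]] s[OF slots_basis(1)[OF x]] Vpart_entry[OF order_refl y x]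
    by auto
qed

lemma sum_jvec:
  assumes c: "c \<in> pairs d"
  shows "(\<Sum>z\<in>basis d (2 * Suc m). F (slotsA (Suc m) z) (slotsB (Suc m) z) * jvec m (slotsA (Suc m) z) (slotsB (Suc m) z) c) =
    (\<Sum>s\<in>basis d m. F (s(Suc m := fst c)) (s(Suc m := snd c)))"
proof -
  have j: "jvec m (s(Suc m := a)) (t(Suc m := b)) c = (if t = s then if a = fst c then if b = snd c then 1 else 0 else 0 else 0)"
    if "s \<in> basis d m" "t \<in> basis d m" for s t a b
  proof -
    have "(\<forall>k\<in>{1..m}. (s(Suc m := a)) k = (t(Suc m := b)) k) \<longleftrightarrow> s = t"
      using basis_eq_iff[OF that] by auto
    then show ?thesis by (auto simp: jvec_def)
  qed
  have "(\<Sum>z\<in>basis d (2 * Suc m). F (slotsA (Suc m) z) (slotsB (Suc m) z) * jvec m (slotsA (Suc m) z) (slotsB (Suc m) z) c) =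
     (\<Sum>u\<in>basis d (Suc m). \<Sum>v\<in>basis d (Suc m). F u v * jvec m u v c)"
    by (rule sum_basis_slots)
  also have "\<dots> = (\<Sum>s\<in>basis d m. \<Sum>a<d. \<Sum>t\<in>basis d m. \<Sum>b<d. F (s(Suc m := a)) (t(Suc m := b)) *
      (if t = s then if a = fst c then if b = snd c then 1 else 0 else 0 else 0))"
    unfolding sum_basis_Suc by (intro sum.cong refl) (simp only: j)
  also have "\<dots> = (\<Sum>s\<in>basis d m. \<Sum>a<d. if a = fst c then F (s(Suc m := fst c)) (s(Suc m := snd c)) else 0)"
  proof (intro sum.cong refl)
    fix s a assume s: "s \<in> basis d m"
    have "(\<Sum>t\<in>basis d m. \<Sum>b<d. F (s(Suc m := a)) (t(Suc m := b)) *
      (if t = s then if a = fst c then if b = snd c then 1 else 0 else 0 else 0)) =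
      (\<Sum>t\<in>basis d m. if t = s then (\<Sum>b<d. if b = snd c then (if a = fst c then F (s(Suc m := a)) (s(Suc m := b)) else 0) else 0) else 0)"
    proof (intro sum.cong refl)
      fix t
      have "(\<Sum>b<d. F (s(Suc m := a)) (s(Suc m := b)) * (if a = fst c then if b = snd c then 1 else 0 else 0)) =
        (\<Sum>b<d. if b = snd c then (if a = fst c then F (s(Suc m := a)) (s(Suc m := b)) else 0) else 0)"
        by (intro sum.cong refl) auto
      then show "(\<Sum>b<d. F (s(Suc m := a)) (t(Suc m := b)) *
          (if t = s then if a = fst c then if b = snd c then 1 else 0 else 0 else 0)) =
        (if t = s then (\<Sum>b<d. if b = snd c then (if a = fst c then F (s(Suc m := a)) (s(Suc m := b)) else 0) else 0) else 0)"
        by (cases "t = s") (simp_all only: if_True if_False mult_zero_right sum.neutral_const refl)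
    qed
    then show "(\<Sum>t\<in>basis d m. \<Sum>b<d. F (s(Suc m := a)) (t(Suc m := b)) *
      (if t = s then if a = fst c then if b = snd c then 1 else 0 else 0 else 0)) =
      (if a = fst c then F (s(Suc m := fst c)) (s(Suc m := snd c)) else 0)"
      using s c by (auto simp: pairs_def)
  qed
  also have "\<dots> = (\<Sum>s\<in>basis d m. F (s(Suc m := fst c)) (s(Suc m := snd c)))"
    using c by (auto simp: pairs_def)
  finally show ?thesis .
qed

text \<open>Entries of (A \<otimes> B) J; \<open>right_fac\<close> does the same for J^T (A
  \<otimes> B). Both \<open>F\<close> operators factor through the small space of pairs this
  way.\<close>

definition left_fac :: "nat \<Rightarrow> nat \<Rightarrow> op \<Rightarrow> op \<Rightarrow> (nat \<Rightarrow> nat) \<Rightarrow> nat \<times> nat \<Rightarrow> complex" where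
  "left_fac d m A B y c = (\<Sum>s\<in>basis d m.
     A (slotsA (Suc m) y) (s(Suc m := fst c)) * B (slotsB (Suc m) y) (s(Suc m := snd c)))"

definition right_fac :: "nat \<Rightarrow> nat \<Rightarrow> op \<Rightarrow> op \<Rightarrow> nat \<times> nat \<Rightarrow> (nat \<Rightarrow> nat) \<Rightarrow> complex" where
  "right_fac d m A B c x = (\<Sum>s\<in>basis d m.
     A (s(Suc m := fst c)) (slotsA (Suc m) x) * B (s(Suc m := snd c)) (slotsB (Suc m) x))"

lemma tensor_jvec:
  assumes "c \<in> pairs d"
  shows "(\<Sum>z\<in>basis d (2 * Suc m). tensor (Suc m) A B y z * jvec m (slotsA (Suc m) z) (slotsB (Suc m) z) c) = left_fac d m A B y c"
    "(\<Sum>z\<in>basis d (2 * Suc m). jvec m (slotsA (Suc m) z) (slotsB (Suc m) z) c * tensor (Suc m) A B z x) = right_fac d m A B c x"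
  unfolding left_fac_def right_fac_def tensor_def
  using sum_jvec[OF assms, of "\<lambda>u v. A (slotsA (Suc m) y) u * B (slotsB (Suc m) y) v" m]
    sum_jvec[OF assms, of "\<lambda>u v. A u (slotsA (Suc m) x) * B v (slotsB (Suc m) x)" m]
  by (simp_all add: mult.commute)

lemma op_mult3: "op_mult d n (op_mult d n A V) B y x =
    (\<Sum>z\<in>basis d n. \<Sum>w\<in>basis d n. A y z * V z w * B w x)"
  unfolding op_mult_def mat_mult_on_def sum_distrib_right by (rule sum.swap)

lemma sandwich_pred:
  "op_mult d (2 * Suc m) (op_mult d (2 * Suc m) (tensor (Suc m) A B) (Vpart d (Suc m) m)) (tensor (Suc m) A' B') y x =
    (\<Sum>c\<in>pairs d. left_fac d m A B y c * right_fac d m A' B' c x)"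
proof -
  let ?X = "basis d (2 * Suc m)" and ?j = "\<lambda>z. jvec m (slotsA (Suc m) z) (slotsB (Suc m) z)"
  have "op_mult d (2 * Suc m) (op_mult d (2 * Suc m) (tensor (Suc m) A B) (Vpart d (Suc m) m)) (tensor (Suc m) A' B') y x =
     (\<Sum>z\<in>?X. \<Sum>w\<in>?X. \<Sum>c\<in>pairs d. (tensor (Suc m) A B y z * ?j z c) * (?j w c * tensor (Suc m) A' B' w x))"
    unfolding op_mult3
    by (intro sum.cong refl) (simp only: Vpart_pred_factor sum_distrib_left sum_distrib_right mult.assoc)
  also have "\<dots> = (\<Sum>c\<in>pairs d. \<Sum>z\<in>?X. \<Sum>w\<in>?X. (tensor (Suc m) A B y z * ?j z c) * (?j w c * tensor (Suc m) A' B' w x))"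
    by (rule sum_rotate3[symmetric])
  also have "\<dots> = (\<Sum>c\<in>pairs d. left_fac d m A B y c * right_fac d m A' B' c x)"
    by (intro sum.cong refl) (simp only: sum_product[symmetric] tensor_jvec)
  finally show ?thesis .
qed

lemma sandwich_full:
  "op_mult d (2 * Suc m) (op_mult d (2 * Suc m) (tensor (Suc m) A B) (Vpart d (Suc m) (Suc m))) (tensor (Suc m) A' B') y x =
    (\<Sum>a<d. left_fac d m A B y (a, a)) * (\<Sum>a<d. right_fac d m A' B' (a, a) x)"
proof -
  let ?X = "basis d (2 * Suc m)" and ?j = "\<lambda>z. jvec m (slotsA (Suc m) z) (slotsB (Suc m) z)"
  have "op_mult d (2 * Suc m) (op_mult d (2 * Suc m) (tensor (Suc m) A B) (Vpart d (Suc m) (Suc m))) (tensor (Suc m) A' B') y x =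
     (\<Sum>z\<in>?X. \<Sum>w\<in>?X. (\<Sum>a<d. tensor (Suc m) A B y z * ?j z (a, a)) * (\<Sum>a<d. ?j w (a, a) * tensor (Suc m) A' B' w x))"
    unfolding op_mult3
    by (intro sum.cong refl) (simp only: Vpart_full_factor sum_distrib_left[symmetric] sum_distrib_right[symmetric] mult.assoc)
  also have "\<dots> = (\<Sum>a<d. \<Sum>z\<in>?X. tensor (Suc m) A B y z * ?j z (a, a)) * (\<Sum>a<d. \<Sum>w\<in>?X. ?j w (a, a) * tensor (Suc m) A' B' w x)"
    by (simp only: sum_product[symmetric] sum.swap[of _ "?X" "{..<d}"])
  also have "\<dots> = (\<Sum>a<d. left_fac d m A B y (a, a)) * (\<Sum>a<d. right_fac d m A' B' (a, a) x)"
    by (intro arg_cong2[of _ _ _ _ "(*)"] sum.cong refl tensor_jvec) (auto simp: pairs_def)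
  finally show ?thesis .
qed

lemma left_fac_diag:
  "(\<Sum>a<d. left_fac d m A B y (a, a)) = (\<Sum>u\<in>basis d (Suc m). A (slotsA (Suc m) y) u * B (slotsB (Suc m) y) u)"
  unfolding left_fac_def sum_basis_Suc fst_conv snd_conv by (rule sum.swap)

lemma right_fac_diag:
  "(\<Sum>a<d. right_fac d m A B (a, a) x) = (\<Sum>u\<in>basis d (Suc m). A u (slotsA (Suc m) x) * B u (slotsB (Suc m) x))"
  unfolding right_fac_def sum_basis_Suc fst_conv snd_conv by (rule sum.swap)

text \<open>Adjacent factors multiply slotwise before being compressed. The scalars \<open>a\<close>
  and \<open>b\<close> absorb the Kronecker deltas of \<open>Eunit_mult\<close>, so vanishing
  products are covered as well.\<close>

lemma right_left_compr:
  assumes c: "c \<in> pairs d" "c' \<in> pairs d"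
    and A: "\<And>u v. u \<in> basis d (Suc m) \<Longrightarrow> v \<in> basis d (Suc m) \<Longrightarrow> (\<Sum>w\<in>basis d (Suc m). A u w * A' w v) = a * A'' u v"
    and B: "\<And>u v. u \<in> basis d (Suc m) \<Longrightarrow> v \<in> basis d (Suc m) \<Longrightarrow> (\<Sum>w\<in>basis d (Suc m). B u w * B' w v) = b * B'' u v"
  shows "(\<Sum>z\<in>basis d (2 * Suc m). right_fac d m A B c z * left_fac d m A' B' z c') = a * b * compr d m A'' B'' c c'"
proof -
  let ?X = "basis d m" and ?Y = "basis d (Suc m)"
  have "(\<Sum>z\<in>basis d (2 * Suc m). right_fac d m A B c z * left_fac d m A' B' z c') =
    (\<Sum>u\<in>?Y. \<Sum>v\<in>?Y. (\<Sum>s\<in>?X. A (s(Suc m := fst c)) u * B (s(Suc m := snd c)) v) *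
       (\<Sum>t\<in>?X. A' u (t(Suc m := fst c')) * B' v (t(Suc m := snd c'))))"
    unfolding right_fac_def left_fac_def by (rule sum_basis_slots)
  also have "\<dots> = (\<Sum>u\<in>?Y. \<Sum>v\<in>?Y. \<Sum>s\<in>?X. \<Sum>t\<in>?X. (A (s(Suc m := fst c)) u * A' u (t(Suc m := fst c'))) *
       (B (s(Suc m := snd c)) v * B' v (t(Suc m := snd c'))))"
    by (simp only: sum_product mult_ac)
  also have "\<dots> = (\<Sum>s\<in>?X. \<Sum>t\<in>?X. \<Sum>u\<in>?Y. \<Sum>v\<in>?Y. (A (s(Suc m := fst c)) u * A' u (t(Suc m := fst c'))) *
       (B (s(Suc m := snd c)) v * B' v (t(Suc m := snd c'))))"
    by (rule sum_swap_pairs)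
  also have "\<dots> = (\<Sum>s\<in>?X. \<Sum>t\<in>?X. (a * A'' (s(Suc m := fst c)) (t(Suc m := fst c'))) * (b * B'' (s(Suc m := snd c)) (t(Suc m := snd c'))))"
  proof (intro sum.cong refl)
    fix s t assume s: "s \<in> ?X" and t: "t \<in> ?X"
    have m: "s(Suc m := fst c) \<in> ?Y" "s(Suc m := snd c) \<in> ?Y" "t(Suc m := fst c') \<in> ?Y" "t(Suc m := snd c') \<in> ?Y"
      using s t c by (auto intro!: basis_upd_Suc simp: pairs_def)
    show "(\<Sum>u\<in>?Y. \<Sum>v\<in>?Y. (A (s(Suc m := fst c)) u * A' u (t(Suc m := fst c'))) *
       (B (s(Suc m := snd c)) v * B' v (t(Suc m := snd c')))) =
      (a * A'' (s(Suc m := fst c)) (t(Suc m := fst c'))) * (b * B'' (s(Suc m := snd c)) (t(Suc m := snd c')))"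
      by (simp only: sum_product[symmetric] A[OF m(1,3)] B[OF m(2,4)])
  qed
  also have "\<dots> = a * b * compr d m A'' B'' c c'"
    unfolding compr_def sum_distrib_left by (simp only: mult_ac)
  finally show ?thesis .
qed

section \<open>Multiplication of the irreducible matrix units\<close>

lemma Eunit_cnj: "cnj (Eunit n mu i j y x) = Eunit n mu i j y x"
  by (simp add: Eunit_def Vperm_def if_distrib[of cnj] cong: if_cong)

lemma dproj_cnj: "cnj (dproj d c c') = dproj d c c'"
  by (simp add: dproj_def)

lemma left_fac_Eunit_cnj:
  "cnj (left_fac d m (Eunit n mu i a) (Eunit n' nu j b) y c) = left_fac d m (Eunit n mu i a) (Eunit n' nu j b) y c"
  by (simp add: left_fac_def Eunit_cnj)

lemma left_fac_Eunit_transpose: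
  assumes "is_partition e (Suc m) mu" "is_partition e' (Suc m) nu"
    and "i \<in> syt mu" "a \<in> syt mu" "j \<in> syt nu" "b \<in> syt nu"
  shows "left_fac d m (Eunit (Suc m) mu i a) (Eunit (Suc m) nu j b) y c =
    right_fac d m (Eunit (Suc m) mu a i) (Eunit (Suc m) nu b j) c y"
  unfolding left_fac_def right_fac_def
  using Eunit_transpose[OF assms(1,3,4)] Eunit_transpose[OF assms(2,5,6)] by simp

lemma sum_prod_prod:
  "(\<Sum>q\<in>A \<times> B. \<Sum>r\<in>C \<times> D. F (fst q) (snd q) (fst r) (snd r)) =
    (\<Sum>a\<in>A. \<Sum>b\<in>B. \<Sum>c\<in>C. \<Sum>d\<in>D. F a b c d)"
proof -
  have "(\<Sum>r\<in>C \<times> D. F a b (fst r) (snd r)) = (\<Sum>c\<in>C. \<Sum>d\<in>D. F a b c d)" for a b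
    by (simp add: sum.cartesian_product case_prod_unfold)
  then show ?thesis by (simp add: sum.cartesian_product[of _ B A] case_prod_unfold)
qed

locale fixed_indices =
  fixes d m :: nat and one :: "nat list \<Rightarrow> tableau"
  assumes d: "2 \<le> d"
    and one: "\<And>alpha. is_partition d m alpha \<Longrightarrow> one alpha \<in> syt alpha"
begin

abbreviation "p \<equiv> Suc m"

abbreviation ext1 :: "nat list \<Rightarrow> nat list \<Rightarrow> tableau" where
  "ext1 mu alpha \<equiv> ext_tab mu alpha (one alpha)"

lemma one_wedge:
  assumes "is_partition d p mu" "alpha \<in> wedge d mu nu"
  shows "is_partition d m alpha" "one alpha \<in> syt alpha" "in_shape d alpha mu" "in_shape d alpha nu"
  using assms in_shape_partition[OF assms(1), of alpha] one by (auto simp: wedge_def)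

lemma ext1_syt:
  assumes "is_partition d p mu" "is_partition d p nu" "alpha \<in> wedge d mu nu"
  shows "ext1 mu alpha \<in> syt mu" "ext1 nu alpha \<in> syt nu"
  using one_wedge[OF assms(1,3)] ext_tab_syt[OF assms(1)] ext_tab_syt[OF assms(2)] by auto

text \<open>Schur--Weyl duality forces the compression of a product of matrix units into the span of the
  identity and the maximally entangled projector; the two coefficients are determined by two traces.\<close>

lemma compr_Eunit:
  assumes P: "is_partition d p mu" "is_partition d p nu"
    and a: "alpha \<in> wedge d mu nu" "beta \<in> wedge d mu nu"
  obtains v where "\<And>c c'. c \<in> pairs d \<Longrightarrow> c' \<in> pairs d \<Longrightarrow>
    compr d m (Eunit p mu (ext1 mu alpha) (ext1 mu beta)) (Eunit p nu (ext1 nu alpha) (ext1 nu beta)) c c' =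
      bmat d mu nu alpha beta * (if c = c' then 1 else 0) + v * (if fst c = snd c \<and> fst c' = snd c' then 1 else 0)"
proof -
  let ?A = "Eunit p mu (ext1 mu alpha) (ext1 mu beta)" and ?B = "Eunit p nu (ext1 nu alpha) (ext1 nu beta)"
  let ?X = "compr d m ?A ?B"
  obtain u v where uv: "\<And>a b a' b'. a < d \<Longrightarrow> b < d \<Longrightarrow> a' < d \<Longrightarrow> b' < d \<Longrightarrow>
    ?X (a, b) (a', b') = u * (if a = a' \<and> b = b' then 1 else 0) + v * (if a = b \<and> a' = b' then 1 else 0)"
    using compr_structure[OF commutes_tpow_Eunit commutes_tpow_Eunit d] by blast
  have X: "?X c c' = u * (if c = c' then 1 else 0) + v * (if fst c = snd c \<and> fst c' = snd c' then 1 else 0)"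
    if "c \<in> pairs d" "c' \<in> pairs d" for c c'
    using that uv[of "fst c" "snd c" "fst c'" "snd c'"]
    by (cases c; cases c') (simp add: pairs_def)
  note w1 = one_wedge[OF P(1) a(1)] and w2 = one_wedge[OF P(1) a(2)]
  note e1 = ext1_syt[OF P a(1)] and e2 = ext1_syt[OF P a(2)]
  let ?M = "\<lambda>l. of_nat (Defs.mult d l) :: complex"
  define T where "T = (if alpha = beta then ?M mu * ?M nu / ?M alpha else 0)"
  define S where "S = (if mu = nu then ?M mu else 0)"
  have ma: "?M alpha \<noteq> 0" using mult_pos[OF w1(1)] w1(2) by auto
  \<comment> \<open>Full trace: the two partial traces leave multiples of one idempotent, the
    diagonal unit of \<open>alpha\<close> at \<open>one alpha\<close>. Its trace is
    \<open>m_alpha\<close>, whence \<open>m_mu m_nu / m_alpha\<close>, and 0 for distinct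
    shapes.\<close>
  have T: "of_nat d ^ 2 * u + of_nat d * v = T"
  proof -
    have "of_nat d ^ 2 * u + of_nat d * v = (\<Sum>b\<in>pairs d. ?X b b)"
      using compr_traces(1)[of d ?X u v] X by simp
    also have "\<dots> = (\<Sum>a<d. \<Sum>b<d. \<Sum>s\<in>basis d m. \<Sum>t\<in>basis d m.
        ?A (s(p := a)) (t(p := a)) * ?B (s(p := b)) (t(p := b)))"
      by (simp add: sum_pairs compr_def)
    also have "\<dots> = (\<Sum>s\<in>basis d m. \<Sum>t\<in>basis d m. \<Sum>a<d. \<Sum>b<d.
        ?A (s(p := a)) (t(p := a)) * ?B (s(p := b)) (t(p := b)))"
      by (rule sum_swap_pairs)
    also have "\<dots> = (\<Sum>s\<in>basis d m. \<Sum>t\<in>basis d m.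
        (\<Sum>a<d. ?A (s(p := a)) (t(p := a))) * (\<Sum>b<d. ?B (s(p := b)) (t(p := b))))"
      by (simp only: sum_product)
    also have "\<dots> = (\<Sum>s\<in>basis d m. \<Sum>t\<in>basis d m. if alpha = beta then
        (?M mu / ?M alpha * ?M nu / ?M alpha) * (Eunit m alpha (one alpha) (one alpha) s t * Eunit m alpha (one alpha) (one alpha) t s) else 0)"
    proof (intro sum.cong refl)
      fix s t assume st: "s \<in> basis d m" "t \<in> basis d m"
      show "(\<Sum>a<d. ?A (s(p := a)) (t(p := a))) * (\<Sum>b<d. ?B (s(p := b)) (t(p := b))) = (if alpha = beta then
        (?M mu / ?M alpha * ?M nu / ?M alpha) * (Eunit m alpha (one alpha) (one alpha) s t * Eunit m alpha (one alpha) (one alpha) t s) else 0)"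
        unfolding Eunit_partial_trace[OF P(1) w1(3) w2(3) w1(2) w2(2) st]
          Eunit_partial_trace[OF P(2) w1(4) w2(4) w1(2) w2(2) st]
        using Eunit_transpose[OF w1(1,2,2), of t s] by (cases "alpha = beta") simp_all
    qed
    also have "\<dots> = (if alpha = beta then (?M mu / ?M alpha * ?M nu / ?M alpha) *
        (\<Sum>s\<in>basis d m. \<Sum>t\<in>basis d m. Eunit m alpha (one alpha) (one alpha) s t * Eunit m alpha (one alpha) (one alpha) t s) else 0)"
      by (simp only: sum_distrib_left if_distrib sum.neutral_const split: if_split) simp
    also have "(\<Sum>s\<in>basis d m. \<Sum>t\<in>basis d m. Eunit m alpha (one alpha) (one alpha) s t * Eunit m alpha (one alpha) (one alpha) t s) =
       (\<Sum>s\<in>basis d m. Eunit m alpha (one alpha) (one alpha) s s)"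
      using Eunit_mult[OF w1(1) w1(1) w1(2,2,2,2)] by (intro sum.cong refl) simp
    also have "\<dots> = ?M alpha" using Eunit_trace[OF w1(1,2,2)] by simp
    finally show ?thesis using ma by (simp add: T_def)
  qed
  \<comment> \<open>Contraction of all slots: transposing \<open>?B\<close> makes this a product of
    matrix units with matching inner index \<open>ext1 mu beta\<close>, so only the trace
    \<open>m_mu\<close> for \<open>mu = nu\<close> remains, for all \<open>alpha\<close> and
    \<open>beta\<close>.\<close>
  have S: "of_nat d * u + of_nat d ^ 2 * v = S"
  proof -
    have "of_nat d * u + of_nat d ^ 2 * v = (\<Sum>a<d. \<Sum>b<d. ?X (a, a) (b, b))"
      using compr_traces(2)[of d ?X u v] X by simp
    also have "\<dots> = (\<Sum>a<d. \<Sum>s\<in>basis d m. \<Sum>b<d. \<Sum>t\<in>basis d m.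
        ?A (s(p := a)) (t(p := b)) * ?B (s(p := a)) (t(p := b)))"
      unfolding compr_def fst_conv snd_conv by (rule sum.cong[OF refl], rule sum.swap)
    also have "\<dots> = (\<Sum>s\<in>basis d m. \<Sum>a<d. \<Sum>b<d. \<Sum>t\<in>basis d m.
        ?A (s(p := a)) (t(p := b)) * ?B (s(p := a)) (t(p := b)))"
      by (rule sum.swap)
    also have "\<dots> = (\<Sum>s\<in>basis d m. \<Sum>a<d. \<Sum>t\<in>basis d m. \<Sum>b<d.
        ?A (s(p := a)) (t(p := b)) * ?B (s(p := a)) (t(p := b)))"
      by (rule sum.cong[OF refl], rule sum.cong[OF refl], rule sum.swap)
    also have "\<dots> = (\<Sum>x\<in>basis d p. \<Sum>y\<in>basis d p. ?A x y * ?B x y)"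
      by (simp only: sum_basis_Suc)
    also have "\<dots> = (\<Sum>x\<in>basis d p. if mu = nu then Eunit p mu (ext1 mu alpha) (ext1 mu alpha) x x else 0)"
    proof (intro sum.cong refl)
      fix x assume x: "x \<in> basis d p"
      have "(\<Sum>y\<in>basis d p. ?A x y * ?B x y) = (\<Sum>y\<in>basis d p. ?A x y * Eunit p nu (ext1 nu beta) (ext1 nu alpha) y x)"
        using Eunit_transpose[OF P(2) e1(2) e2(2)] by simp
      also have "\<dots> = (if mu = nu then Eunit p mu (ext1 mu alpha) (ext1 mu alpha) x x else 0)"
        by (subst Eunit_mult[OF P e1(1) e2(1) e2(2) e1(2) x]) auto
      finally show "(\<Sum>y\<in>basis d p. ?A x y * ?B x y) =
        (if mu = nu then Eunit p mu (ext1 mu alpha) (ext1 mu alpha) x x else 0)" .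
    qed
    also have "\<dots> = S" using Eunit_trace[OF P(1) e1(1,1)] by (cases "mu = nu") (simp_all add: S_def)
    finally show ?thesis .
  qed
  define K :: complex where "K = of_nat d * (of_nat d ^ 2 - 1)"
  have K: "K \<noteq> 0"
  proof -
    have "(of_nat (d ^ 2) :: complex) \<noteq> of_nat 1"
      unfolding of_nat_eq_iff power2_eq_square using d by simp
    then show ?thesis using d by (simp add: K_def)
  qed
  have "K * u = of_nat d * (of_nat d ^ 2 * u + of_nat d * v) - (of_nat d * u + of_nat d ^ 2 * v)"
    by (simp add: K_def algebra_simps power2_eq_square)
  also have "\<dots> = of_nat d * T - S" unfolding T S ..
  finally have "of_nat d * T - S = K * u" ..
  then have "u = 1 / K * (of_nat d * T - S)" using K by simp
  also have "\<dots> = bmat d mu nu alpha beta"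
    unfolding bmat_def K_def by (simp add: T_def S_def)
  finally have u: "u = bmat d mu nu alpha beta" .
  show thesis by (rule that[OF X[unfolded u]])
qed

abbreviation Lf :: "nat list \<Rightarrow> nat list \<Rightarrow> tableau \<Rightarrow> tableau \<Rightarrow> nat list \<Rightarrow> (nat \<Rightarrow> nat) \<Rightarrow> nat \<times> nat \<Rightarrow> complex" where
  "Lf mu nu i j alpha \<equiv> left_fac d m (Eunit p mu i (ext1 mu alpha)) (Eunit p nu j (ext1 nu alpha))"

abbreviation Rf :: "nat list \<Rightarrow> nat list \<Rightarrow> tableau \<Rightarrow> tableau \<Rightarrow> nat list \<Rightarrow> nat \<times> nat \<Rightarrow> (nat \<Rightarrow> nat) \<Rightarrow> complex" where
  "Rf mu nu i j alpha \<equiv> right_fac d m (Eunit p mu (ext1 mu alpha) i) (Eunit p nu (ext1 nu alpha) j)"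

text \<open>Contracting a left factor over the diagonal pairs multiplies
  \<open>E_(i, 1_alpha)\<close> by \<open>E_(1_alpha, j)\<close>: the result is \<open>E_ij\<close>,
  free of \<open>alpha\<close>, and 0 unless \<open>mu = nu\<close>. This explains the deltas in
  \<open>H\<close> and why F(p) carries no \<open>alpha\<close>, and it lets \<open>dproj\<close>
  express both terms at once.\<close>

lemma Hop_factor:
  assumes P: "is_partition d p mu" "is_partition d p nu" "is_partition d p mu'" "is_partition d p nu'"
    and a: "alpha \<in> wedge d mu nu" "alpha' \<in> wedge d mu' nu'"
    and i: "i \<in> syt mu" "j \<in> syt nu" "i' \<in> syt mu'" "j' \<in> syt nu'"
    and y: "y \<in> basis d (2 * p)" and x: "x \<in> basis d (2 * p)"
  shows "Hop d p one mu nu mu' nu' i j i' j' alpha alpha' y x =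
    (\<Sum>c\<in>pairs d. \<Sum>c'\<in>pairs d. Lf mu nu i j alpha y c * dproj d c c' * Rf mu' nu' i' j' alpha' c' x)"
proof -
  note e = ext1_syt[OF P(1,2) a(1)] and e' = ext1_syt[OF P(3,4) a(2)]
  note ys = slots_basis[OF y] and xs = slots_basis[OF x]
  let ?L = "Lf mu nu i j alpha y" and ?R = "\<lambda>c. Rf mu' nu' i' j' alpha' c x"
  have L: "(\<Sum>a<d. ?L (a, a)) = (if mu = nu then Eunit p mu i j (slotsA p y) (slotsB p y) else 0)"
    unfolding left_fac_diag Eunit_transpose[OF P(2) i(2) e(2)]
    by (subst Eunit_mult[OF P(1,2) i(1) e(1) e(2) i(2) ys(1)]) auto
  have R: "(\<Sum>a<d. ?R (a, a)) = (if mu' = nu' then Eunit p mu' i' j' (slotsA p x) (slotsB p x) else 0)"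
    unfolding right_fac_diag Eunit_transpose[OF P(3) e'(1) i(3)]
    by (subst Eunit_mult[OF P(3,4) i(3) e'(1) e'(2) i(4) xs(1)]) auto
  have F: "Fp d p mu mu' i j i' j' y x = Eunit p mu i j (slotsA p y) (slotsB p y) * Eunit p mu' j' i' (slotsB p x) (slotsA p x)"
    unfolding Fp_def sandwich_full left_fac_diag right_fac_diag op_id_def mat_id_def
    using ys(2) xs(2)
    by (simp add: if_distrib[of "\<lambda>z. _ * z"] cong: if_cong)
  have "(\<Sum>c\<in>pairs d. \<Sum>c'\<in>pairs d. ?L c * dproj d c c' * ?R c') =
      (\<Sum>c'\<in>pairs d. (\<Sum>c\<in>pairs d. ?L c * dproj d c c') * ?R c')"
    by (subst sum.swap) (simp only: sum_distrib_right)
  also have "\<dots> = (\<Sum>c'\<in>pairs d. of_nat d * (?L c' * ?R c') - (if fst c' = snd c' then (\<Sum>a<d. ?L (a, a)) * ?R c' else 0))"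
    by (intro sum.cong refl) (simp only: sum_dproj_left, simp add: algebra_simps)
  also have "\<dots> = of_nat d * (\<Sum>c'\<in>pairs d. ?L c' * ?R c') - (\<Sum>a<d. ?L (a, a)) * (\<Sum>a<d. ?R (a, a))"
    unfolding sum_subtractf sum_pairs_diag by (simp only: sum_distrib_left)
  also have "(\<Sum>a<d. ?L (a, a)) * (\<Sum>a<d. ?R (a, a)) =
      (if mu = nu \<and> mu' = nu' then Fp d p mu mu' i j i' j' y x else 0)"
    unfolding L R F using Eunit_transpose[OF P(3) i(3), of j' "slotsA p x" "slotsB p x"] i(4) by auto
  also have "(\<Sum>c'\<in>pairs d. ?L c' * ?R c') = Fpm1 d p one mu nu mu' nu' i j i' j' alpha alpha' y x"
    unfolding Fpm1_def diff_Suc_1 sandwich_pred ..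
  finally show ?thesis by (simp add: Hop_def)
qed

text \<open>The inner indices produce the deltas here: \<open>Eunit_mult\<close> merges the right
  factor with the left one, \<open>compr_Eunit\<close> gives the compression up to the unspecified
  \<open>v\<close>, and \<open>dproj_sandwich\<close> removes \<open>v\<close>.\<close>

lemma middle_factor:
  assumes P: "is_partition d p mu" "is_partition d p nu" "is_partition d p mu'" "is_partition d p nu'"
    and a: "alpha \<in> wedge d mu nu" "alpha' \<in> wedge d mu' nu'"
    and i: "i \<in> syt mu" "j \<in> syt nu" "i' \<in> syt mu'" "j' \<in> syt nu'"
    and c: "c \<in> pairs d" "c' \<in> pairs d"
  shows "(\<Sum>b\<in>pairs d. dproj d c b * (\<Sum>b'\<in>pairs d.
      (\<Sum>z\<in>basis d (2 * p). Rf mu nu i j alpha b z * Lf mu' nu' i' j' alpha' z b') * dproj d b' c')) =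
    (if mu = mu' \<and> nu = nu' \<and> i = i' \<and> j = j' then of_nat d * bmat d mu nu alpha alpha' * dproj d c c' else 0)"
proof -
  note e = ext1_syt[OF P(1,2) a(1)] and e' = ext1_syt[OF P(3,4) a(2)]
  define k1 where "k1 = (if mu = mu' \<and> i = i' then 1 else (0 :: complex))"
  define k2 where "k2 = (if nu = nu' \<and> j = j' then 1 else (0 :: complex))"
  let ?X = "compr d m (Eunit p mu (ext1 mu alpha) (ext1 mu' alpha')) (Eunit p nu (ext1 nu alpha) (ext1 nu' alpha'))"
  have RL: "(\<Sum>z\<in>basis d (2 * p). Rf mu nu i j alpha b z * Lf mu' nu' i' j' alpha' z b') = k1 * k2 * ?X b b'"
    if "b \<in> pairs d" "b' \<in> pairs d" for b b'
    by (rule right_left_compr[OF that])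
      (simp_all add: Eunit_mult[OF P(1,3) e(1) i(1) i(3) e'(1)] Eunit_mult[OF P(2,4) e(2) i(2) i(4) e'(2)] k1_def k2_def)
  show ?thesis
  proof (cases "mu = mu' \<and> nu = nu' \<and> i = i' \<and> j = j'")
    case False
    then have "k1 * k2 = 0" by (auto simp: k1_def k2_def)
    then have "(\<Sum>b\<in>pairs d. dproj d c b * (\<Sum>b'\<in>pairs d.
      (\<Sum>z\<in>basis d (2 * p). Rf mu nu i j alpha b z * Lf mu' nu' i' j' alpha' z b') * dproj d b' c')) = 0"
    proof (intro sum.neutral ballI)
      fix b assume b: "b \<in> pairs d"
      have "(\<Sum>b'\<in>pairs d. (\<Sum>z\<in>basis d (2 * p). Rf mu nu i j alpha b z * Lf mu' nu' i' j' alpha' z b') * dproj d b' c') = 0"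
        using b \<open>k1 * k2 = 0\<close> by (intro sum.neutral ballI) (simp only: RL mult_zero_left)
      then show "dproj d c b * (\<Sum>b'\<in>pairs d.
        (\<Sum>z\<in>basis d (2 * p). Rf mu nu i j alpha b z * Lf mu' nu' i' j' alpha' z b') * dproj d b' c') = 0"
        by (simp only: mult_zero_right)
    qed
    then show ?thesis unfolding if_not_P[OF False] .
  next
    case True
    then have k: "k1 * k2 = 1" by (simp add: k1_def k2_def)
    have a': "alpha' \<in> wedge d mu nu" using a(2) True by simp
    obtain v where v: "\<And>c c'. c \<in> pairs d \<Longrightarrow> c' \<in> pairs d \<Longrightarrow>
      compr d m (Eunit p mu (ext1 mu alpha) (ext1 mu alpha')) (Eunit p nu (ext1 nu alpha) (ext1 nu alpha')) c c' =
      bmat d mu nu alpha alpha' * (if c = c' then 1 else 0) + v * (if fst c = snd c \<and> fst c' = snd c' then 1 else 0)"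
      using compr_Eunit[OF P(1,2) a(1) a'] by blast
    have "(\<Sum>z\<in>basis d (2 * p). Rf mu nu i j alpha b z * Lf mu' nu' i' j' alpha' z b') =
      bmat d mu nu alpha alpha' * (if b = b' then 1 else 0) + v * (if fst b = snd b \<and> fst b' = snd b' then 1 else 0)"
      if "b \<in> pairs d" "b' \<in> pairs d" for b b'
      unfolding RL[OF that] k using v[OF that] True by simp
    from dproj_sandwich[OF this c] show ?thesis unfolding if_P[OF True] .
  qed
qed

lemma Hop_mult:
  assumes P: "is_partition d p mu" "is_partition d p nu" "is_partition d p mu'" "is_partition d p nu'"
      "is_partition d p mut" "is_partition d p nut" "is_partition d p mu''" "is_partition d p nu''"
    and a: "alpha \<in> wedge d mu nu" "alpha' \<in> wedge d mu' nu'" "beta \<in> wedge d mut nut" "beta' \<in> wedge d mu'' nu''"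
    and i: "i \<in> syt mu" "j \<in> syt nu" "i' \<in> syt mu'" "j' \<in> syt nu'"
      "k \<in> syt mut" "l \<in> syt nut" "k' \<in> syt mu''" "l' \<in> syt nu''"
    and y: "y \<in> basis d (2 * p)" and x: "x \<in> basis d (2 * p)"
  shows "(\<Sum>z\<in>basis d (2 * p). Hop d p one mu nu mu' nu' i j i' j' alpha alpha' y z *
      Hop d p one mut nut mu'' nu'' k l k' l' beta beta' z x) =
    (if mu' = mut \<and> nu' = nut \<and> i' = k \<and> j' = l
     then of_nat d * bmat d mu' nu' alpha' beta * Hop d p one mu nu mu'' nu'' i j k' l' alpha beta' y x else 0)"
proof -
  let ?Z = "basis d (2 * p)" and ?Q = "pairs d"
  let ?L = "Lf mu nu i j alpha y" and ?R = "Rf mu' nu' i' j' alpha'" and ?L' = "Lf mut nut k l beta"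
    and ?R' = "\<lambda>c. Rf mu'' nu'' k' l' beta' c x" and ?D = "dproj d"
  have "(\<Sum>z\<in>?Z. Hop d p one mu nu mu' nu' i j i' j' alpha alpha' y z *
      Hop d p one mut nut mu'' nu'' k l k' l' beta beta' z x) =
    (\<Sum>z\<in>?Z. (\<Sum>c\<in>?Q. \<Sum>b\<in>?Q. ?L c * ?D c b * ?R b z) * (\<Sum>b'\<in>?Q. \<Sum>c'\<in>?Q. ?L' z b' * ?D b' c' * ?R' c'))"
    by (intro sum.cong refl) (simp only: Hop_factor[OF P(1-4) a(1,2) i(1-4) y] Hop_factor[OF P(5-8) a(3,4) i(5-8) _ x])
  \<comment> \<open>Index pairs are bundled so that a single exchange of three sums moves the sum
    over \<open>z\<close> inward.\<close>
  also have "\<dots> = (\<Sum>z\<in>?Z. \<Sum>q\<in>?Q \<times> ?Q. \<Sum>r\<in>?Q \<times> ?Q.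
      (?L (fst q) * ?D (fst q) (snd q) * ?R (snd q) z) * (?L' z (fst r) * ?D (fst r) (snd r) * ?R' (snd r)))"
    by (simp only: sum.cartesian_product sum_product case_prod_unfold)
  also have "\<dots> = (\<Sum>q\<in>?Q \<times> ?Q. \<Sum>r\<in>?Q \<times> ?Q. \<Sum>z\<in>?Z.
      (?L (fst q) * ?D (fst q) (snd q) * ?R (snd q) z) * (?L' z (fst r) * ?D (fst r) (snd r) * ?R' (snd r)))"
    by (rule sum_rotate3)
  also have "\<dots> = (\<Sum>q\<in>?Q \<times> ?Q. \<Sum>r\<in>?Q \<times> ?Q. ?L (fst q) * (?D (fst q) (snd q) *
      ((\<Sum>z\<in>?Z. ?R (snd q) z * ?L' z (fst r)) * ?D (fst r) (snd r))) * ?R' (snd r))"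
    by (simp only: sum_distrib_left sum_distrib_right mult.assoc)
  also have "\<dots> = (\<Sum>c\<in>?Q. \<Sum>b\<in>?Q. \<Sum>b'\<in>?Q. \<Sum>c'\<in>?Q. ?L c * (?D c b *
      ((\<Sum>z\<in>?Z. ?R b z * ?L' z b') * ?D b' c')) * ?R' c')"
    by (rule sum_prod_prod[where F = "\<lambda>c b b' c'. ?L c * (?D c b *
      ((\<Sum>z\<in>?Z. ?R b z * ?L' z b') * ?D b' c')) * ?R' c'"])
  also have "\<dots> = (\<Sum>c\<in>?Q. \<Sum>c'\<in>?Q. \<Sum>b\<in>?Q. \<Sum>b'\<in>?Q. ?L c * (?D c b *
      ((\<Sum>z\<in>?Z. ?R b z * ?L' z b') * ?D b' c')) * ?R' c')"
    by (rule sum.cong[OF refl], rule sum_rotate3[symmetric])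
  also have "\<dots> = (\<Sum>c\<in>?Q. \<Sum>c'\<in>?Q. ?L c * (\<Sum>b\<in>?Q. ?D c b *
      (\<Sum>b'\<in>?Q. (\<Sum>z\<in>?Z. ?R b z * ?L' z b') * ?D b' c')) * ?R' c')"
    by (simp only: sum_distrib_left[symmetric] sum_distrib_right[symmetric])
  also have "\<dots> = (\<Sum>c\<in>?Q. \<Sum>c'\<in>?Q. ?L c * (if mu' = mut \<and> nu' = nut \<and> i' = k \<and> j' = l
      then of_nat d * bmat d mu' nu' alpha' beta * ?D c c' else 0) * ?R' c')"
    by (intro sum.cong refl) (simp only: middle_factor[OF P(3-6) a(2,3) i(3-6)])
  also have "\<dots> = (if mu' = mut \<and> nu' = nut \<and> i' = k \<and> j' = l
     then of_nat d * bmat d mu' nu' alpha' beta * Hop d p one mu nu mu'' nu'' i j k' l' alpha beta' y x else 0)"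
  proof (cases "mu' = mut \<and> nu' = nut \<and> i' = k \<and> j' = l")
    case True
    show ?thesis
      unfolding if_P[OF True] Hop_factor[OF P(1,2,7,8) a(1,4) i(1,2,7,8) y x] sum_distrib_left
      by (intro sum.cong refl) (simp only: mult_ac)
  next
    case False
    show ?thesis unfolding if_not_P[OF False] by simp
  qed
  finally show ?thesis .
qed

text \<open>The matrix \<open>b\<close> is a Gram matrix, so its diagonalised entries are nonnegative; this is what makes
  the product of the square roots in the denominators of \<open>G\<close> well behaved.\<close>

lemma bmat_gram:
  assumes P: "is_partition d p mu" "is_partition d p nu" and i: "i \<in> syt mu" "j \<in> syt nu"
  obtains r where "0 \<le> r"
    "(\<Sum>a\<in>wedge d mu nu. \<Sum>b\<in>wedge d mu nu. w a * bmat d mu nu a b * cnj (w b)) = complex_of_real r"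
proof -
  let ?W = "wedge d mu nu" and ?Q = "pairs d" and ?Z = "basis d (2 * p)"
  \<comment> \<open>An off-diagonal pair, available since \<open>d \<ge> 2\<close>. There
    \<open>dproj\<close> has diagonal entry \<open>d\<close>, so the real vectors \<open>V a\<close>
    have Gram matrix exactly \<open>d\<^sup>2\<close> times \<open>b\<close>.\<close>
  define c0 :: "nat \<times> nat" where "c0 = (0, 1)"
  have c0: "c0 \<in> ?Q" "dproj d c0 c0 = of_nat d" using d by (auto simp: c0_def pairs_def dproj_def)
  define V where "V a y = (\<Sum>c\<in>?Q. Lf mu nu i j a y c * dproj d c c0)" for a y
  define Q where "Q y = (\<Sum>a\<in>?W. cnj (w a) * V a y)" for y
  have VR: "V a y = (\<Sum>c\<in>?Q. dproj d c0 c * Rf mu nu i j a c y)" if "a \<in> ?W" for a y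
    unfolding V_def left_fac_Eunit_transpose[OF P i(1) ext1_syt(1)[OF P that] i(2) ext1_syt(2)[OF P that]]
    by (simp only: dproj_sym[of d _ c0] mult.commute)
  have Vc: "cnj (V a y) = V a y" for a y
    by (simp add: V_def left_fac_Eunit_cnj dproj_cnj)
  have VV: "(\<Sum>y\<in>?Z. V a y * V b y) = of_nat d * bmat d mu nu a b * of_nat d" if "a \<in> ?W" "b \<in> ?W" for a b
  proof -
    have "(\<Sum>y\<in>?Z. V a y * V b y) = (\<Sum>y\<in>?Z. \<Sum>c\<in>?Q. \<Sum>c'\<in>?Q.
        dproj d c0 c * ((Rf mu nu i j a c y * Lf mu nu i j b y c') * dproj d c' c0))"
      unfolding VR[OF that(1)] V_def[of b] by (simp only: sum_product mult.assoc)
    also have "\<dots> = (\<Sum>c\<in>?Q. \<Sum>c'\<in>?Q. \<Sum>y\<in>?Z.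
        dproj d c0 c * ((Rf mu nu i j a c y * Lf mu nu i j b y c') * dproj d c' c0))"
      by (rule sum_rotate3)
    also have "\<dots> = (\<Sum>c\<in>?Q. dproj d c0 c * (\<Sum>c'\<in>?Q.
        (\<Sum>y\<in>?Z. Rf mu nu i j a c y * Lf mu nu i j b y c') * dproj d c' c0))"
      by (simp only: sum_distrib_left sum_distrib_right)
    also have "\<dots> = of_nat d * bmat d mu nu a b * of_nat d"
      using middle_factor[OF P P that i i c0(1) c0(1)] c0(2) by simp
    finally show ?thesis .
  qed
  have "(\<Sum>y\<in>?Z. cnj (Q y) * Q y) = (\<Sum>y\<in>?Z. \<Sum>a\<in>?W. \<Sum>b\<in>?W. w a * cnj (w b) * (V a y * V b y))"
    by (simp add: Q_def Vc sum_product mult_ac)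
  also have "\<dots> = (\<Sum>a\<in>?W. \<Sum>b\<in>?W. \<Sum>y\<in>?Z. w a * cnj (w b) * (V a y * V b y))"
    by (rule sum_rotate3)
  also have "\<dots> = (\<Sum>a\<in>?W. \<Sum>b\<in>?W. w a * cnj (w b) * (of_nat d * bmat d mu nu a b * of_nat d))"
    by (intro sum.cong refl) (simp only: sum_distrib_left[symmetric] VV)
  also have "\<dots> = of_nat d ^ 2 * (\<Sum>a\<in>?W. \<Sum>b\<in>?W. w a * bmat d mu nu a b * cnj (w b))"
    unfolding sum_distrib_left power2_eq_square by (intro sum.cong refl) (simp only: mult_ac)
  finally have "of_nat d ^ 2 * (\<Sum>a\<in>?W. \<Sum>b\<in>?W. w a * bmat d mu nu a b * cnj (w b)) = (\<Sum>y\<in>?Z. cnj (Q y) * Q y)" ..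
  also have "\<dots> = complex_of_real (\<Sum>y\<in>?Z. (cmod (Q y))\<^sup>2)"
    by (simp only: of_real_sum complex_norm_square mult.commute)
  finally have "(\<Sum>a\<in>?W. \<Sum>b\<in>?W. w a * bmat d mu nu a b * cnj (w b)) =
      complex_of_real ((\<Sum>y\<in>?Z. (cmod (Q y))\<^sup>2) / real d ^ 2)"
    using d by (simp add: field_simps)
  moreover have "0 \<le> (\<Sum>y\<in>?Z. (cmod (Q y))\<^sup>2) / real d ^ 2" by (simp add: sum_nonneg)
  ultimately show thesis using that by blast
qed

lemma bdiag_nonneg:
  assumes "is_partition d p mu" "is_partition d p nu" "i \<in> syt mu" "j \<in> syt nu"
  obtains r where "0 \<le> r" "bdiag d U mu nu beta = complex_of_real r"
  using bmat_gram[OF assms, of "U mu nu beta"] unfolding bdiag_def conj_b_def by blast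

end

theorem theorem20:
  fixes d p :: nat
    and one :: "nat list \<Rightarrow> tableau"
    and U :: "nat list \<Rightarrow> nat list \<Rightarrow> nat list \<Rightarrow> nat list \<Rightarrow> complex"
    and mu nu mu' nu' mut nut mu'' nu'' :: "nat list"
    and beta beta' betat betat' :: "nat list"
    and i j i' j' k l k' l' :: tableau
  assumes "d \<ge> 2" and "p \<ge> 2"
    and one: "\<And>alpha. is_partition d (p - 1) alpha \<Longrightarrow> one alpha \<in> syt alpha"
    and U: "\<And>m n. is_partition d p m \<Longrightarrow> is_partition d p n \<Longrightarrow> wedge d m n \<noteq> {} \<Longrightarrow>
              unitary_on (wedge d m n) (U m n) \<and>
              (\<forall>a\<in>wedge d m n. \<forall>a'\<in>wedge d m n. a \<noteq> a' \<longrightarrow> conj_b d U m n a a' = 0)"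
    and parts: "is_partition d p mu" "is_partition d p nu" "is_partition d p mu'" "is_partition d p nu'"
      "is_partition d p mut" "is_partition d p nut" "is_partition d p mu''" "is_partition d p nu''"
    and betas: "beta \<in> wedge d mu nu" "beta' \<in> wedge d mu' nu'"
      "betat \<in> wedge d mut nut" "betat' \<in> wedge d mu'' nu''"
    and nz: "bdiag d U mu nu beta \<noteq> 0" "bdiag d U mu' nu' beta' \<noteq> 0"
      "bdiag d U mut nut betat \<noteq> 0" "bdiag d U mu'' nu'' betat' \<noteq> 0"
    and idx: "i \<in> syt mu" "j \<in> syt nu" "i' \<in> syt mu'" "j' \<in> syt nu'"
      "k \<in> syt mut" "l \<in> syt nut" "k' \<in> syt mu''" "l' \<in> syt nu''"
  shows "\<forall>y\<in>basis d (2 * p). \<forall>x\<in>basis d (2 * p).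
           op_mult d (2 * p)
             (Gop d p one U mu nu mu' nu' i j i' j' beta beta')
             (Gop d p one U mut nut mu'' nu'' k l k' l' betat betat') y x
           = (if beta' = betat \<and> mu' = mut \<and> nu' = nut \<and> i' = k \<and> j' = l
              then Gop d p one U mu nu mu'' nu'' i j k' l' beta betat' y x
              else 0)"
proof (intro ballI)
  fix y x assume y: "y \<in> basis d (2 * p)" and x: "x \<in> basis d (2 * p)"
  obtain m where pm: "p = Suc m" using \<open>p \<ge> 2\<close> by (cases p) auto
  interpret fixed_indices d m one
    using \<open>d \<ge> 2\<close> one by unfold_locales (simp_all add: pm)
  note P = parts[unfolded pm]
  let ?Z = "basis d (2 * p)"
  let ?W1 = "wedge d mu nu" and ?W2 = "wedge d mu' nu'" and ?W3 = "wedge d mut nut" and ?W4 = "wedge d mu'' nu''"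
  let ?H1 = "Hop d p one mu nu mu' nu' i j i' j'" and ?H2 = "Hop d p one mut nut mu'' nu'' k l k' l'"
    and ?H = "Hop d p one mu nu mu'' nu'' i j k' l'"
  \<comment> \<open>On nonnegative reals \<open>csqrt\<close> is multiplicative. Three values
    suffice, because in the surviving case \<open>betat\<close> shares \<open>r2\<close> with
    \<open>beta'\<close>.\<close>
  obtain r1 where r1: "0 \<le> r1" "bdiag d U mu nu beta = complex_of_real r1"
    using bdiag_nonneg[OF P(1,2) idx(1,2)] by blast
  obtain r2 where r2: "0 \<le> r2" "bdiag d U mu' nu' beta' = complex_of_real r2"
    using bdiag_nonneg[OF P(3,4) idx(3,4)] by blast
  obtain r4 where r4: "0 \<le> r4" "bdiag d U mu'' nu'' betat' = complex_of_real r4"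
    using bdiag_nonneg[OF P(7,8) idx(7,8)] by blast
  let ?n1 = "of_nat d * csqrt (bdiag d U mu nu beta * bdiag d U mu' nu' beta')"
  let ?n2 = "of_nat d * csqrt (bdiag d U mut nut betat * bdiag d U mu'' nu'' betat')"
  let ?GG = "op_mult d (2 * p) (Gop d p one U mu nu mu' nu' i j i' j' beta beta')
             (Gop d p one U mut nut mu'' nu'' k l k' l' betat betat') y x"
  let ?u = "\<lambda>q r. (cnj (U mu nu beta (fst q)) * U mu' nu' beta' (snd q)) *
       (cnj (U mut nut betat (fst r)) * U mu'' nu'' betat' (snd r))"
  let ?cond = "mu' = mut \<and> nu' = nut \<and> i' = k \<and> j' = l"
  have prod: "?GG =
    (\<Sum>q\<in>?W1 \<times> ?W2. \<Sum>r\<in>?W3 \<times> ?W4. ?u q r *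
       (\<Sum>z\<in>?Z. ?H1 (fst q) (snd q) y z * ?H2 (fst r) (snd r) z x)) / (?n1 * ?n2)"
  proof -
    have "?GG =
      (\<Sum>z\<in>?Z. (\<Sum>q\<in>?W1 \<times> ?W2. cnj (U mu nu beta (fst q)) * U mu' nu' beta' (snd q) * ?H1 (fst q) (snd q) y z) *
        (\<Sum>r\<in>?W3 \<times> ?W4. cnj (U mut nut betat (fst r)) * U mu'' nu'' betat' (snd r) * ?H2 (fst r) (snd r) z x)) / (?n1 * ?n2)"
      unfolding op_mult_def mat_mult_on_def Gop_def times_divide_times_eq sum_divide_distrib[symmetric]
        sum.cartesian_product case_prod_unfold ..
    also have "(\<Sum>z\<in>?Z. (\<Sum>q\<in>?W1 \<times> ?W2. cnj (U mu nu beta (fst q)) * U mu' nu' beta' (snd q) * ?H1 (fst q) (snd q) y z) *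
        (\<Sum>r\<in>?W3 \<times> ?W4. cnj (U mut nut betat (fst r)) * U mu'' nu'' betat' (snd r) * ?H2 (fst r) (snd r) z x)) =
      (\<Sum>z\<in>?Z. \<Sum>q\<in>?W1 \<times> ?W2. \<Sum>r\<in>?W3 \<times> ?W4. ?u q r * (?H1 (fst q) (snd q) y z * ?H2 (fst r) (snd r) z x))"
      by (simp only: sum_product mult_ac)
    also have "\<dots> = (\<Sum>q\<in>?W1 \<times> ?W2. \<Sum>r\<in>?W3 \<times> ?W4. \<Sum>z\<in>?Z. ?u q r * (?H1 (fst q) (snd q) y z * ?H2 (fst r) (snd r) z x))"
      by (rule sum_rotate3)
    finally show ?thesis by (simp only: sum_distrib_left)
  qed
  have HH: "(\<Sum>z\<in>?Z. ?H1 (fst q) (snd q) y z * ?H2 (fst r) (snd r) z x) =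
     (if ?cond then of_nat d * bmat d mu' nu' (snd q) (fst r) * ?H (fst q) (snd r) y x else 0)"
    if q: "q \<in> ?W1 \<times> ?W2" and r: "r \<in> ?W3 \<times> ?W4" for q r
  proof -
    have mem: "fst q \<in> ?W1" "snd q \<in> ?W2" "fst r \<in> ?W3" "snd r \<in> ?W4" using q r by auto
    show ?thesis
      using Hop_mult[OF P mem idx y[unfolded pm] x[unfolded pm]] unfolding pm .
  qed
  show "?GG
           = (if beta' = betat \<and> mu' = mut \<and> nu' = nut \<and> i' = k \<and> j' = l
              then Gop d p one U mu nu mu'' nu'' i j k' l' beta betat' y x else 0)"
  proof (cases ?cond)
    case False
    have "(\<Sum>q\<in>?W1 \<times> ?W2. \<Sum>r\<in>?W3 \<times> ?W4. ?u q r *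
       (\<Sum>z\<in>?Z. ?H1 (fst q) (snd q) y z * ?H2 (fst r) (snd r) z x)) = 0"
      by (intro sum.neutral ballI) (simp only: HH if_not_P[OF False] mult_zero_right)
    then have "?GG = 0"
      unfolding prod by simp
    then show ?thesis using False by auto
  next
    case True
    \<comment> \<open>The inner sums over \<open>a'\<close> and \<open>c\<close> conjugate
      \<open>b\<close> by \<open>U\<close> and give the entry at \<open>beta'\<close> and
      \<open>betat\<close>, which is 0 off the diagonal by the choice of \<open>U\<close>.\<close>
    let ?b = "conj_b d U mu' nu' beta' betat"
    have W3: "?W3 = ?W2" using True by simp
    have "(\<Sum>q\<in>?W1 \<times> ?W2. \<Sum>r\<in>?W3 \<times> ?W4. ?u q r *
       (\<Sum>z\<in>?Z. ?H1 (fst q) (snd q) y z * ?H2 (fst r) (snd r) z x)) =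
      (\<Sum>q\<in>?W1 \<times> ?W2. \<Sum>r\<in>?W3 \<times> ?W4. ?u q r *
       (of_nat d * bmat d mu' nu' (snd q) (fst r) * ?H (fst q) (snd r) y x))"
      by (intro sum.cong refl) (simp only: HH if_P[OF True])
    also have "\<dots> = (\<Sum>a\<in>?W1. \<Sum>a'\<in>?W2. \<Sum>c\<in>?W2. \<Sum>c'\<in>?W4. (cnj (U mu nu beta a) * U mu' nu' beta' a') *
       (cnj (U mu' nu' betat c) * U mu'' nu'' betat' c') *
       (of_nat d * bmat d mu' nu' a' c * ?H a c' y x))"
    proof -
      have eq: "mut = mu'" "nut = nu'" using True by auto
      show ?thesis unfolding eq
        by (rule sum_prod_prod[where F = "\<lambda>a a' c c'. (cnj (U mu nu beta a) * U mu' nu' beta' a') *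
         (cnj (U mu' nu' betat c) * U mu'' nu'' betat' c') *
         (of_nat d * bmat d mu' nu' a' c * ?H a c' y x)"])
    qed
    also have "\<dots> = (\<Sum>a\<in>?W1. \<Sum>c'\<in>?W4. \<Sum>a'\<in>?W2. \<Sum>c\<in>?W2. (cnj (U mu nu beta a) * U mu' nu' beta' a') *
       (cnj (U mu' nu' betat c) * U mu'' nu'' betat' c') *
       (of_nat d * bmat d mu' nu' a' c * ?H a c' y x))"
      by (rule sum.cong[OF refl], rule sum_rotate3[symmetric])
    also have "\<dots> = of_nat d * ?b * (\<Sum>a\<in>?W1. \<Sum>c'\<in>?W4. cnj (U mu nu beta a) * U mu'' nu'' betat' c' * ?H a c' y x)"
      unfolding conj_b_def sum_distrib_left sum_distrib_right by (simp only: mult_ac)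
    finally have val: "?GG =
       of_nat d * ?b * (\<Sum>a\<in>?W1. \<Sum>c'\<in>?W4. cnj (U mu nu beta a) * U mu'' nu'' betat' c' * ?H a c' y x) / (?n1 * ?n2)"
      unfolding prod by (simp only:)
    show ?thesis
    proof (cases "beta' = betat")
      case False
      have "?b = 0" using U[OF parts(3,4)] betas(2,3) False True W3 by blast
      then show ?thesis unfolding val using False by simp
    next
      case beq: True
      have b: "?b = complex_of_real r2" using r2 beq by (simp add: bdiag_def)
      have r2n: "r2 \<noteq> 0" using r2 nz(2) by auto
      have s: "csqrt (complex_of_real r) = complex_of_real (sqrt r)" if "0 \<le> r" for r
        using that by (simp add: csqrt_of_real_nonneg)
      have n1: "?n1 = complex_of_real (real d * (sqrt r1 * sqrt r2))"
        unfolding r1 r2 of_real_mult[symmetric] using r1 r2 by (simp add: s real_sqrt_mult)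
      have n2: "?n2 = complex_of_real (real d * (sqrt r2 * sqrt r4))"
      proof -
        have "bdiag d U mut nut betat = complex_of_real r2" using r2 True beq by simp
        then show ?thesis unfolding r4 of_real_mult[symmetric] using r2 r4 by (simp add: s real_sqrt_mult)
      qed
      have n: "of_nat d * csqrt (bdiag d U mu nu beta * bdiag d U mu'' nu'' betat') = complex_of_real (real d * (sqrt r1 * sqrt r4))"
        unfolding r1 r4 of_real_mult[symmetric] using r1 r4 by (simp add: s real_sqrt_mult)
      \<comment> \<open>The two denominators share \<open>sqrt r2\<close>, whose square cancels the
        entry \<open>?b\<close>; one of their two factors \<open>d\<close> cancels the
        \<open>d\<close> contributed by \<open>Hop_mult\<close>.\<close>
      have "?n1 * ?n2 = of_nat d * ?b * complex_of_real (real d * (sqrt r1 * sqrt r4))"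
      proof -
        have sq: "sqrt r2 * sqrt r2 = r2" using r2(1) by simp
        have "real d * (sqrt r1 * sqrt r2) * (real d * (sqrt r2 * sqrt r4)) =
            real d * (sqrt r2 * sqrt r2) * (real d * (sqrt r1 * sqrt r4))" by (simp only: mult_ac)
        then have "complex_of_real (real d * (sqrt r1 * sqrt r2)) * complex_of_real (real d * (sqrt r2 * sqrt r4)) =
            complex_of_real (real d) * complex_of_real r2 * complex_of_real (real d * (sqrt r1 * sqrt r4))"
          unfolding sq by (simp only: of_real_mult[symmetric])
        then show ?thesis unfolding n1 n2 b by (simp only: of_real_of_nat_eq)
      qed
      moreover have "of_nat d * ?b \<noteq> 0" using b r2n \<open>d \<ge> 2\<close> by simp
      ultimately have "?GG =
         (\<Sum>a\<in>?W1. \<Sum>c'\<in>?W4. cnj (U mu nu beta a) * U mu'' nu'' betat' c' * ?H a c' y x) /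
           complex_of_real (real d * (sqrt r1 * sqrt r4))"
        unfolding val by (simp only: nonzero_mult_divide_mult_cancel_left not_False_eq_True)
      also have "\<dots> = Gop d p one U mu nu mu'' nu'' i j k' l' beta betat' y x"
        unfolding Gop_def n ..
      finally show ?thesis using True beq by simp
    qed
  qed
qed

end
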